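(* Let $F$ be a field of characteristic zero and $k\ge2$, and let $e:=e_{12}$ if $k=2$ and $e:=e_{31}$ if $k\ge3$. The set of generators (as a $T_U$-ideal) of $\operatorname{Id}^U(M_k(F))$ formed by $$x^{e_{12}e_{12}}y^{e_{12}e},\qquad x^{e_{12}e_{12}}y^{e_{12}e_{21}}-y^{e_{12}e_{12}}x^{e_{12}e_{21}},\qquad [x^{gg},y^{gg}],\qquad [x^{gg},y^{e_{12}e_{12}}]$$ is minimal, i.e. no proper subset of it generates $\operatorname{Id}^U(M_k(F))$ as a $T_U$-ideal.
   Context: $L=\operatorname{Der}(M_k(F))$, identified with $\mathrm{sl}_k(F)$ via $c\mapsto\operatorname{ad}_c$, $\operatorname{ad}_c(x)=cx-xc$; $\phi:U(L)\to\operatorname{End}_F(M_k(F))$ is the unital algebra homomorphism from the universal enveloping algebra extending this action, and $U:=\phi(U(L))$. $e_{ij}$ are matrix units, $h_i:=e_{ii}-e_{i+1,i+1}$ ($1\le i<k$), $g:=I_k$, $\mathcal S:=\{e_{ij}\mid i\neq j\}\cup\{h_1,\dots,h_{k-1}\}$, $\mathcal M:=\mathcal S\cup\{g\}$ (a basis of $M_k(F)$). For $a,b\in\mathcal M$, $\varphi_{ab}$ is the linear endomorphism of $M_k(F)$ sending $a$ to $b$ and the other elements of $\mathcal M$ to $0$; $\{\varphi_{ab}\}_{a,b\in\mathcal S}\cup\{\varphi_{gg}\}$ is a basis of $U$. $F\langle X|U\rangle$ (elements: $U$-polynomials) is the nonunital associative algebra generated by symbols $x_i^u$ ($i\ge1$,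 $u\in U$), linear in $u$, with $x_i^1=x_i$; it is free on $\{x_i^{w}\}$ for $w$ in a basis of $U$. One writes $x^{ab}:=x^{\varphi_{ab}}$. $L$ acts on it by derivations: $\delta\in L$ acts as the derivation sending $x_i^u\mapsto x_i^{\phi(\delta)\circ u}$. A $T_U$-ideal is a two-sided ideal invariant under this $L$-action and under all algebra endomorphisms of $F\langle X|U\rangle$ commuting with the $L$-action. $\operatorname{Id}^U(M_k(F))$ is the set of $f\in F\langle X|U\rangle$ vanishing under all evaluations $x_i\mapsto m_i\in M_k(F)$, $x_i^u\mapsto u(m_i)$. $x,y$ denote distinct variables of $X=\{x_1,x_2,\dots\}$ and $[f,h]=fh-hf$. *)

theory Defs
  imports "HOL-Analysis.Analysis" "HOL-Library.Poly_Mapping"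
begin

section \<open>Free algebras and ideals\<close>

text \<open>
  The free unital associative algebra over \<open>'f\<close> on a set of letters \<open>'s\<close> is
  the algebra of finitely supported functions on words, with convolution as product.
\<close>

datatype 's fword = FWord (letters: "'s list")

instantiation fword :: (type) monoid_add
begin
definition zero_fword :: "'a fword" where "0 = FWord []"
definition plus_fword :: "'a fword \<Rightarrow> 'a fword \<Rightarrow> 'a fword"
  where "v + w = FWord (letters v @ letters w)"
instance by standard (auto simp: zero_fword_def plus_fword_def)
end

type_synonym ('f, 's) falg = "'s fword \<Rightarrow>\<^sub>0 'f"

definition fscale :: "'f::semiring_1 \<Rightarrow> ('f, 's) falg \<Rightarrow> ('f, 's) falg"
  where "fscale c p = Poly_Mapping.single 0 c * p"

definition letter :: "'s \<Rightarrow> ('f::semiring_1, 's) falg"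
  where "letter s = Poly_Mapping.single (FWord [s]) 1"

inductive_set ideal_gen :: "'a::ring_1 set \<Rightarrow> 'a set" for R where
  zero: "0 \<in> ideal_gen R"
| base: "r \<in> R \<Longrightarrow> r \<in> ideal_gen R"
| add: "p \<in> ideal_gen R \<Longrightarrow> q \<in> ideal_gen R \<Longrightarrow> p + q \<in> ideal_gen R"
| left: "p \<in> ideal_gen R \<Longrightarrow> a * p \<in> ideal_gen R"
| right: "p \<in> ideal_gen R \<Longrightarrow> p * a \<in> ideal_gen R"

lemma ideal_gen_uminus: "p \<in> ideal_gen R \<Longrightarrow> - p \<in> ideal_gen R"
  using ideal_gen.left[of p R "- 1"] by simp

lemma ideal_gen_diff: "p \<in> ideal_gen R \<Longrightarrow> q \<in> ideal_gen R \<Longrightarrow> p - q \<in> ideal_gen R"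
  using ideal_gen.add[of p R "- q"] ideal_gen_uminus[of q R] by simp

lemma ideal_cong_refl: "p - p \<in> ideal_gen R"
  by (simp add: ideal_gen.zero)

lemma ideal_cong_sym: "p - q \<in> ideal_gen R \<Longrightarrow> q - p \<in> ideal_gen R"
  using ideal_gen_uminus by fastforce

lemma ideal_cong_trans:
  "p - q \<in> ideal_gen R \<Longrightarrow> q - r \<in> ideal_gen R \<Longrightarrow> p - r \<in> ideal_gen R"
  using ideal_gen.add by fastforce

lemma ideal_cong_add:
  "p - p' \<in> ideal_gen R \<Longrightarrow> q - q' \<in> ideal_gen R \<Longrightarrow> (p + q) - (p' + q') \<in> ideal_gen R"
  using ideal_gen.add[of "p - p'" R "q - q'"] by (simp add: algebra_simps)

lemma ideal_cong_uminus: "p - p' \<in> ideal_gen R \<Longrightarrow> (- p) - (- p') \<in> ideal_gen R"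
  using ideal_gen_uminus[of "p - p'" R] by (simp add: algebra_simps)

lemma ideal_cong_minus:
  "p - p' \<in> ideal_gen R \<Longrightarrow> q - q' \<in> ideal_gen R \<Longrightarrow> (p - q) - (p' - q') \<in> ideal_gen R"
  using ideal_gen_diff[of "p - p'" R "q - q'"] by (simp add: algebra_simps)

lemma ideal_cong_mult:
  assumes "p - p' \<in> ideal_gen R" "q - q' \<in> ideal_gen R"
  shows "p * q - p' * q' \<in> ideal_gen R"
proof -
  have "p * q - p' * q' = (p - p') * q + p' * (q - q')"
    by (simp add: algebra_simps)
  then show ?thesis
    using assms by (simp add: ideal_gen.add ideal_gen.left ideal_gen.right)
qed

definition word_poly :: "'s list \<Rightarrow> ('f::semiring_1, 's) falg"
  where "word_poly w = Poly_Mapping.single (FWord w) 1"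

lemma word_poly_Nil: "word_poly [] = 1"
  by (simp add: word_poly_def flip: zero_fword_def single_one)

lemma word_poly_append: "word_poly (v @ w) = word_poly v * word_poly w"
  by (simp add: word_poly_def mult_single plus_fword_def)

lemma word_poly_Cons: "word_poly (s # w) = letter s * word_poly w"
  using word_poly_append[of "[s]" w] by (simp add: word_poly_def letter_def)

lemma word_poly_singleton: "word_poly [s] = letter s"
  by (simp add: word_poly_def letter_def)

lemma lookup_letter_zero: "Poly_Mapping.lookup (letter s) 0 = 0"
  by (simp add: letter_def lookup_single zero_fword_def)

lemma fscale_single: "fscale c (Poly_Mapping.single w d) = Poly_Mapping.single w (c * d)"
  by (simp add: fscale_def mult_single)

lemma fscale_add: "fscale c (p + q) = fscale c p + fscale c q"
  by (simp add: fscale_def distrib_left)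

lemma fscale_diff: "fscale c (p - q) = fscale c p - fscale c q"
  for p :: "('f::ring_1, 's) falg"
  by (simp add: fscale_def right_diff_distrib)

lemma fscale_add_left: "fscale (c + d) p = fscale c p + fscale d p"
  by (simp add: fscale_def single_add distrib_right)

lemma fscale_fscale: "fscale c (fscale d p) = fscale (c * d) p"
  by (simp add: fscale_def mult_single flip: mult.assoc)

lemma fscale_one: "fscale 1 p = p"
  by (simp add: fscale_def)

lemma fscale_mult_left: "fscale c (p * q) = fscale c p * q"
  by (simp add: fscale_def mult.assoc)

lemma single_expansion: "p = (\<Sum>w\<in>Poly_Mapping.keys p. Poly_Mapping.single w (Poly_Mapping.lookup p w))"
  by (rule poly_mapping_eqI)
    (auto simp: lookup_sum lookup_single when_def in_keys_iff sum.delta)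

lemma falg_induct [case_names word add scale]:
  fixes p :: "('f::ring_1, 's) falg"
  assumes word: "\<And>w. P (word_poly w)"
    and add: "\<And>p q. P p \<Longrightarrow> P q \<Longrightarrow> P (p + q)"
    and scale: "\<And>c p. P p \<Longrightarrow> P (fscale c p)"
  shows "P p"
proof -
  have sng: "P (Poly_Mapping.single k v)" for k v
  proof -
    have "Poly_Mapping.single k v = fscale v (word_poly (letters k))"
      by (simp add: fscale_single word_poly_def)
    then show ?thesis using word scale by simp
  qed
  have "P (\<Sum>w\<in>K. Poly_Mapping.single w (Poly_Mapping.lookup p w))" if "finite K" for K
    using that
  proof (induction K)
    case empty
    then show ?case using sng[of 0 0] by simp
  next
    case (insert x K)
    then show ?case using add sng by simp
  qed
  from this[of "Poly_Mapping.keys p"] show ?thesis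
    by (simp flip: single_expansion)
qed

lemma lookup_fscale: "Poly_Mapping.lookup (fscale c p) w = c * Poly_Mapping.lookup p w"
  unfolding fscale_def mult_map_scale_conv_mult[symmetric]
  by (simp add: map.rep_eq when_def)

lemma fscale_mult_right:
  fixes p q :: "('f::comm_ring_1, 's) falg"
  shows "fscale c (p * q) = p * fscale c q"
proof -
  have "Poly_Mapping.single 0 c * p = p * Poly_Mapping.single 0 c"
  proof (induction p rule: falg_induct)
    case (word w)
    then show ?case by (simp add: word_poly_def mult_single)
  next
    case (add p q)
    then show ?case by (simp add: distrib_left distrib_right)
  next
    case (scale d p)
    have "Poly_Mapping.single 0 c * Poly_Mapping.single 0 d
        = (Poly_Mapping.single 0 d * Poly_Mapping.single 0 c :: ('f, 's) falg)"
      by (simp add: mult_single mult.commute)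
    then have "Poly_Mapping.single 0 c * fscale d p = fscale d (Poly_Mapping.single 0 c * p)"
      by (simp add: fscale_def flip: mult.assoc)
    also have "\<dots> = fscale d p * Poly_Mapping.single 0 c"
      by (simp add: scale fscale_mult_left)
    finally show ?case .
  qed
  then show ?thesis by (simp add: fscale_def flip: mult.assoc)
qed

lemma module_fscale: "module (fscale :: 'f::comm_ring_1 \<Rightarrow> ('f, 's) falg \<Rightarrow> _)"
  by standard (simp_all add: fscale_add fscale_add_left fscale_fscale fscale_one)

lemma fscale_ideal_gen: "p \<in> ideal_gen R \<Longrightarrow> fscale c p \<in> ideal_gen R"
  for p :: "('f::ring_1, 's) falg"
  by (simp add: fscale_def ideal_gen.left)

lemma lookup_mult_zero: "Poly_Mapping.lookup (p * q) 0 = Poly_Mapping.lookup p 0 * Poly_Mapping.lookup q 0"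
  for p q :: "('f::comm_ring_1, 's) falg"
proof (induction p rule: falg_induct)
  case (word v)
  show ?case
  proof (induction q rule: falg_induct)
    case (word w)
    show ?case
      by (auto simp: word_poly_def mult_single lookup_single when_def plus_fword_def zero_fword_def)
  next
    case (add p q)
    then show ?case by (simp add: lookup_add distrib_left)
  next
    case (scale c p)
    then show ?case
      by (simp add: lookup_fscale mult.left_commute flip: fscale_mult_right)
  qed
next
  case (add p r)
  then show ?case by (simp add: lookup_add distrib_right)
next
  case (scale c p)
  then show ?case
    by (simp add: lookup_fscale mult.assoc flip: fscale_mult_left)
qed

text \<open>The linear extension of a map on words, with respect to a scalar action \<open>sc\<close>.\<close>

definition lin_ext ::
  "('f::semiring_1 \<Rightarrow> 'v \<Rightarrow> 'v) \<Rightarrow> ('s list \<Rightarrow> 'v) \<Rightarrow> ('f, 's) falg \<Rightarrow> 'v::comm_monoid_add"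
  where "lin_ext sc f p = (\<Sum>w\<in>Poly_Mapping.keys p. sc (Poly_Mapping.lookup p w) (f (letters w)))"

lemma lin_ext_superset:
  assumes "module sc" "finite K" "Poly_Mapping.keys p \<subseteq> K"
  shows "lin_ext sc f p = (\<Sum>w\<in>K. sc (Poly_Mapping.lookup p w) (f (letters w)))"
proof -
  interpret module sc by fact
  show ?thesis
    unfolding lin_ext_def
    by (rule sum.mono_neutral_left) (use assms in \<open>auto simp: in_keys_iff\<close>)
qed

lemma lin_ext_add:
  assumes "module sc"
  shows "lin_ext sc f (p + q) = lin_ext sc f p + lin_ext sc f q"
proof -
  interpret module sc by fact
  let ?K = "Poly_Mapping.keys p \<union> Poly_Mapping.keys q"
  have "Poly_Mapping.keys (p + q) \<subseteq> ?K" by (rule Poly_Mapping.keys_add)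
  then show ?thesis
    using lin_ext_superset[OF assms, of ?K]
    by (simp add: lookup_add scale_left_distrib sum.distrib)
qed

lemma lin_ext_fscale:
  assumes "module sc"
  shows "lin_ext sc f (fscale c p) = sc c (lin_ext sc f p)"
proof -
  interpret module sc by fact
  have "Poly_Mapping.keys (fscale c p) \<subseteq> Poly_Mapping.keys p"
    by (auto simp: in_keys_iff lookup_fscale)
  then show ?thesis
    using lin_ext_superset[OF assms, of "Poly_Mapping.keys p"]
    by (simp add: lookup_fscale scale_sum_right)
qed

lemma lin_ext_word:
  assumes "module sc"
  shows "lin_ext sc f (word_poly w) = f w"
proof -
  interpret module sc by fact
  show ?thesis by (simp add: lin_ext_def word_poly_def)
qed

lemma lin_ext_diff:
  fixes f :: "'s list \<Rightarrow> 'v::ab_group_add"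
  assumes "module sc"
  shows "lin_ext sc f (p - q) = lin_ext sc f p - lin_ext sc f q"
  using lin_ext_add[OF assms, of f "p - q" q] by (simp add: algebra_simps)


section \<open>The matrix algebra and its derivations\<close>

definition mscale :: "'f::times \<Rightarrow> 'f^'n^'n \<Rightarrow> 'f^'n^'n"
  where "mscale c A = (\<chi> i j. c * A $ i $ j)"

lemma vector_space_mscale: "vector_space (mscale :: 'f::field \<Rightarrow> 'f^'n^'n \<Rightarrow> 'f^'n^'n)"
  by standard (auto simp: mscale_def vec_eq_iff algebra_simps)

lemma module_mscale: "module (mscale :: 'f::field \<Rightarrow> 'f^'n^'n \<Rightarrow> 'f^'n^'n)"
  by standard (auto simp: mscale_def vec_eq_iff algebra_simps)

lemma mscale_simps:
  fixes A B :: "'f::field^'n^'n"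
  shows "mscale c (A + B) = mscale c A + mscale c B"
    "mscale (c + d) A = mscale c A + mscale d A"
    "mscale c (mscale d A) = mscale (c * d) A"
    "mscale 0 A = 0" "mscale c 0 = 0" "mscale 1 A = A"
    "mscale c (- A) = - mscale c A"
    "mscale (- c) A = - mscale c A"
    "mscale c A ** B = mscale c (A ** B)"
    "A ** mscale c B = mscale c (A ** B)"
  by (auto simp: mscale_def vec_eq_iff algebra_simps matrix_matrix_mult_def sum_distrib_left)

abbreviation mlinear :: "('f::field^'n^'n \<Rightarrow> 'f^'n^'n) \<Rightarrow> bool"
  where "mlinear \<equiv> Vector_Spaces.linear mscale mscale"

lemma mlinear_iff:
  "mlinear D \<longleftrightarrow> (\<forall>A B. D (A + B) = D A + D B) \<and> (\<forall>c A. D (mscale c A) = mscale c (D A))"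
  using vector_space_mscale
  by (auto simp: Vector_Spaces.linear_iff module_hom_iff vector_space_def module_hom_axioms_def)

definition is_matrix_derivation :: "('f::field^'n^'n \<Rightarrow> 'f^'n^'n) \<Rightarrow> bool"
  where "is_matrix_derivation D \<longleftrightarrow>
    mlinear D \<and> (\<forall>A B. D (A ** B) = D A ** B + A ** D B)"

text \<open>The Lie algebra \<open>L = Der(M\<^sub>k(F))\<close>, with \<open>k\<close> the cardinality of the index type.\<close>

typedef (overloaded) ('f, 'n) der = "{D :: 'f::field^'n^'n \<Rightarrow> 'f^'n^'n. is_matrix_derivation D}"
proof
  show "(\<lambda>_. 0) \<in> {D :: 'f^'n^'n \<Rightarrow> 'f^'n^'n. is_matrix_derivation D}"
    by (simp add: is_matrix_derivation_def mlinear_iff mscale_simps)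
qed

lemma Rep_der_linear: "mlinear (Rep_der d)"
  using Rep_der[of d] by (simp add: is_matrix_derivation_def)

lemma Rep_der_simps:
  "Rep_der d (A + B) = Rep_der d A + Rep_der d B"
  "Rep_der d (mscale c A) = mscale c (Rep_der d A)"
  "Rep_der d 0 = 0"
  using Rep_der_linear[of d]
  by (auto simp: mlinear_iff) (metis mscale_simps(4))


section \<open>The universal enveloping algebra and its action\<close>

text \<open>
  \<open>U(L)\<close> is the free unital algebra on the set \<open>L\<close> modulo the relations making the
  inclusion of \<open>L\<close> linear and compatible with the Lie bracket \<open>d \<circ> d' - d' \<circ> d\<close>.
\<close>

definition env_rels :: "('f::field, ('f, 'n::finite) der) falg set"
  where "env_rels =
    {letter d - (fscale a (letter d1) + fscale b (letter d2)) | a b d d1 d2.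
       \<forall>A. Rep_der d A = mscale a (Rep_der d1 A) + mscale b (Rep_der d2 A)} \<union>
    {letter d - (letter d1 * letter d2 - letter d2 * letter d1) | d d1 d2.
       \<forall>A. Rep_der d A = Rep_der d1 (Rep_der d2 A) - Rep_der d2 (Rep_der d1 A)}"

definition falg_act ::
  "('f::field, ('f, 'n::finite) der) falg \<Rightarrow> 'f^'n^'n \<Rightarrow> 'f^'n^'n"
  where "falg_act p A = lin_ext mscale (\<lambda>w. foldr Rep_der w A) p"

lemma falg_act_simps:
  "falg_act (p + q) A = falg_act p A + falg_act q A"
  "falg_act (p - q) A = falg_act p A - falg_act q A"
  "falg_act (fscale c p) A = mscale c (falg_act p A)"
  "falg_act (word_poly w) A = foldr Rep_der w A"
  "falg_act 1 A = A"
  "falg_act (letter d) A = Rep_der d A"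
  using lin_ext_word[OF module_mscale, of "\<lambda>w. foldr Rep_der w A" "[]"]
    lin_ext_word[OF module_mscale, of "\<lambda>w. foldr Rep_der w A" "[d]"]
  by (simp_all add: falg_act_def lin_ext_add lin_ext_diff lin_ext_fscale lin_ext_word
      module_mscale word_poly_Nil word_poly_singleton)

lemma falg_act_linear:
  "falg_act p (A + B) = falg_act p A + falg_act p B"
  "falg_act p (mscale c A) = mscale c (falg_act p A)"
proof -
  have "foldr Rep_der w (A + B) = foldr Rep_der w A + foldr Rep_der w B" for w
    by (induction w) (simp_all add: Rep_der_simps)
  then show "falg_act p (A + B) = falg_act p A + falg_act p B"
    by (induction p rule: falg_induct) (simp_all add: falg_act_simps mscale_simps)
  have "foldr Rep_der w (mscale c A) = mscale c (foldr Rep_der w A)" for w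
    by (induction w) (simp_all add: Rep_der_simps)
  then show "falg_act p (mscale c A) = mscale c (falg_act p A)"
    by (induction p rule: falg_induct) (simp_all add: falg_act_simps mscale_simps mult.commute)
qed

lemma falg_act_mult: "falg_act (p * q) A = falg_act p (falg_act q A)"
proof (induction p rule: falg_induct)
  case (word v)
  show ?case
  proof (induction q rule: falg_induct)
    case (word w)
    then show ?case by (simp add: falg_act_simps flip: word_poly_append)
  next
    case (add p q)
    then show ?case by (simp add: distrib_left falg_act_simps(1) falg_act_linear)
  next
    case (scale c p)
    then show ?case by (simp add: falg_act_simps(3) falg_act_linear flip: fscale_mult_right)
  qed
next
  case (add p q)
  then show ?case by (simp add: distrib_right falg_act_simps)
next
  case (scale c p)
  then show ?case by (simp add: falg_act_simps flip: fscale_mult_left)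
qed

lemma falg_act_zero: "falg_act 0 A = 0" "falg_act p 0 = 0"
  using falg_act_simps(2)[of 0 0 A] falg_act_linear(2)[of p 0 0] by (simp_all add: mscale_simps)

lemma falg_act_env_rels: "p \<in> ideal_gen env_rels \<Longrightarrow> falg_act p A = 0"
proof (induction p arbitrary: A rule: ideal_gen.induct)
  case (base r)
  then show ?case
    by (auto simp: env_rels_def falg_act_simps falg_act_mult)
qed (simp_all add: falg_act_zero falg_act_simps falg_act_mult)

quotient_type (overloaded) ('f, 'n) env =
  "('f::field, ('f, 'n::finite) der) falg" / "\<lambda>p q. p - q \<in> ideal_gen env_rels"
proof (intro equivpI reflpI sympI transpI)
  fix p q r :: "('f, ('f, 'n) der) falg"
  show "p - p \<in> ideal_gen env_rels" by (rule ideal_cong_refl)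
  show "q - p \<in> ideal_gen env_rels" if "p - q \<in> ideal_gen env_rels"
    using that by (rule ideal_cong_sym)
  show "p - r \<in> ideal_gen env_rels"
    if "p - q \<in> ideal_gen env_rels" "q - r \<in> ideal_gen env_rels"
    using that by (rule ideal_cong_trans)
qed

instantiation env :: (field, finite) ring_1
begin
lift_definition zero_env :: "('a, 'b) env" is 0 .
lift_definition one_env :: "('a, 'b) env" is 1 .
lift_definition plus_env :: "('a, 'b) env \<Rightarrow> ('a, 'b) env \<Rightarrow> ('a, 'b) env" is "(+)"
  by (rule ideal_cong_add)
lift_definition uminus_env :: "('a, 'b) env \<Rightarrow> ('a, 'b) env" is uminus
  by (rule ideal_cong_uminus)
lift_definition minus_env :: "('a, 'b) env \<Rightarrow> ('a, 'b) env \<Rightarrow> ('a, 'b) env" is "(-)"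
  by (rule ideal_cong_minus)
lift_definition times_env :: "('a, 'b) env \<Rightarrow> ('a, 'b) env \<Rightarrow> ('a, 'b) env" is "(*)"
  by (rule ideal_cong_mult)
instance
proof
  show "0 \<noteq> (1 :: ('a, 'b) env)"
  proof transfer
    show "0 - 1 \<notin> ideal_gen (env_rels :: ('a, ('a, 'b) der) falg set)"
    proof
      assume "0 - 1 \<in> ideal_gen (env_rels :: ('a, ('a, 'b) der) falg set)"
      then have "1 - 0 \<in> ideal_gen (env_rels :: ('a, ('a, 'b) der) falg set)"
        by (rule ideal_cong_sym)
      then have "falg_act (1 :: ('a, ('a, 'b) der) falg) (mat 1) = 0"
        by (simp add: falg_act_env_rels)
      then have "(mat 1 :: 'a^'b^'b) = 0"
        by (simp add: falg_act_simps(5))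
      then have "(mat 1 :: 'a^'b^'b) $ i $ i = 0" for i by simp
      then show False by (simp add: mat_def)
    qed
  qed
qed (transfer; simp add: algebra_simps ideal_gen.zero)+
end

lift_definition env_incl :: "('f::field, 'n::finite) der \<Rightarrow> ('f, 'n) env" is letter .

lift_definition env_scale :: "'f::field \<Rightarrow> ('f, 'n::finite) env \<Rightarrow> ('f, 'n) env" is fscale
  by (simp add: fscale_ideal_gen flip: fscale_diff)

text \<open>The algebra homomorphism \<open>\<phi>\<close> from \<open>U(L)\<close> to the endomorphisms of the matrix space.\<close>

lift_definition env_act :: "('f::field, 'n::finite) env \<Rightarrow> 'f^'n^'n \<Rightarrow> 'f^'n^'n" is falg_act
  using falg_act_env_rels by (metis (no_types) ext falg_act_simps(2) right_minus_eq)

lemma env_act_hom: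
  "env_act (a + b) A = env_act a A + env_act b A"
  "env_act (env_scale c a) A = mscale c (env_act a A)"
  "env_act (a * b) A = env_act a (env_act b A)"
  "env_act 1 A = A"
  "env_act (env_incl d) A = Rep_der d A"
  by (transfer; simp add: falg_act_simps falg_act_mult)+

lemma env_act_linear: "mlinear (env_act a)"
  unfolding mlinear_iff by transfer (simp add: falg_act_linear)


section \<open>U-polynomials\<close>

text \<open>The algebra \<open>U = \<phi>(U(L))\<close>.\<close>

typedef (overloaded) ('f, 'n) uop =
  "range (env_act :: ('f::field, 'n::finite) env \<Rightarrow> 'f^'n^'n \<Rightarrow> 'f^'n^'n)"
  by blast

definition der_comp :: "('f::field, 'n::finite) der \<Rightarrow> ('f, 'n) uop \<Rightarrow> ('f, 'n) uop"
  where "der_comp d u = Abs_uop (Rep_der d \<circ> Rep_uop u)"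

lemma Rep_der_comp: "Rep_uop (der_comp d u) = Rep_der d \<circ> Rep_uop u"
proof -
  obtain a where "Rep_uop u = env_act a" using Rep_uop[of u] by blast
  then have "Rep_der d \<circ> Rep_uop u = env_act (env_incl d * a)"
    by (auto simp: env_act_hom)
  then show ?thesis unfolding der_comp_def by (intro Abs_uop_inverse) simp
qed

text \<open>
  The letter \<open>(i, u)\<close> stands for the symbol \<open>x\<^sub>i\<^sup>u\<close>; variables are numbered from \<open>0\<close>.
  The nonunital algebra \<open>F\<langle>X|U\<rangle>\<close> consists of the classes of the elements without constant
  term in the free unital algebra, modulo linearity in \<open>u\<close>. The relations have no constant
  term, so the ideal they generate in the free unital algebra is the one they generate in
  the free nonunital algebra.
\<close>

definition lin_rels :: "('f::field, nat \<times> ('f, 'n::finite) uop) falg set"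
  where "lin_rels =
    {letter (i, u) - (fscale a (letter (i, u1)) + fscale b (letter (i, u2))) | a b i u u1 u2.
       \<forall>A. Rep_uop u A = mscale a (Rep_uop u1 A) + mscale b (Rep_uop u2 A)}"

quotient_type (overloaded) ('f, 'n) upoly =
  "('f::field, nat \<times> ('f, 'n::finite) uop) falg" / partial:
  "\<lambda>p q. Poly_Mapping.lookup p 0 = 0 \<and> Poly_Mapping.lookup q 0 = 0 \<and> p - q \<in> ideal_gen lin_rels"
proof (rule part_equivpI)
  show "\<exists>p :: ('f, nat \<times> ('f, 'n) uop) falg.
      Poly_Mapping.lookup p 0 = 0 \<and> Poly_Mapping.lookup p 0 = 0 \<and> p - p \<in> ideal_gen lin_rels"
    by (rule exI[of _ 0]) (simp add: ideal_gen.zero)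
qed (auto intro!: sympI transpI intro: ideal_cong_sym ideal_cong_trans)

instantiation upoly :: (field, finite) ring
begin
lift_definition zero_upoly :: "('a, 'b) upoly" is 0 by (simp add: ideal_gen.zero)
lift_definition plus_upoly :: "('a, 'b) upoly \<Rightarrow> ('a, 'b) upoly \<Rightarrow> ('a, 'b) upoly" is "(+)"
  by (simp add: ideal_cong_add lookup_add)
lift_definition uminus_upoly :: "('a, 'b) upoly \<Rightarrow> ('a, 'b) upoly" is uminus
  using ideal_cong_uminus by fastforce
lift_definition minus_upoly :: "('a, 'b) upoly \<Rightarrow> ('a, 'b) upoly \<Rightarrow> ('a, 'b) upoly" is "(-)"
  by (simp add: ideal_cong_minus lookup_minus)
lift_definition times_upoly :: "('a, 'b) upoly \<Rightarrow> ('a, 'b) upoly \<Rightarrow> ('a, 'b) upoly" is "(*)"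
  by (simp add: ideal_cong_mult lookup_mult_zero)
instance
  by standard
    (transfer; simp add: algebra_simps ideal_gen.zero lookup_add lookup_minus lookup_mult_zero)+
end

lift_definition upoly_scale :: "'f::field \<Rightarrow> ('f, 'n::finite) upoly \<Rightarrow> ('f, 'n) upoly" is fscale
  by (simp add: fscale_ideal_gen lookup_fscale flip: fscale_diff)

lift_definition uvar :: "nat \<Rightarrow> ('f::field, 'n::finite) uop \<Rightarrow> ('f, 'n) upoly"
  is "\<lambda>i u. letter (i, u)"
  by (simp add: ideal_gen.zero lookup_letter_zero)

lemma uvar_linear:
  fixes u u1 u2 :: "('f::field, 'n::finite) uop"
  assumes "\<And>A. Rep_uop u A = mscale a (Rep_uop u1 A) + mscale b (Rep_uop u2 A)"
  shows "uvar i u = upoly_scale a (uvar i u1) + upoly_scale b (uvar i u2)"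
  using assms
proof (transfer, intro conjI)
  fix u u1 u2 :: "('f, 'n) uop" and a b i
  assume "\<And>A. Rep_uop u A = mscale a (Rep_uop u1 A) + mscale b (Rep_uop u2 A)"
  then show "letter (i, u) - (fscale a (letter (i, u1)) + fscale b (letter (i, u2)))
      \<in> ideal_gen lin_rels"
    by (intro ideal_gen.base) (unfold lin_rels_def, blast)
qed (simp_all add: lookup_letter_zero lookup_add lookup_fscale)


subsection \<open>The action of \<open>L\<close> by derivations\<close>

primrec word_der ::
  "('f::field, 'n::finite) der \<Rightarrow> (nat \<times> ('f, 'n) uop) list \<Rightarrow> ('f, nat \<times> ('f, 'n) uop) falg"
  where
    "word_der d [] = 0"
  | "word_der d (s # w) =
       letter (fst s, der_comp d (snd s)) * word_poly w + letter s * word_der d w"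

definition falg_der ::
  "('f::field, 'n::finite) der \<Rightarrow> ('f, nat \<times> ('f, 'n) uop) falg \<Rightarrow> ('f, nat \<times> ('f, 'n) uop) falg"
  where "falg_der d = lin_ext fscale (word_der d)"

lemma falg_der_simps:
  "falg_der d (p + q) = falg_der d p + falg_der d q"
  "falg_der d (p - q) = falg_der d p - falg_der d q"
  "falg_der d (fscale c p) = fscale c (falg_der d p)"
  "falg_der d (word_poly w) = word_der d w"
  "falg_der d (letter (i, u)) = letter (i, der_comp d u)"
  using lin_ext_word[OF module_fscale, of "word_der d" "[(i, u)]"]
  by (simp_all add: falg_der_def lin_ext_add lin_ext_diff lin_ext_fscale lin_ext_word
      module_fscale word_poly_Nil word_poly_singleton)

lemma falg_der_mult: "falg_der d (p * q) = falg_der d p * q + p * falg_der d q"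
proof (induction p rule: falg_induct)
  case (word v)
  show ?case
  proof (induction q rule: falg_induct)
    case (word w)
    have "word_der d (v @ w) = word_der d v * word_poly w + word_poly v * word_der d w"
      by (induction v)
        (simp_all add: word_poly_Nil word_poly_Cons word_poly_append algebra_simps)
    then show ?case by (simp add: falg_der_simps flip: word_poly_append)
  next
    case (add p q)
    then show ?case by (simp add: falg_der_simps(1) algebra_simps)
  next
    case (scale c p)
    then show ?case
      by (simp add: falg_der_simps(3) fscale_add flip: fscale_mult_right)
  qed
next
  case (add p q)
  then show ?case by (simp add: falg_der_simps(1) algebra_simps)
next
  case (scale c p)
  then show ?case
    by (simp add: falg_der_simps(3) fscale_add flip: fscale_mult_left)
qed

lemma falg_der_lin_rels: "p \<in> ideal_gen lin_rels \<Longrightarrow> falg_der d p \<in> ideal_gen lin_rels"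
proof (induction p rule: ideal_gen.induct)
  case zero
  then show ?case using falg_der_simps(2)[of d 0 0] by (simp add: ideal_gen.zero)
next
  case (base r)
  then obtain a b i u u1 u2
    where r: "r = letter (i, u) - (fscale a (letter (i, u1)) + fscale b (letter (i, u2)))"
      and *: "\<forall>A. Rep_uop u A = mscale a (Rep_uop u1 A) + mscale b (Rep_uop u2 A)"
    by (auto simp: lin_rels_def)
  have "Rep_uop (der_comp d u) A =
      mscale a (Rep_uop (der_comp d u1) A) + mscale b (Rep_uop (der_comp d u2) A)" for A
    by (simp add: Rep_der_comp * Rep_der_simps)
  then have "letter (i, der_comp d u) -
      (fscale a (letter (i, der_comp d u1)) + fscale b (letter (i, der_comp d u2))) \<in> lin_rels"
    unfolding lin_rels_def by blast
  then show ?case by (simp add: r falg_der_simps ideal_gen.base)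
next
  case (add p q)
  then show ?case by (simp add: falg_der_simps ideal_gen.add)
next
  case (left p a)
  then show ?case by (simp add: falg_der_mult ideal_gen.add ideal_gen.left)
next
  case (right p a)
  then show ?case by (simp add: falg_der_mult ideal_gen.add ideal_gen.right)
qed

lemma lookup_falg_der_zero: "Poly_Mapping.lookup (falg_der d p) 0 = 0"
proof (induction p rule: falg_induct)
  case (word w)
  have "Poly_Mapping.lookup (letter s * q :: ('a, nat \<times> ('a, 'b) uop) falg) 0 = 0" for s q
    unfolding lookup_mult_zero by (simp add: lookup_letter_zero)
  then have "Poly_Mapping.lookup (word_der d w) 0 = 0"
    by (cases w) (simp_all add: lookup_add)
  then show ?case by (simp add: falg_der_simps)
qed (simp_all add: falg_der_simps lookup_add lookup_fscale)

lift_definition upoly_der ::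
  "('f::field, 'n::finite) der \<Rightarrow> ('f, 'n) upoly \<Rightarrow> ('f, 'n) upoly" is falg_der
  by (simp add: lookup_falg_der_zero falg_der_lin_rels flip: falg_der_simps(2))

lemma upoly_der_add: "upoly_der d (f + h) = upoly_der d f + upoly_der d h"
  by transfer (simp add: falg_der_simps(1) ideal_gen.zero lookup_add lookup_falg_der_zero)

lemma upoly_der_scale: "upoly_der d (upoly_scale c f) = upoly_scale c (upoly_der d f)"
  by transfer (simp add: falg_der_simps(3) ideal_gen.zero lookup_fscale lookup_falg_der_zero)

lemma upoly_der_mult: "upoly_der d (f * h) = upoly_der d f * h + f * upoly_der d h"
  by transfer
    (simp add: falg_der_mult ideal_gen.zero lookup_add lookup_mult_zero lookup_falg_der_zero)

lemma upoly_der_uvar: "upoly_der d (uvar i u) = uvar i (der_comp d u)"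
  by transfer (simp add: falg_der_simps(5) ideal_gen.zero lookup_letter_zero)


subsection \<open>Identities\<close>

definition falg_eval ::
  "(nat \<Rightarrow> 'f::field^'n::finite^'n) \<Rightarrow> ('f, nat \<times> ('f, 'n) uop) falg \<Rightarrow> 'f^'n^'n"
  where "falg_eval m =
    lin_ext mscale (\<lambda>w. foldr (\<lambda>s A. Rep_uop (snd s) (m (fst s)) ** A) w (mat 1))"

lemma falg_eval_simps:
  "falg_eval m (p + q) = falg_eval m p + falg_eval m q"
  "falg_eval m (p - q) = falg_eval m p - falg_eval m q"
  "falg_eval m (fscale c p) = mscale c (falg_eval m p)"
  "falg_eval m (word_poly w) = foldr (\<lambda>s A. Rep_uop (snd s) (m (fst s)) ** A) w (mat 1)"
  "falg_eval m (letter (i, u)) = Rep_uop u (m i)"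
  using lin_ext_word[OF module_mscale, of
      "\<lambda>w. foldr (\<lambda>s A. Rep_uop (snd s) (m (fst s)) ** A) w (mat 1)" "[(i, u)]"]
  by (simp_all add: falg_eval_def lin_ext_add lin_ext_diff lin_ext_fscale lin_ext_word
      module_mscale word_poly_singleton)

lemma matrix_add_rdistrib: "(A + B) ** C = A ** C + B ** C"
  for A B :: "'f::semiring_1^'n^'n"
  by (simp add: matrix_matrix_mult_def vec_eq_iff distrib_right sum.distrib)

lemma falg_eval_mult: "falg_eval m (p * q) = falg_eval m p ** falg_eval m q"
proof (induction p rule: falg_induct)
  case (word v)
  show ?case
  proof (induction q rule: falg_induct)
    case (word w)
    have "foldr (\<lambda>s A. Rep_uop (snd s) (m (fst s)) ** A) (v @ w) (mat 1) =
        foldr (\<lambda>s A. Rep_uop (snd s) (m (fst s)) ** A) v (mat 1) **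
        foldr (\<lambda>s A. Rep_uop (snd s) (m (fst s)) ** A) w (mat 1)"
      by (induction v) (simp_all add: matrix_mul_assoc)
    then show ?case by (simp add: falg_eval_simps(4) del: foldr_append flip: word_poly_append)
  next
    case (add p q)
    then show ?case by (simp add: falg_eval_simps(1) distrib_left matrix_add_ldistrib)
  next
    case (scale c p)
    then show ?case by (simp add: falg_eval_simps(3) mscale_simps flip: fscale_mult_right)
  qed
next
  case (add p q)
  then show ?case by (simp add: falg_eval_simps(1) distrib_right matrix_add_rdistrib)
next
  case (scale c p)
  then show ?case by (simp add: falg_eval_simps(3) mscale_simps flip: fscale_mult_left)
qed

lemma falg_eval_lin_rels: "p \<in> ideal_gen lin_rels \<Longrightarrow> falg_eval m p = 0"
proof (induction p rule: ideal_gen.induct)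
  case zero
  then show ?case using falg_eval_simps(2)[of m 0 0] by simp
next
  case (base r)
  then show ?case by (auto simp: lin_rels_def falg_eval_simps)
qed (simp_all add: falg_eval_simps falg_eval_mult)

lift_definition upoly_eval ::
  "(nat \<Rightarrow> 'f::field^'n::finite^'n) \<Rightarrow> ('f, 'n) upoly \<Rightarrow> 'f^'n^'n" is falg_eval
  using falg_eval_lin_rels by (metis falg_eval_simps(2) right_minus_eq)

lemma upoly_eval_simps:
  "upoly_eval m (f + h) = upoly_eval m f + upoly_eval m h"
  "upoly_eval m (upoly_scale c f) = mscale c (upoly_eval m f)"
  "upoly_eval m (f * h) = upoly_eval m f ** upoly_eval m h"
  "upoly_eval m (uvar i u) = Rep_uop u (m i)"
  subgoal by transfer (simp add: falg_eval_simps(1))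
  subgoal by transfer (simp add: falg_eval_simps(3))
  subgoal by transfer (simp add: falg_eval_mult)
  subgoal by transfer (simp add: falg_eval_simps(5))
  done

definition Id_U :: "('f::field, 'n::finite) upoly set"
  where "Id_U = {f. \<forall>m. upoly_eval m f = 0}"


subsection \<open>T_U-ideals\<close>

definition upoly_endo :: "(('f::field, 'n::finite) upoly \<Rightarrow> ('f, 'n) upoly) \<Rightarrow> bool"
  where "upoly_endo \<psi> \<longleftrightarrow>
    (\<forall>f h. \<psi> (f + h) = \<psi> f + \<psi> h) \<and>
    (\<forall>c f. \<psi> (upoly_scale c f) = upoly_scale c (\<psi> f)) \<and>
    (\<forall>f h. \<psi> (f * h) = \<psi> f * \<psi> h)"

definition upoly_ideal :: "('f::field, 'n::finite) upoly set \<Rightarrow> bool"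
  where "upoly_ideal I \<longleftrightarrow>
    0 \<in> I \<and> (\<forall>f\<in>I. \<forall>h\<in>I. f + h \<in> I) \<and> (\<forall>c. \<forall>f\<in>I. upoly_scale c f \<in> I) \<and>
    (\<forall>f\<in>I. \<forall>h. h * f \<in> I \<and> f * h \<in> I)"

definition TU_ideal :: "('f::field, 'n::finite) upoly set \<Rightarrow> bool"
  where "TU_ideal I \<longleftrightarrow>
    upoly_ideal I \<and>
    (\<forall>d. \<forall>f\<in>I. upoly_der d f \<in> I) \<and>
    (\<forall>\<psi>. upoly_endo \<psi> \<and> (\<forall>d f. \<psi> (upoly_der d f) = upoly_der d (\<psi> f)) \<longrightarrow>
      (\<forall>f\<in>I. \<psi> f \<in> I))"

definition TU_generated :: "('f::field, 'n::finite) upoly set \<Rightarrow> ('f, 'n) upoly set"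
  where "TU_generated S = \<Inter> {I. TU_ideal I \<and> S \<subseteq> I}"


section \<open>The basis of the matrix algebra and its elementary operators\<close>

text \<open>
  Throughout, \<open>\<iota>\<close> is a bijection from \<open>{1..k}\<close> to the index type, which numbers the
  rows and columns.
\<close>

definition matrix_unit :: "(nat \<Rightarrow> 'n::finite) \<Rightarrow> nat \<Rightarrow> nat \<Rightarrow> 'f::field^'n^'n"
  where "matrix_unit \<iota> i j = (\<chi> p q. if p = \<iota> i \<and> q = \<iota> j then 1 else 0)"

definition sl_basis :: "(nat \<Rightarrow> 'n::finite) \<Rightarrow> ('f::field^'n^'n) set"
  where "sl_basis \<iota> =
    {matrix_unit \<iota> i j | i j. i \<in> {1..CARD('n)} \<and> j \<in> {1..CARD('n)} \<and> i \<noteq> j} \<union>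
    {matrix_unit \<iota> i i - matrix_unit \<iota> (i + 1) (i + 1) | i. 1 \<le> i \<and> i < CARD('n)}"

definition mat_basis :: "(nat \<Rightarrow> 'n::finite) \<Rightarrow> ('f::field^'n^'n) set"
  where "mat_basis \<iota> = insert (mat 1) (sl_basis \<iota>)"

text \<open>The elementary operator \<open>\<phi>\<^sub>a\<^sub>b\<close> and the \<open>U\<close>-polynomial \<open>x\<^sub>i\<^sup>a\<^sup>b\<close>.\<close>

definition elem_op ::
  "(nat \<Rightarrow> 'n::finite) \<Rightarrow> 'f::field^'n^'n \<Rightarrow> 'f^'n^'n \<Rightarrow> 'f^'n^'n \<Rightarrow> 'f^'n^'n"
  where "elem_op \<iota> a b =
    (THE u. mlinear u \<and> u a = b \<and> (\<forall>c \<in> mat_basis \<iota> - {a}. u c = 0))"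

definition uvar_elem ::
  "(nat \<Rightarrow> 'n::finite) \<Rightarrow> nat \<Rightarrow> 'f::field^'n^'n \<Rightarrow> 'f^'n^'n \<Rightarrow> ('f, 'n) upoly"
  where "uvar_elem \<iota> i a b = uvar i (Abs_uop (elem_op \<iota> a b))"

definition commutator :: "'a::ring \<Rightarrow> 'a \<Rightarrow> 'a"
  where "commutator f h = f * h - h * f"

end

theory Submission
  imports Defs
begin

text \<open>
  Write \<open>sl\<close> for the trace-zero matrices. Since \<open>(ad E\<^sub>1\<^sub>2)\<^sup>2\<close> is an operator of rank one and \<open>sl\<close> is a simple
  Lie algebra, \<open>U\<close> contains every operator \<open>A \<mapsto> \<xi>(A) s\<close> with \<open>s\<close> in \<open>sl\<close> and \<open>\<xi>\<close> a functional that
  vanishes at the identity (\<open>ops_functional\<close>), and it contains \<open>\<phi>\<^sub>g\<^sub>g\<close>. So \<open>U\<close>-polynomials are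
  noncommutative polynomials in letters \<open>X \<alpha> s\<close>, linear in the target \<open>s\<close> from \<open>sl\<close>, where the
  source \<open>\<alpha>\<close> is a variable with a coordinate, and in letters \<open>Z l\<close> for the scalar parts of the
  variables. A derivation \<open>ad c\<close> acts on the targets by the bracket and kills the \<open>Z l\<close>.
  Evaluation in matrices sends \<open>X \<alpha> s\<close> to \<open>t\<^sub>\<alpha> s\<close> and \<open>Z l\<close> to \<open>t\<^sub>l\<close> for independent commuting
  unknowns \<open>t\<close>, so the identities are the linear relations between words with the same multiset
  of sources whose matrix products of targets cancel.

  The four polynomials generate these relations. Linear substitutions move them to arbitrary
  sources. Acting with derivations on the first one shows that \<open>X \<alpha> s * X \<beta> t\<close> depends only on
  the matrix product \<open>s ** t\<close> (\<open>pr_factors\<close>); an associativity argument extends this to words of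
  any length (\<open>associative_factors\<close>, \<open>X_nf\<close>). Acting on the second one makes the result symmetric
  in the sources (\<open>nf_perm\<close>), and the last two make the \<open>Z l\<close> central. Hence every
  \<open>U\<close>-polynomial is congruent to a sum of normal forms, one for each multiset of sources and
  linear in a matrix, and such a sum is an identity only if all these matrices vanish, because
  distinct monomials are linearly independent (\<open>Id_U_subset\<close>).

  For minimality it is enough to find, for each of the four polynomials, a \<open>T\<^sub>U\<close>-ideal containing
  the other three but not this one. The identities of any algebra with an \<open>L\<close>-action, for all
  homomorphisms commuting with \<open>L\<close>, form a \<open>T\<^sub>U\<close>-ideal. As the four polynomials are quadratic,
  algebras in which all products of three elements vanish suffice: they are given by a bilinear
  \<open>L\<close>-equivariant map, and four such maps serve (\<open>independent1\<close> to \<open>independent4\<close>).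
\<close>


section \<open>Matrix units and trace-zero matrices\<close>

definition munit :: "'n \<Rightarrow> 'n \<Rightarrow> 'f::field^'n^'n"
  where "munit p q = (\<chi> i j. if i = p \<and> j = q then 1 else 0)"

lemma munit_nth: "munit p q $ i $ j = (if i = p \<and> j = q then 1 else 0)"
  by (simp add: munit_def)

lemma munit_mult_nth:
  fixes A :: "'f::field^'n::finite^'n"
  shows "(munit p q ** A) $ i $ j = (if i = p then A $ q $ j else 0)"
    and "(A ** munit p q) $ i $ j = (if j = q then A $ i $ p else 0)"
  by (auto simp: matrix_matrix_mult_def munit_nth if_distrib[of "\<lambda>x. x * _"]
      if_distrib[of "\<lambda>x. _ * x"] cong: if_cong)

lemma munit_mult: "munit p q ** munit r s = (if q = r then munit p s else 0)"
  for p :: "'n::finite"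
  by (auto simp: vec_eq_iff munit_mult_nth munit_nth)

lemma mscale_nth [simp]: "mscale c A $ i $ j = c * A $ i $ j"
  by (simp add: mscale_def)

lemma trace_munit: "trace (munit p q :: 'f::field^'n::finite^'n) = (if p = q then 1 else 0)"
proof -
  have "trace (munit p q :: 'f^'n^'n) = (\<Sum>i\<in>UNIV. if i = p then (if p = q then 1 else 0) else 0)"
    unfolding trace_def by (rule sum.cong) (auto simp: munit_nth)
  then show ?thesis by simp
qed

lemma trace_mscale: "trace (mscale c A) = c * trace A"
  for A :: "'f::field^'n::finite^'n"
  by (simp add: trace_def sum_distrib_left)

lemma matrix_mult_diff: "A ** (B - C) = A ** B - A ** C" "(B - C) ** A = B ** A - C ** A"
  for A B C :: "'f::field^'n::finite^'n"
  by (auto simp: vec_eq_iff matrix_matrix_mult_def algebra_simps sum_subtractf)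

lemma matrix_mult_minus: "A ** (- B) = - (A ** B)" "(- B) ** A = - (B ** A)"
  for A B :: "'f::field^'n::finite^'n"
  by (auto simp: vec_eq_iff matrix_matrix_mult_def sum_negf)

lemmas matrix_ring_simps =
  matrix_mult_diff matrix_mult_minus matrix_add_ldistrib matrix_add_rdistrib mscale_simps

lemma trace_zero: "trace (0 :: 'f::field^'n::finite^'n) = 0"
  by (simp add: trace_def)

lemma trace_minus: "trace (- A) = - trace A" for A :: "'f::field^'n::finite^'n"
  by (simp add: trace_def sum_negf)

lemmas trace_simps = trace_add trace_sub trace_mscale trace_munit trace_zero trace_minus

definition lie :: "'f::field^'n::finite^'n \<Rightarrow> 'f^'n^'n \<Rightarrow> 'f^'n^'n"
  where "lie c A = c ** A - A ** c"

lemma lie_add: "lie c (A + B) = lie c A + lie c B"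
  and lie_mscale: "lie c (mscale x A) = mscale x (lie c A)"
  and lie_diff: "lie c (A - B) = lie c A - lie c B"
  by (simp_all add: lie_def matrix_ring_simps) (simp add: vec_eq_iff algebra_simps)

lemma trace_lie: "trace (lie c A) = 0"
  by (simp add: lie_def trace_sub trace_mul_sym[of c A])

lemma lie_mult: "lie c (A ** B) = lie c A ** B + A ** lie c B"
  by (simp add: lie_def matrix_ring_simps matrix_mul_assoc)

lemma lie_munit:
  "lie (munit p q) (munit r s) =
    (if q = r then munit p s else 0) - (if s = p then munit r q else 0)"
  by (simp add: lie_def munit_mult)

lemma additive_sum:
  assumes "P 0" and "\<And>x y. P x \<Longrightarrow> P y \<Longrightarrow> P (x + y)" and "\<And>i. i \<in> I \<Longrightarrow> P (f i)"
  shows "P (sum f I)"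
  using assms(3) by (induction I rule: infinite_finite_induct) (auto intro: assms)

text \<open>
  The off-diagonal units in the rows from \<open>R\<close> and the differences of diagonal units span the
  trace-zero matrices supported in these rows: the diagonal entry in row \<open>o'\<close> is determined by
  the others. Proofs by relations often know a statement only for matrices that vanish on a given
  row, which is what the set of rows is for.
\<close>

lemma sl_row_induct [consumes 3, case_names zero add scale off diag]:
  fixes s :: "'f::field^'n::finite^'n"
  assumes tr: "trace s = 0" and rows: "\<forall>i q. i \<notin> R \<longrightarrow> s $ i $ q = 0" and o: "o' \<in> R"
    and zero: "P 0"
    and add: "\<And>s t. trace s = 0 \<Longrightarrow> trace t = 0 \<Longrightarrow> P s \<Longrightarrow> P t \<Longrightarrow> P (s + t)"
    and scale: "\<And>c s. trace s = 0 \<Longrightarrow> P s \<Longrightarrow> P (mscale c s)"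
    and off: "\<And>i q. i \<in> R \<Longrightarrow> i \<noteq> q \<Longrightarrow> P (munit i q)"
    and diag: "\<And>i. i \<in> R \<Longrightarrow> i \<noteq> o' \<Longrightarrow> P (munit i i - munit o' o')"
  shows "P s"
proof -
  define b where "b i q = (if i = q then munit i i - munit o' o' else munit i q :: 'f^'n^'n)" for i q
  have trd: "(\<Sum>i\<in>R. s $ i $ i) = 0"
  proof -
    have "trace s = (\<Sum>i\<in>R. s $ i $ i)"
      unfolding trace_def by (rule sum.mono_neutral_right) (auto simp: rows)
    then show ?thesis using tr by simp
  qed
  have "s $ u $ v = (\<Sum>i\<in>R. \<Sum>q\<in>UNIV. mscale (s $ i $ q) (b i q)) $ u $ v" for u v
  proof -
    have "(\<Sum>i\<in>R. \<Sum>q\<in>UNIV. mscale (s $ i $ q) (b i q)) $ u $ v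
        = (\<Sum>i\<in>R. \<Sum>q\<in>UNIV. (if q = v then (if i = u then s $ i $ v else 0) else 0)
            - (if q = i then s $ i $ i * (if u = o' \<and> v = o' then 1 else 0) else 0))"
      by (auto simp: sum_component b_def munit_nth intro!: sum.cong)
    also have "\<dots> = (\<Sum>i\<in>R. (if i = u then s $ i $ v else 0)
            - s $ i $ i * (if u = o' \<and> v = o' then 1 else 0))"
      by (intro sum.cong refl) (simp add: sum_subtractf)
    also have "\<dots> = (if u \<in> R then s $ u $ v else 0)"
      by (simp add: sum_subtractf trd sum.delta flip: sum_distrib_right)
    also have "\<dots> = s $ u $ v" using rows by auto
    finally show ?thesis by simp
  qed
  then have eq: "s = (\<Sum>i\<in>R. \<Sum>q\<in>UNIV. mscale (s $ i $ q) (b i q))"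
    unfolding vec_eq_iff by blast
  have "P (b i q)" and "trace (b i q) = 0" if "i \<in> R" for i q
    by (cases "q = o'"; use that zero off diag in \<open>auto simp: b_def trace_simps\<close>)+
  then have "P (mscale c (b i q)) \<and> trace (mscale c (b i q)) = 0" if "i \<in> R" for i q c
    using that scale by (simp add: trace_mscale)
  then have "(\<lambda>x. P x \<and> trace x = 0) (\<Sum>i\<in>R. \<Sum>q\<in>UNIV. mscale (s $ i $ q) (b i q))"
    by (intro additive_sum[where P = "\<lambda>x. P x \<and> trace x = 0"])
      (auto intro: add zero simp: trace_simps)
  then show ?thesis using eq by simp
qed

lemma sl_induct [consumes 1, case_names zero add scale off diag]:
  fixes s :: "'f::field^'n::finite^'n"
  assumes "trace s = 0" and "P 0"
    and "\<And>s t. trace s = 0 \<Longrightarrow> trace t = 0 \<Longrightarrow> P s \<Longrightarrow> P t \<Longrightarrow> P (s + t)"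
    and "\<And>c s. trace s = 0 \<Longrightarrow> P s \<Longrightarrow> P (mscale c s)"
    and "\<And>i q. i \<noteq> q \<Longrightarrow> P (munit i q)"
    and "\<And>i. i \<noteq> o' \<Longrightarrow> P (munit i i - munit o' o')"
  shows "P s"
  by (rule sl_row_induct[where R = UNIV and o' = o']) (use assms in auto)

lemma matrix_induct [case_names zero add scale unit]:
  fixes A :: "'f::field^'n::finite^'n"
  assumes zero: "P 0" and add: "\<And>A B. P A \<Longrightarrow> P B \<Longrightarrow> P (A + B)"
    and scale: "\<And>c A. P A \<Longrightarrow> P (mscale c A)" and unit: "\<And>p q. P (munit p q)"
  shows "P A"
proof -
  obtain o' :: 'n where True by simp
  define B where "B = A - mscale (trace A) (munit o' o')"
  have "trace B = 0" by (simp add: B_def trace_simps)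
  then have "P B"
  proof (induction B rule: sl_induct[where o' = o'])
    case (diag i)
    have "munit i i - munit o' o' = munit i i + mscale (- 1) (munit o' o' :: 'f^'n^'n)"
      by (simp add: mscale_simps)
    then show ?case using add unit scale by metis
  qed (auto intro: assms)
  then have "P (B + mscale (trace A) (munit o' o'))" using add scale unit by blast
  then show ?thesis by (simp add: B_def)
qed

text \<open>
  An explicit form of the simplicity of \<open>sl\<close>. Brackets with \<open>E\<^sub>p\<^sub>i\<close> change the row index of
  \<open>E\<^sub>i\<^sub>j\<close>, and \<open>[E\<^sub>j\<^sub>i, [E\<^sub>j\<^sub>i, E\<^sub>i\<^sub>j]] = -2 E\<^sub>j\<^sub>i\<close> interchanges the two indices, so all off-diagonal
  units are reached; their brackets give the diagonal part.
\<close>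

lemma lie_closed_sl:
  fixes i j :: "'n::finite" and s :: "'f::field_char_0^'n^'n"
  assumes add: "\<And>s t. P s \<Longrightarrow> P t \<Longrightarrow> P (s + t)" and scale: "\<And>c s. P s \<Longrightarrow> P (mscale c s)"
    and lie: "\<And>c s. P s \<Longrightarrow> P (lie c s)"
    and ij: "i \<noteq> j" and base: "P (munit i j)"
    and tr: "trace s = 0"
  shows "P s"
proof -
  have neg: "P (- s)" if "P s" for s
    using scale[OF that, of "- 1"] by (simp add: mscale_simps)
  have row: "P (munit p j)" if "P (munit i j)" "i \<noteq> j" "p \<noteq> j" for p i j
    using lie[OF that(1), of "munit p i"] that by (auto simp: lie_munit)
  have h: "P (munit j j - munit i i)" if "P (munit i j)" "i \<noteq> j" for i j
    using lie[OF that(1), of "munit j i"] that by (auto simp: lie_munit)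
  have flip: "P (munit j i)" if "P (munit i j)" "i \<noteq> j" for i j
  proof -
    have "lie (munit j i) (munit j j - munit i i) = mscale (- 2 :: 'f) (munit j i)"
      using that(2) by (simp add: lie_diff lie_munit) (simp add: vec_eq_iff)
    then have "P (mscale (- 2) (munit j i))"
      using lie[OF h[OF that], of "munit j i"] by simp
    then have "P (mscale (- 1 / 2) (mscale (- 2) (munit j i)))" by (rule scale)
    then show ?thesis by (simp add: mscale_simps)
  qed
  have all: "P (munit p q)" if "p \<noteq> q" for p q
  proof (cases "q = j")
    case True
    then show ?thesis using row[OF base ij] that by simp
  next
    case False
    have "P (munit q j)" using row[OF base ij] False by simp
    then have "P (munit j q)" using flip False by simp
    then show ?thesis using row[of j q p] False that by simp
  qed
  show ?thesis using tr
  proof (induction s rule: sl_induct[where o' = i])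
    case zero
    then show ?case using scale[OF base, of 0] by (simp add: mscale_simps)
  next
    case (diag p)
    then show ?case using h[OF all, of i p] by simp
  qed (auto intro: add scale all)
qed

text \<open>
  The bracket \<open>[E\<^sub>i\<^sub>j, E\<^sub>i\<^sub>i] = -E\<^sub>i\<^sub>j\<close> leads into \<open>sl\<close>, whose complement is spanned by \<open>E\<^sub>i\<^sub>i\<close>.
\<close>

lemma lie_closed_UNIV:
  fixes i j :: "'n::finite" and m :: "'f::field_char_0^'n^'n"
  assumes add: "\<And>s t. P s \<Longrightarrow> P t \<Longrightarrow> P (s + t)" and scale: "\<And>c s. P s \<Longrightarrow> P (mscale c s)"
    and lie: "\<And>c s. P s \<Longrightarrow> P (lie c s)"
    and ij: "i \<noteq> j" and base: "P (munit i i)"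
  shows "P m"
proof -
  have "P (mscale (- 1) (lie (munit i j) (munit i i)))" by (intro scale lie base)
  then have off: "P (munit i j)" using ij by (simp add: lie_munit mscale_simps)
  have "P (m - mscale (trace m) (munit i i))"
    by (rule lie_closed_sl[of P, OF add scale lie ij off]) (simp_all add: trace_simps)
  then have "P ((m - mscale (trace m) (munit i i)) + mscale (trace m) (munit i i))"
    by (rule add) (intro scale base)
  then show ?thesis by simp
qed


section \<open>Linear maps modulo an ideal\<close>

definition sl :: "('f::field^'n::finite^'n) set"
  where "sl = {s. trace s = 0}"

lemma sl_simps [simp]:
  "s \<in> sl \<Longrightarrow> t \<in> sl \<Longrightarrow> s + t \<in> sl" "s \<in> sl \<Longrightarrow> t \<in> sl \<Longrightarrow> s - t \<in> sl"
  "s \<in> sl \<Longrightarrow> mscale c s \<in> sl" "s \<in> sl \<Longrightarrow> - s \<in> sl" "0 \<in> sl" "lie A B \<in> sl"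
  "p \<noteq> q \<Longrightarrow> munit p q \<in> sl" "munit p p - munit q q \<in> sl"
  by (simp_all add: sl_def trace_simps trace_lie)

text \<open>
  The linear map that takes the matrix unit \<open>E\<^sub>r\<^sub>q\<close> to \<open>n r q\<close>.
\<close>

definition lin :: "('n::finite \<Rightarrow> 'n \<Rightarrow> ('f::field, 's) falg) \<Rightarrow> 'f^'n^'n \<Rightarrow> ('f, 's) falg"
  where "lin n m = (\<Sum>r\<in>UNIV. \<Sum>q\<in>UNIV. fscale (m $ r $ q) (n r q))"

lemma fscale_zero [simp]: "fscale 0 p = 0" "fscale c 0 = 0"
  by (simp_all add: fscale_def)

lemma fscale_minus: "fscale (- c) p = - fscale c p" "fscale c (- p) = - fscale c p"
  for p :: "('f::ring_1, 's) falg"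
  by (simp_all add: fscale_def single_uminus)

lemma fscale_sum: "fscale c (sum f A) = (\<Sum>i\<in>A. fscale c (f i))"
  by (induction A rule: infinite_finite_induct) (simp_all add: fscale_add)

lemma lin_add: "lin n (A + B) = lin n A + lin n B"
  by (simp add: lin_def fscale_add_left sum.distrib)

lemma lin_mscale: "lin n (mscale c A) = fscale c (lin n A)"
  by (simp add: lin_def fscale_sum fscale_fscale)

lemma lin_zero [simp]: "lin n 0 = 0"
  by (simp add: lin_def)

lemma lin_minus: "lin n (- A) = - lin n A"
  using lin_mscale[of n "- 1" A] by (simp add: mscale_simps fscale_minus fscale_one)

lemma lin_diff: "lin n (A - B) = lin n A - lin n B"
  using lin_add[of n A "- B"] by (simp add: lin_minus)

lemma lin_munit [simp]: "lin n (munit r q) = n r q"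
proof -
  have "lin n (munit r q) = (\<Sum>i\<in>UNIV. \<Sum>j\<in>UNIV. if j = q then if i = r then n r q else 0 else 0)"
    unfolding lin_def by (intro sum.cong refl) (auto simp: munit_nth fscale_one)
  then show ?thesis by simp
qed

locale falg_mod =
  fixes R :: "('f::field_char_0, 's) falg set"
begin

text \<open>
  The quotient by the ideal depends on \<open>R\<close>, so it is not a type; its equations are expressed as
  congruences.
\<close>

definition cong :: "('f, 's) falg \<Rightarrow> ('f, 's) falg \<Rightarrow> bool" (infix "\<simeq>" 50)
  where "p \<simeq> q \<longleftrightarrow> p - q \<in> ideal_gen R"

lemma cong_refl [simp]: "p \<simeq> p"
  by (simp add: cong_def ideal_gen.zero)

lemma cong_sym: "p \<simeq> q \<Longrightarrow> q \<simeq> p"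
  by (simp add: cong_def ideal_cong_sym)

lemma cong_trans [trans]: "p \<simeq> q \<Longrightarrow> q \<simeq> r \<Longrightarrow> p \<simeq> r"
  unfolding cong_def by (rule ideal_cong_trans)

lemma cong_add: "p \<simeq> p' \<Longrightarrow> q \<simeq> q' \<Longrightarrow> p + q \<simeq> p' + q'"
  unfolding cong_def by (rule ideal_cong_add)

lemma cong_diff: "p \<simeq> p' \<Longrightarrow> q \<simeq> q' \<Longrightarrow> p - q \<simeq> p' - q'"
  unfolding cong_def by (rule ideal_cong_minus)

lemma cong_minus: "p \<simeq> p' \<Longrightarrow> - p \<simeq> - p'"
  unfolding cong_def by (rule ideal_cong_uminus)

lemma cong_mult: "p \<simeq> p' \<Longrightarrow> q \<simeq> q' \<Longrightarrow> p * q \<simeq> p' * q'"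
  unfolding cong_def by (rule ideal_cong_mult)

lemma cong_fscale: "p \<simeq> q \<Longrightarrow> fscale c p \<simeq> fscale c q"
  unfolding cong_def by (simp add: fscale_ideal_gen flip: fscale_diff)

lemma cong_sum: "(\<And>i. i \<in> I \<Longrightarrow> f i \<simeq> g i) \<Longrightarrow> sum f I \<simeq> sum g I"
  by (induction I rule: infinite_finite_induct) (auto intro: cong_add)

lemma cong_lin: "(\<And>r q. n r q \<simeq> n' r q) \<Longrightarrow> lin n m \<simeq> lin n' m"
  unfolding lin_def by (intro cong_sum cong_fscale)

lemma cong_fscale_cancel:
  assumes "fscale c p \<simeq> 0" "c \<noteq> 0"
  shows "p \<simeq> 0"
  using cong_fscale[OF assms(1), of "inverse c"] assms(2) by (simp add: fscale_fscale fscale_one)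

lemma cong_add_zero_iff: "p \<simeq> 0 \<Longrightarrow> p + q \<simeq> 0 \<longleftrightarrow> q \<simeq> 0"
  using cong_add[of p 0 q 0] cong_diff[of "p + q" 0 p 0] by auto

text \<open>
  A letter depends linearly on its operator only modulo the defining relations, hence the
  linearity up to congruence.
\<close>

definition lin_on :: "('f^'n::finite^'n) set \<Rightarrow> ('f^'n^'n \<Rightarrow> ('f, 's) falg) \<Rightarrow> bool"
  where "lin_on D f \<longleftrightarrow>
    (\<forall>s\<in>D. \<forall>t\<in>D. f (s + t) \<simeq> f s + f t) \<and> (\<forall>c. \<forall>s\<in>D. f (mscale c s) \<simeq> fscale c (f s))"

lemma lin_on_add: "lin_on D f \<Longrightarrow> s \<in> D \<Longrightarrow> t \<in> D \<Longrightarrow> f (s + t) \<simeq> f s + f t"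
  and lin_on_mscale: "lin_on D f \<Longrightarrow> s \<in> D \<Longrightarrow> f (mscale c s) \<simeq> fscale c (f s)"
  by (simp_all add: lin_on_def)

lemma lin_on_zero: "lin_on D f \<Longrightarrow> s \<in> D \<Longrightarrow> f 0 \<simeq> 0"
  using lin_on_mscale[of D f s 0] by (simp add: mscale_simps)

lemma lin_on_minus: "lin_on D f \<Longrightarrow> s \<in> D \<Longrightarrow> f (- s) \<simeq> - f s"
  using lin_on_mscale[of D f s "- 1"] by (simp add: mscale_simps fscale_minus fscale_one)

lemma lin_on_lin: "lin_on D (lin n)"
  by (simp add: lin_on_def lin_add lin_mscale)

lemma lin_on_mult_left: "lin_on D f \<Longrightarrow> lin_on D (\<lambda>m. p * f m)"
  unfolding lin_on_def
  by (simp add: fscale_mult_right cong_mult flip: distrib_left)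

lemma lin_on_mult_right: "lin_on D f \<Longrightarrow> lin_on D (\<lambda>m. f m * p)"
  unfolding lin_on_def
  by (simp add: fscale_mult_left cong_mult flip: distrib_right)

lemma lin_on_comp:
  assumes "lin_on D f" and "\<And>s. s \<in> D' \<Longrightarrow> l s \<in> D"
    and "\<And>s t. l (s + t) = l s + l t" and "\<And>c s. l (mscale c s) = mscale c (l s)"
  shows "lin_on D' (\<lambda>s. f (l s))"
  using assms by (simp add: lin_on_def)

lemma lin_on_eq_rows:
  assumes f: "lin_on sl f" and g: "lin_on sl g" and s: "s \<in> sl"
    and rows: "\<forall>i q. i \<notin> I \<longrightarrow> s $ i $ q = 0" and o: "o' \<in> I"
    and off: "\<And>i q. i \<in> I \<Longrightarrow> i \<noteq> q \<Longrightarrow> f (munit i q) \<simeq> g (munit i q)"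
    and diag: "\<And>i. i \<in> I \<Longrightarrow> i \<noteq> o' \<Longrightarrow>
      f (munit i i - munit o' o') \<simeq> g (munit i i - munit o' o')"
  shows "f s \<simeq> g s"
  using s[unfolded sl_def mem_Collect_eq] rows o
proof (induction s rule: sl_row_induct)
  case zero
  have "f 0 \<simeq> 0" "g 0 \<simeq> 0" using lin_on_zero[OF f s] lin_on_zero[OF g s] .
  then show ?case by (meson cong_sym cong_trans)
next
  case (add s t)
  then have st: "s \<in> sl" "t \<in> sl" by (simp_all add: sl_def)
  have "f (s + t) \<simeq> f s + f t" using f st by (rule lin_on_add)
  also have "\<dots> \<simeq> g s + g t" using add by (intro cong_add)
  also have "\<dots> \<simeq> g (s + t)" using lin_on_add[OF g st] by (rule cong_sym)
  finally show ?case .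
next
  case (scale c s)
  then have s: "s \<in> sl" by (simp add: sl_def)
  have "f (mscale c s) \<simeq> fscale c (f s)" using f s by (rule lin_on_mscale)
  also have "\<dots> \<simeq> fscale c (g s)" using scale by (intro cong_fscale)
  also have "\<dots> \<simeq> g (mscale c s)" using lin_on_mscale[OF g s] by (rule cong_sym)
  finally show ?case .
next
  case (off i q)
  then show ?case by (rule assms(6))
next
  case (diag i)
  then show ?case by (rule assms(7))
qed

lemma lin_on_eq_sl:
  assumes "lin_on sl f" and "lin_on sl g" and "s \<in> sl"
    and "\<And>i q. i \<noteq> q \<Longrightarrow> f (munit i q) \<simeq> g (munit i q)"
    and "\<And>i. i \<noteq> o' \<Longrightarrow> f (munit i i - munit o' o') \<simeq> g (munit i i - munit o' o')"
  shows "f s \<simeq> g s"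
  by (rule lin_on_eq_rows[of f g s UNIV o']) (use assms in auto)

lemma lin_on_eq_UNIV:
  assumes f: "lin_on UNIV f" and g: "lin_on UNIV g"
    and unit: "\<And>p q. f (munit p q) \<simeq> g (munit p q)"
  shows "f m \<simeq> g m"
proof (induction m rule: matrix_induct)
  case zero
  have "f 0 \<simeq> 0" "g 0 \<simeq> 0" using f g by (auto intro: lin_on_zero)
  then show ?case by (meson cong_sym cong_trans)
next
  case (add s t)
  have "f (s + t) \<simeq> f s + f t" using f by (simp add: lin_on_add)
  also have "\<dots> \<simeq> g s + g t" using add by (intro cong_add)
  also have "\<dots> \<simeq> g (s + t)" using lin_on_add[OF g] by (simp add: cong_sym)
  finally show ?case .
next
  case (scale c s)
  have "f (mscale c s) \<simeq> fscale c (f s)" using f by (simp add: lin_on_mscale)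
  also have "\<dots> \<simeq> fscale c (g s)" using scale by (intro cong_fscale)
  also have "\<dots> \<simeq> g (mscale c s)" using lin_on_mscale[OF g] by (simp add: cong_sym)
  finally show ?case .
qed (rule unit)

end


section \<open>Bilinear maps that only depend on the matrix product\<close>

text \<open>
  Every matrix unit \<open>E\<^sub>r\<^sub>q\<close>, also a diagonal one, is a product of two trace-zero matrices:
  \<open>lfac r = E\<^sub>r\<^sub>c\<close> with some \<open>c \<noteq> r\<close>, and \<open>rfac r q = E\<^sub>c\<^sub>q\<close>, where the diagonal unit that occurs
  for \<open>q = c\<close> is corrected by \<open>E\<^sub>r\<^sub>r\<close>, which does not change the product. With two indices there is
  no choice of \<open>c\<close> that avoids both \<open>r\<close> and \<open>q\<close>.
\<close>

definition oth :: "'n \<Rightarrow> 'n" where "oth r = (SOME q. q \<noteq> r)"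

definition lfac :: "'n \<Rightarrow> 'f::field^'n::finite^'n" where "lfac r = munit r (oth r)"

definition rfac :: "'n \<Rightarrow> 'n \<Rightarrow> 'f::field^'n::finite^'n"
  where "rfac r q = (if q = oth r then munit q q - munit r r else munit (oth r) q)"

locale falg_mod_two = falg_mod R for R :: "('f::field_char_0, 's) falg set" +
  fixes a b :: "'n::finite"
  assumes ab: "a \<noteq> b"
begin

lemma oth: "oth r \<noteq> (r :: 'n)"
proof -
  have "\<exists>q. q \<noteq> r" using ab by metis
  then show ?thesis unfolding oth_def by (rule someI_ex)
qed

lemma lfac_sl [simp]: "lfac (r :: 'n) \<in> sl"
  using oth[of r] by (simp add: lfac_def)

lemma rfac_sl [simp]: "rfac (r :: 'n) q \<in> sl"
  using oth[of r] by (simp add: rfac_def)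

lemma lfac_rfac [simp]: "lfac (r :: 'n) ** rfac r q = munit r q"
  using oth[of r] by (simp add: lfac_def rfac_def matrix_ring_simps munit_mult)

text \<open>
  A bilinear map that factors through the product determines the linear map through which it
  factors, since all matrix units are products.
\<close>

lemma factor_canonical:
  assumes Q: "\<And>s m. s \<in> sl \<Longrightarrow> m \<in> D \<Longrightarrow> Q s m \<simeq> lin n (s ** m)"
    and D: "sl \<subseteq> (D :: ('f^'n^'n) set)" and s: "s \<in> sl" "m \<in> D"
  shows "Q s m \<simeq> lin (\<lambda>r q. Q (lfac r) (rfac r q)) (s ** m)"
proof -
  have "n r q \<simeq> Q (lfac r) (rfac r q)" for r q
    using Q[OF lfac_sl subsetD[OF D rfac_sl], of r r q] by (simp add: cong_sym)
  then have "lin n (s ** m) \<simeq> lin (\<lambda>r q. Q (lfac r) (rfac r q)) (s ** m)" by (rule cong_lin)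
  with Q[OF s] show ?thesis by (rule cong_trans)
qed

text \<open>
  If a trilinear expression in \<open>s\<close>, \<open>s'\<close>, \<open>t\<close> depends only on \<open>s\<close> and \<open>s' ** t\<close>, and also only on
  \<open>s ** s'\<close> and \<open>t\<close>, then it depends only on \<open>s ** s' ** t\<close>. For matrices \<open>s\<close>, \<open>s'\<close>, \<open>t\<close> without
  trace condition one would insert the identity; here the decompositions of the matrix units have to
  stay inside \<open>sl\<close>, which for two-by-two matrices leaves little freedom. The value \<open>n r q\<close>
  is read off from \<open>E\<^sub>r\<^sub>r\<close> in the first argument of \<open>P\<close>, where \<open>E\<^sub>r\<^sub>r = E\<^sub>r\<^sub>c E\<^sub>c\<^sub>r\<close> for any \<open>c \<noteq> r\<close>.
\<close>

lemma associative_factors: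
  fixes Q P :: "'f^'n^'n \<Rightarrow> 'f^'n^'n \<Rightarrow> ('f, 's) falg"
  assumes Q: "\<And>s. s \<in> sl \<Longrightarrow> lin_on UNIV (Q s)"
    and P: "\<And>t. t \<in> sl \<Longrightarrow> lin_on UNIV (\<lambda>m. P m t)"
    and QP: "\<And>s s' t. s \<in> sl \<Longrightarrow> s' \<in> sl \<Longrightarrow> t \<in> sl \<Longrightarrow> Q s (s' ** t) \<simeq> P (s ** s') t"
    and s: "s \<in> sl"
  shows "Q s m \<simeq> lin (\<lambda>r q. Q (lfac r) (rfac r q)) (s ** m)"
proof -
  define t where "t r q = (if q = r then munit r r - munit (oth r) (oth r) else munit r q :: 'f^'n^'n)"
    for r q :: 'n
  define n where "n r q = P (munit r r) (t r q)" for r q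
  have t: "t r q \<in> sl" "munit p r ** t r q = munit p q" for p r q
    using oth[of r] by (simp_all add: t_def matrix_ring_simps munit_mult)
  have diag: "P (munit r r) t' \<simeq> Q (munit r c) (munit c r ** t')" if "c \<noteq> r" "t' \<in> sl" for r c t'
    using QP[of "munit r c" "munit c r" t'] that by (auto simp: munit_mult intro: cong_sym)
  have Qn: "Q (munit r c) (munit c q) \<simeq> n r q" if "c \<noteq> r" for r c q
    unfolding n_def using diag[OF that t(1), of r q] by (simp add: t(2) cong_sym)
  have Qn': "Q (munit r c) (munit c r ** m) \<simeq> lin n (munit r r ** m)" if "c \<noteq> r" for r c m
  proof (rule lin_on_eq_UNIV[where f = "\<lambda>m. Q (munit r c) (munit c r ** m)"])
    show "lin_on UNIV (\<lambda>m. Q (munit r c) (munit c r ** m))"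
      using that by (intro lin_on_comp[OF Q]) (simp_all add: matrix_ring_simps)
    show "lin_on UNIV (\<lambda>m. lin n (munit r r ** m))"
      by (intro lin_on_comp[OF lin_on_lin[of UNIV]]) (simp_all add: matrix_ring_simps)
    fix p q
    have "Q (munit r c) 0 \<simeq> 0" using that by (intro lin_on_zero[OF Q]) auto
    then show "Q (munit r c) (munit c r ** munit p q) \<simeq> lin n (munit r r ** munit p q)"
      using Qn[OF that] by (auto simp: munit_mult)
  qed
  \<comment> \<open>The vanishing of these values, whose matrix products are zero, corrects the
    decomposition of off-diagonal units with the help of diagonal matrices in \<open>Pn\<close>.\<close>
  have Qz: "Q (munit r c) (munit r q) \<simeq> 0" if rc: "r \<noteq> c" for r c q
  proof (cases "q = r")
    case True
    have "Q (munit r c) (munit r c ** munit c r) \<simeq> P (munit r c ** munit r c) (munit c r)"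
      using rc by (intro QP) auto
    then have "Q (munit r c) (munit r r) \<simeq> P 0 (munit c r)" using rc by (simp add: munit_mult)
    also have "\<dots> \<simeq> 0" using rc by (intro lin_on_zero[OF P]) auto
    finally show ?thesis using True by simp
  next
    case False
    let ?h = "munit r r - munit c c :: 'f^'n^'n"
    have "Q (munit r c) (?h ** munit r q) \<simeq> P (munit r c ** ?h) (munit r q)"
      using rc False by (intro QP) auto
    then have "Q (munit r c) (munit r q) \<simeq> P (- munit r c) (munit r q)"
      using rc by (simp add: matrix_ring_simps munit_mult)
    also have "\<dots> \<simeq> - P (munit r c) (munit r q)" using False by (intro lin_on_minus[OF P]) auto
    also have "P (munit r c) (munit r q) = P (?h ** munit r c) (munit r q)"
      using rc by (simp add: matrix_ring_simps munit_mult)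
    also have "- \<dots> \<simeq> - Q ?h (munit r c ** munit r q)"
      using rc False by (intro cong_minus cong_sym[OF QP]) auto
    also have "\<dots> = - Q ?h 0" using rc by (simp add: munit_mult)
    also have "\<dots> \<simeq> - 0" by (intro cong_minus lin_on_zero[OF Q]) auto
    finally show ?thesis by simp
  qed
  \<comment> \<open>For \<open>c \<noteq> r\<close> the unit is written as \<open>E\<^sub>r\<^sub>c (E\<^sub>c\<^sub>c - E\<^sub>r\<^sub>r)\<close>, which needs no third index.\<close>
  have Pn: "P (munit r c) t' \<simeq> lin n (munit r c ** t')" if "t' \<in> sl" for r c t'
  proof (cases "c = r")
    case True
    have "P (munit r r) t' \<simeq> Q (munit r (oth r)) (munit (oth r) r ** t')"
      using oth that by (intro diag)
    also have "\<dots> \<simeq> lin n (munit r r ** t')" using oth by (rule Qn')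
    finally show ?thesis using True by simp
  next
    case False
    let ?h = "munit c c - munit r r :: 'f^'n^'n"
    have "P (munit r c ** ?h) t' \<simeq> Q (munit r c) (?h ** t')"
      using that False by (intro cong_sym[OF QP]) auto
    then have "P (munit r c) t' \<simeq> Q (munit r c) (?h ** t')"
      using False by (simp add: matrix_ring_simps munit_mult)
    also have "\<dots> \<simeq> lin n (munit r c ** t')"
    proof (rule lin_on_eq_UNIV[where f = "\<lambda>m. Q (munit r c) (?h ** m)"])
      show "lin_on UNIV (\<lambda>m. Q (munit r c) (?h ** m))"
        using False by (intro lin_on_comp[OF Q]) (simp_all add: matrix_ring_simps)
      show "lin_on UNIV (\<lambda>m. lin n (munit r c ** m))"
        by (intro lin_on_comp[OF lin_on_lin[of UNIV]]) (simp_all add: matrix_ring_simps)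
      fix p q
      have 1: "Q (munit r c) 0 \<simeq> 0" using False by (intro lin_on_zero[OF Q]) auto
      have "Q (munit r c) (- munit r q) \<simeq> - Q (munit r c) (munit r q)"
        using False by (intro lin_on_minus[OF Q]) auto
      also have "\<dots> \<simeq> - 0" using False by (intro cong_minus Qz) auto
      finally have 2: "Q (munit r c) (- munit r q) \<simeq> 0" by simp
      show "Q (munit r c) (?h ** munit p q) \<simeq> lin n (munit r c ** munit p q)"
        using 1 2 False Qn[of c r q] by (auto simp: munit_mult matrix_ring_simps)
    qed
    finally show ?thesis .
  qed
  have Pn': "P m t' \<simeq> lin n (m ** t')" if "t' \<in> sl" for m t'
  proof (rule lin_on_eq_UNIV[where f = "\<lambda>m. P m t'"])
    show "lin_on UNIV (\<lambda>m. lin n (m ** t'))"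
      by (intro lin_on_comp[OF lin_on_lin[of UNIV]]) (simp_all add: matrix_ring_simps)
  qed (use P Pn that in auto)
  have "Q s m \<simeq> lin n (s ** m)" if "s \<in> sl" for s m
  proof (rule lin_on_eq_UNIV[where f = "Q s"])
    show "lin_on UNIV (\<lambda>m. lin n (s ** m))"
      by (intro lin_on_comp[OF lin_on_lin[of UNIV]]) (simp_all add: matrix_ring_simps)
    fix r q
    have "Q s (lfac r ** rfac r q) \<simeq> P (s ** lfac r) (rfac r q)"
      using that by (intro QP) auto
    also have "\<dots> \<simeq> lin n ((s ** lfac r) ** rfac r q)" by (intro Pn') auto
    finally show "Q s (munit r q) \<simeq> lin n (s ** munit r q)"
      by (simp flip: matrix_mul_assoc)
  qed (use Q that in auto)
  then show ?thesis using factor_canonical[of UNIV Q n s m] s by simp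
qed

end


section \<open>Consequences of the four relations\<close>

lemma fscale_numeral:
  "fscale 2 x = x + x" "fscale 3 x = x + x + x" "fscale 4 x = x + x + x + x"
  for x :: "('f::field, 's) falg"
  using fscale_add_left[of 1 1 x] fscale_add_left[of 2 1 x] fscale_add_left[of 3 1 x]
  by (simp_all add: fscale_one)

text \<open>
  The words in the letters \<open>X \<alpha> s\<close> and \<open>Z i\<close> modulo an ideal that is stable under the derivations
  \<open>dd c\<close> and contains the four relations, for all sources. The indices \<open>a\<close> and \<open>b\<close> stand for 1
  and 2, and \<open>e\<close> is the matrix of the first generator.
\<close>

locale matrix_relations = falg_mod_two R a b
  for R :: "('f::field_char_0, 's) falg set" and a b :: "'n::finite" +
  fixes X :: "'l \<Rightarrow> 'f^'n^'n \<Rightarrow> ('f, 's) falg" and Z :: "'z \<Rightarrow> ('f, 's) falg"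
    and dd :: "'f^'n^'n \<Rightarrow> ('f, 's) falg \<Rightarrow> ('f, 's) falg"
    and e :: "'f^'n^'n"
  assumes dd_diff: "dd c (p - q) = dd c p - dd c q"
    and dd_fscale: "dd c (fscale x p) = fscale x (dd c p)"
    and dd_mult: "dd c (p * q) = dd c p * q + p * dd c q"
    and dd_ideal: "p \<in> ideal_gen R \<Longrightarrow> dd c p \<in> ideal_gen R"
    and dd_X: "s \<in> sl \<Longrightarrow> dd c (X \<alpha> s) \<simeq> X \<alpha> (lie c s)"
    and dd_Z: "dd c (Z i) \<simeq> 0"
    and X_lin: "lin_on sl (X \<alpha>)"
    and X_X_zero: "X \<alpha> (munit a b) * X \<beta> e \<simeq> 0"
    and X_X_swap: "X \<alpha> (munit a b) * X \<beta> (munit b a) \<simeq> X \<beta> (munit a b) * X \<alpha> (munit b a)"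
    and Z_Z: "Z i * Z j \<simeq> Z j * Z i"
    and Z_X: "Z i * X \<alpha> (munit a b) \<simeq> X \<alpha> (munit a b) * Z i"
    and e: "e = munit a b \<and> UNIV = {a, b} \<or> (\<exists>c. c \<noteq> a \<and> c \<noteq> b \<and> e = munit c a)"
begin

lemma dd_zero: "dd c 0 = 0"
  using dd_diff[of c 0 0] by simp

lemma dd_add: "dd c (p + q) = dd c p + dd c q"
  using dd_diff[of c "p + q" q] by simp

lemma dd_cong: "p \<simeq> q \<Longrightarrow> dd c p \<simeq> dd c q"
  using dd_ideal[of "p - q"] by (simp add: cong_def dd_diff)

lemma dd_cong_zero: "p \<simeq> 0 \<Longrightarrow> dd c p \<simeq> 0"
  using dd_cong[of p 0] by (simp add: dd_zero)

context
  fixes \<alpha> \<beta> :: 'l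
begin

abbreviation pr :: "'f^'n^'n \<Rightarrow> 'f^'n^'n \<Rightarrow> ('f, 's) falg"
  where "pr s t \<equiv> X \<alpha> s * X \<beta> t"

lemma pr_lin_left: "lin_on sl (\<lambda>s. pr s t)"
  by (rule lin_on_mult_right[OF X_lin])

lemma pr_lin_right: "lin_on sl (pr s)"
  by (rule lin_on_mult_left[OF X_lin])

lemma pr_zero: "pr 0 t \<simeq> 0" "pr s 0 \<simeq> 0"
  using lin_on_zero[OF pr_lin_left] lin_on_zero[OF pr_lin_right] sl_simps(5) by blast+

lemma dd_pr:
  assumes "s \<in> sl" "t \<in> sl"
  shows "dd c (pr s t) \<simeq> pr (lie c s) t + pr s (lie c t)"
  unfolding dd_mult using assms by (intro cong_add cong_mult dd_X cong_refl)

lemma pr_lie_zero: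
  assumes "pr s t \<simeq> 0" "s \<in> sl" "t \<in> sl"
  shows "pr (lie c s) t + pr s (lie c t) \<simeq> 0"
  using cong_trans[OF cong_sym[OF dd_pr[OF assms(2,3)]] dd_cong_zero[OF assms(1)]] .

text \<open>
  The matrices \<open>s\<close> with \<open>pr E\<^sub>i\<^sub>j s \<simeq> 0\<close> are stable under brackets with \<open>E\<^sub>p\<^sub>q\<close> for \<open>p \<noteq> j\<close> and \<open>q \<noteq> i\<close>,
  because these commute with \<open>E\<^sub>i\<^sub>j\<close>. Starting from \<open>E\<^sub>m\<^sub>i\<close>, such brackets reach a spanning set of the
  trace-zero matrices with zero row \<open>j\<close>, that is, of those with \<open>E\<^sub>i\<^sub>j s = 0\<close>.
\<close>

lemma pr_row_zero:
  assumes dist: "i \<noteq> j" "m \<noteq> i" "m \<noteq> j" and base: "pr (munit i j) (munit m i) \<simeq> 0"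
    and s: "s \<in> sl" and row: "\<And>q. s $ j $ q = 0"
  shows "pr (munit i j) s \<simeq> 0"
proof -
  let ?Q = "pr (munit i j)"
  have step: "?Q (lie (munit p q) t) \<simeq> 0" if "?Q t \<simeq> 0" "t \<in> sl" "p \<noteq> j" "q \<noteq> i" for p q t
  proof -
    have l: "lie (munit p q) (munit i j) = (0 :: 'f^'n^'n)" using that by (simp add: lie_munit)
    have "pr 0 t + ?Q (lie (munit p q) t) \<simeq> 0"
      using pr_lie_zero[OF that(1), of "munit p q"] that(2) dist(1) by (simp add: l)
    then show ?thesis by (simp add: cong_add_zero_iff[OF pr_zero(1)])
  qed
  have neg: "?Q t \<simeq> 0" if "?Q (- t) \<simeq> 0" "t \<in> sl" for t
  proof -
    have "- ?Q t \<simeq> 0"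
      using cong_trans[OF cong_sym[OF lin_on_minus[OF pr_lin_right that(2)]] that(1)] .
    from cong_minus[OF this] show ?thesis by simp
  qed
  have c1: "?Q (munit p i) \<simeq> 0" if "p \<noteq> i" "p \<noteq> j" for p
    using step[OF base, of p m] dist that base by (cases "p = m") (auto simp: lie_munit)
  have c2: "?Q (munit p q) \<simeq> 0" if "p \<noteq> i" "p \<noteq> j" "q \<noteq> i" "q \<noteq> p" for p q
  proof (rule neg)
    show "?Q (- munit p q) \<simeq> 0"
      using step[OF c1[OF that(1,2)], of i q] dist that by (auto simp: lie_munit)
  qed (use that in auto)
  have c3: "?Q (munit i i - munit p p) \<simeq> 0" if "p \<noteq> i" "p \<noteq> j" for p
    using step[OF c1[OF that], of i p] dist that by (auto simp: lie_munit)
  have c4: "?Q (munit i q) \<simeq> 0" if "q \<noteq> i" for q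
  proof -
    let ?x = "if q = m then 2 else 1 :: 'f"
    have "lie (munit i q) (munit i i - munit m m) = mscale (- ?x) (munit i q :: 'f^'n^'n)"
      using dist that by (auto simp: lie_diff lie_munit vec_eq_iff)
    then have "?Q (mscale (- ?x) (munit i q)) \<simeq> 0"
      using step[OF c3[OF dist(2,3)], of i q] dist that by auto
    moreover have "?Q (mscale (- ?x) (munit i q)) \<simeq> fscale (- ?x) (?Q (munit i q))"
      using that by (intro lin_on_mscale[OF pr_lin_right]) auto
    ultimately have "fscale (- ?x) (?Q (munit i q)) \<simeq> 0" by (meson cong_sym cong_trans)
    then show ?thesis by (rule cong_fscale_cancel) simp
  qed
  have "?Q s \<simeq> lin (\<lambda>_ _. 0) s"
  proof (rule lin_on_eq_rows[where I = "- {j}" and o' = i])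
    fix p q assume "p \<in> - {j}" "p \<noteq> q"
    then have "?Q (munit p q) \<simeq> 0" using c1[of p] c2[of p q] c4[of q] by (cases "p = i"; cases "q = i") auto
    then show "?Q (munit p q) \<simeq> lin (\<lambda>_ _. 0) (munit p q)" by simp
  next
    fix p assume "p \<in> - {j}" "p \<noteq> i"
    then have "?Q (munit p p - munit i i) \<simeq> 0" using c3[of p] by (intro neg[of "munit p p - munit i i"]) auto
    then show "?Q (munit p p - munit i i) \<simeq> lin (\<lambda>_ _. 0) (munit p p - munit i i)"
      by (simp add: lin_def)
  qed (use dist s row in \<open>auto intro: pr_lin_right lin_on_lin\<close>)
  then show ?thesis by (simp add: lin_def)
qed

text \<open>
  The relation for \<open>E\<^sub>a\<^sub>b\<close> is carried to all \<open>E\<^sub>i\<^sub>j\<close> by changing one index at a time. Changing the row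
  index takes one bracket. Changing the column index to \<open>l\<close> means to take two brackets with
  \<open>E\<^sub>j\<^sub>l\<close>, which acts like the permutation interchanging \<open>j\<close> and \<open>l\<close> and yields the hypothesis of
  \<open>pr_row_zero\<close> for the new index pair.
\<close>

lemma pr_base_all:
  assumes c: "c \<noteq> a" "c \<noteq> b" "e = munit c a" and ij: "i \<noteq> j"
    and s: "s \<in> sl" and row: "\<And>q. s $ j $ q = 0"
  shows "pr (munit i j) s \<simeq> 0"
proof -
  let ?Z = "\<lambda>i j. \<forall>s\<in>sl. (\<forall>q. s $ j $ q = 0) \<longrightarrow> pr (munit i j) s \<simeq> 0"
  have Zab: "?Z a b"
    using pr_row_zero[of a b c] X_X_zero[of \<alpha> \<beta>] c ab by auto
  have rowshift: "?Z l j" if Z: "?Z i j" and d: "i \<noteq> j" "l \<noteq> i" "l \<noteq> j" for i j l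
  proof (intro ballI impI)
    fix s :: "'f^'n^'n" assume s: "s \<in> sl" "\<forall>q. s $ j $ q = 0"
    have z: "pr (munit i j) t \<simeq> 0" if "t \<in> sl" "\<And>q. t $ j $ q = 0" for t
      using Z that by blast
    have "lie (munit l i) (munit i j) = (munit l j :: 'f^'n^'n)"
      using d by (simp add: lie_munit)
    then have *: "pr (munit l j) s + pr (munit i j) (lie (munit l i) s) \<simeq> 0"
      using pr_lie_zero[OF z[OF s(1)], of "munit l i"] s d by simp
    have "pr (munit i j) (lie (munit l i) s) \<simeq> 0"
    proof (rule z)
      show "lie (munit l i) s $ j $ q = 0" for q
        using s d by (simp add: lie_def munit_mult_nth)
    qed simp
    from cong_diff[OF * this] show "pr (munit l j) s \<simeq> 0" by simp
  qed
  have colshift: "?Z i l" if Z: "?Z i j" and d: "i \<noteq> j" "l \<noteq> i" "l \<noteq> j" for i j l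
  proof -
    have z: "pr (munit i j) (munit l i) \<simeq> 0"
      using Z d by (simp add: munit_nth)
    have l: "lie (munit j l) (munit i j) = (- munit i l :: 'f^'n^'n)"
      "lie (munit j l) (munit l i) = (munit j i :: 'f^'n^'n)"
      "lie (munit j l) (- munit i l) = (0 :: 'f^'n^'n)"
      "lie (munit j l) (munit j i) = (0 :: 'f^'n^'n)"
      using d by (auto simp: lie_def matrix_ring_simps munit_mult)
    have "pr (- munit i l) (munit l i) + pr (munit i j) (munit j i) \<simeq> 0"
      using pr_lie_zero[OF z, of "munit j l"] d by (simp add: l)
    from dd_cong_zero[OF this, of "munit j l"]
    have h0: "dd (munit j l) (pr (- munit i l) (munit l i))
        + dd (munit j l) (pr (munit i j) (munit j i)) \<simeq> 0"
      by (simp add: dd_add)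
    have "dd (munit j l) (pr (- munit i l) (munit l i))
        + dd (munit j l) (pr (munit i j) (munit j i)) \<simeq>
       (pr 0 (munit l i) + pr (- munit i l) (munit j i))
        + (pr (- munit i l) (munit j i) + pr (munit i j) 0)"
      using dd_pr[of "- munit i l" "munit l i" "munit j l"]
        dd_pr[of "munit i j" "munit j i" "munit j l"] d
      by (intro cong_add) (auto simp: l)
    also have "\<dots> \<simeq> (0 + - pr (munit i l) (munit j i))
        + (- pr (munit i l) (munit j i) + 0)"
      using d by (intro cong_add pr_zero lin_on_minus[OF pr_lin_left]) auto
    also have "\<dots> = fscale (- 2) (pr (munit i l) (munit j i))"
      by (simp add: fscale_minus fscale_numeral)
    finally have "fscale (- 2) (pr (munit i l) (munit j i)) \<simeq> 0"
      using h0 cong_sym cong_trans by blast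
    then have "pr (munit i l) (munit j i) \<simeq> 0" by (rule cong_fscale_cancel) simp
    then show ?thesis using pr_row_zero[of i l j] d by auto
  qed
  have "?Z i j"
  proof (cases "j = b")
    case True
    then show ?thesis using rowshift[OF Zab ab, of i] Zab ij by (cases "i = a") auto
  next
    case False
    obtain i' where i': "i' \<noteq> b" "i' \<noteq> j"
      using ab c by metis
    have Zb: "?Z i' b" using rowshift[OF Zab ab, of i'] Zab i' by (cases "i' = a") auto
    have Zj: "?Z i' j" using colshift[OF Zb i'(1) i'(2)[symmetric] False] .
    then show ?thesis using rowshift[OF Zj i'(2)] ij by (cases "i = i'") auto
  qed
  then show ?thesis using s row by blast
qed

text \<open>
  With at least three indices: \<open>pr E\<^sub>i\<^sub>j t\<close> depends only on row \<open>j\<close> of \<open>t\<close> by \<open>pr_base_all\<close>, which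
  gives the formula for one column index \<open>j\<close>, chosen as \<open>oth i\<close>. A bracket of the relations with
  zero row \<open>j\<close> transports it to another column index, and similarly to the differences of
  diagonal units. Each of these steps covers only the \<open>t\<close> with one row zero; two such spaces of
  trace-zero matrices together span \<open>sl\<close>, as a third row can absorb the trace.
\<close>

lemma pr_factors_three:
  assumes c: "c \<noteq> a" "c \<noteq> b" "e = munit c a" and s: "s \<in> sl" and t: "t \<in> sl"
  shows "pr s t \<simeq> lin (\<lambda>r q. pr (lfac r) (rfac r q)) (s ** t)"
proof -
  define n where "n r q = pr (lfac r) (rfac r q)" for r q
  have lin_comp: "lin_on sl (\<lambda>t. lin n (A ** t))" "lin_on sl (\<lambda>t. lin n (t ** A))" for A
    by (intro lin_on_comp[OF lin_on_lin[of UNIV]]; simp add: matrix_ring_simps)+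
  have z: "pr (munit i j) t \<simeq> 0" if "i \<noteq> j" "t \<in> sl" "\<And>q. t $ j $ q = 0" for i j t
    using that by (intro pr_base_all[OF c])
  have o: "pr (munit i (oth i)) t \<simeq> lin n (munit i (oth i) ** t)" if "t \<in> sl" for i t
  proof (rule lin_on_eq_sl[where f = "pr (munit i (oth i))"
        and g = "\<lambda>t. lin n (munit i (oth i) ** t)" and o' = i])
    fix p q :: 'n assume pq: "p \<noteq> q"
    show "pr (munit i (oth i)) (munit p q) \<simeq> lin n (munit i (oth i) ** munit p q)"
    proof (cases "p = oth i")
      case True
      then have eq: "(munit p q :: 'f^'n^'n) = rfac i q" using pq by (auto simp: rfac_def)
      have "pr (munit i (oth i)) (munit p q) = n i q"
        unfolding eq n_def lfac_def ..
      moreover have "lin n (munit i (oth i) ** munit p q) = n i q"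
        using True by (simp add: munit_mult)
      ultimately show ?thesis by simp
    next
      case False
      then show ?thesis using z[of i "oth i" "munit p q"] pq oth[of i]
        by (auto simp: munit_mult munit_nth)
    qed
  next
    fix p assume p: "p \<noteq> i"
    show "pr (munit i (oth i)) (munit p p - munit i i)
        \<simeq> lin n (munit i (oth i) ** (munit p p - munit i i))"
    proof (cases "p = oth i")
      case True
      then have eq: "(munit p p - munit i i :: 'f^'n^'n) = rfac i p" by (auto simp: rfac_def)
      have "pr (munit i (oth i)) (munit p p - munit i i) = n i p"
        unfolding eq n_def lfac_def ..
      moreover have "lin n (munit i (oth i) ** (munit p p - munit i i)) = n i p"
        using True oth[of i] by (simp add: munit_mult matrix_ring_simps)
      ultimately show ?thesis by simp
    next
      case False
      then show ?thesis using z[of i "oth i" "munit p p - munit i i"] oth[of i]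
        by (auto simp: munit_mult munit_nth matrix_ring_simps)
    qed
  qed (use that in \<open>auto intro: pr_lin_right lin_comp\<close>)
  have row: "pr (munit i l) t \<simeq> lin n (munit i l ** t)"
    if "t \<in> sl" "\<And>q. t $ oth i $ q = 0" "i \<noteq> l" "l \<noteq> oth i" for i l t
  proof -
    let ?j = "oth i"
    have l: "lie (munit ?j l) (munit i ?j) = (- munit i l :: 'f^'n^'n)"
      using that oth[of i] by (auto simp: lie_munit)
    have "pr (- munit i l) t + pr (munit i ?j) (lie (munit ?j l) t) \<simeq> 0"
      using pr_lie_zero[OF z[of i ?j t], of "munit ?j l"] that oth[of i] by (auto simp: l)
    moreover have "pr (- munit i l) t + pr (munit i ?j) (lie (munit ?j l) t)
        \<simeq> - pr (munit i l) t + lin n (munit i ?j ** lie (munit ?j l) t)"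
      using that by (intro cong_add lin_on_minus[OF pr_lin_left] o) auto
    ultimately have "- pr (munit i l) t + lin n (munit i ?j ** lie (munit ?j l) t) \<simeq> 0"
      by (meson cong_sym cong_trans)
    from cong_add[OF cong_refl[of "pr (munit i l) t"] this]
    have "lin n (munit i ?j ** lie (munit ?j l) t) \<simeq> pr (munit i l) t" by simp
    moreover have "munit i ?j ** lie (munit ?j l) t = munit i l ** t"
      using that by (auto simp: vec_eq_iff lie_def matrix_mult_diff munit_mult_nth)
    ultimately show ?thesis using cong_sym by metis
  qed
  have off: "pr (munit i l) t \<simeq> lin n (munit i l ** t)" if t: "t \<in> sl" and il: "i \<noteq> l" for i l t
  proof (cases "l = oth i")
    case True
    then show ?thesis using o[OF t] by simp
  next
    case l: False
    show ?thesis
    proof (rule lin_on_eq_sl[where f = "pr (munit i l)"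
          and g = "\<lambda>t. lin n (munit i l ** t)" and o' = i])
      fix p q :: 'n assume pq: "p \<noteq> q"
      show "pr (munit i l) (munit p q) \<simeq> lin n (munit i l ** munit p q)"
        using row[of "munit p q" i l] z[of i l "munit p q"] pq il l
        by (cases "p = l") (auto simp: munit_mult munit_nth)
    next
      fix p assume p: "p \<noteq> i"
      show "pr (munit i l) (munit p p - munit i i)
          \<simeq> lin n (munit i l ** (munit p p - munit i i))"
        using row[of "munit p p - munit i i" i l] z[of i l "munit p p - munit i i"] p il l oth[of i]
        by (cases "p = l") (auto simp: munit_mult munit_nth matrix_ring_simps)
    qed (use t in \<open>auto intro: pr_lin_right lin_comp\<close>)
  qed
  have half: "pr (munit i i - munit j j) t \<simeq> lin n ((munit i i - munit j j) ** t)"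
    if ij: "i \<noteq> j" and t: "t \<in> sl" and row: "\<And>q. t $ i $ q = 0" for i j t
  proof -
    have l: "lie (munit i j) (munit j i) = (munit i i - munit j j :: 'f^'n^'n)"
      by (simp add: lie_munit)
    have *: "pr (munit i i - munit j j) t + pr (munit j i) (lie (munit i j) t) \<simeq> 0"
      using pr_lie_zero[OF z[of j i t], of "munit i j"] ij t row by (auto simp: l)
    have "pr (munit j i) (lie (munit i j) t) \<simeq> lin n (munit j i ** lie (munit i j) t)"
      using ij by (intro off) auto
    from cong_diff[OF * this]
    have "pr (munit i i - munit j j) t \<simeq> - lin n (munit j i ** lie (munit i j) t)" by simp
    also have "\<dots> = lin n (- (munit j i ** lie (munit i j) t))" by (simp add: lin_minus)
    also have "- (munit j i ** lie (munit i j) t) = (munit i i - munit j j) ** t"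
      using row ij by (auto simp: vec_eq_iff lie_def matrix_mult_diff munit_mult_nth)
    finally show ?thesis .
  qed
  have half': "pr (munit i i - munit j j) t \<simeq> lin n ((munit i i - munit j j) ** t)"
    if ij: "i \<noteq> j" and t: "t \<in> sl" and row: "\<And>q. t $ j $ q = 0" for i j t
  proof -
    have "pr (- (munit j j - munit i i)) t \<simeq> - pr (munit j j - munit i i) t"
      by (intro lin_on_minus[OF pr_lin_left]) auto
    also have "\<dots> \<simeq> - lin n ((munit j j - munit i i) ** t)"
      using that by (intro cong_minus half) auto
    also have "\<dots> = lin n ((munit i i - munit j j) ** t)"
      by (simp add: matrix_ring_simps lin_diff)
    finally show ?thesis by simp
  qed
  have diag: "pr (munit i i - munit j j) t \<simeq> lin n ((munit i i - munit j j) ** t)"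
    if ij: "i \<noteq> j" and t: "t \<in> sl" for i j t
  proof -
    obtain l where l: "l \<noteq> i" "l \<noteq> j" using ab c by metis
    show ?thesis
    proof (rule lin_on_eq_sl[where f = "pr (munit i i - munit j j)"
          and g = "\<lambda>t. lin n ((munit i i - munit j j) ** t)" and o' = l])
      fix p q :: 'n assume pq: "p \<noteq> q"
      show "pr (munit i i - munit j j) (munit p q)
          \<simeq> lin n ((munit i i - munit j j) ** munit p q)"
      proof (cases "p = i")
        case True
        show ?thesis by (rule half') (use True ij pq in \<open>auto simp: munit_nth\<close>)
      next
        case False
        show ?thesis by (rule half) (use False ij pq in \<open>auto simp: munit_nth\<close>)
      qed
    next
      fix p assume "p \<noteq> l"
      show "pr (munit i i - munit j j) (munit p p - munit l l)
          \<simeq> lin n ((munit i i - munit j j) ** (munit p p - munit l l))"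
      proof (cases "p = i")
        case True
        show ?thesis by (rule half') (use True ij l in \<open>auto simp: munit_nth\<close>)
      next
        case False
        show ?thesis by (rule half) (use False ij l in \<open>auto simp: munit_nth\<close>)
      qed
    qed (use t in \<open>auto intro: pr_lin_right lin_comp\<close>)
  qed
  have "pr s t \<simeq> lin n (s ** t)"
    by (rule lin_on_eq_sl[where f = "\<lambda>s. pr s t"
          and g = "\<lambda>s. lin n (s ** t)" and o' = a])
      (use s t off diag in \<open>auto intro: pr_lin_left lin_comp\<close>)
  moreover have "n = (\<lambda>r q. pr (lfac r) (rfac r q))" by (simp add: n_def fun_eq_iff)
  ultimately show ?thesis by simp
qed

text \<open>
  With two indices, \<open>e\<close> itself is \<open>E\<^sub>a\<^sub>b\<close> and \<open>pr e e \<simeq> 0\<close> is the highest weight vector of the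
  five-dimensional representation of \<open>sl\<close> on the kernel of the multiplication. Applying the
  lowering operator \<open>ad f\<close> four times gives all five relations.
\<close>

lemma pr_factors_two:
  assumes e: "e = munit a b" and UNIV: "UNIV = {a, b}" and s: "s \<in> sl" and t: "t \<in> sl"
  shows "pr s t \<simeq> lin (\<lambda>r q. pr (lfac r) (rfac r q)) (s ** t)"
proof -
  define n where "n r q = pr (lfac r) (rfac r q)" for r q
  have two: "r = a \<or> r = b" for r using UNIV by auto
  have ob: "oth a = b" "oth b = a" using two[of "oth a"] two[of "oth b"] oth[of a] oth[of b] by auto
  define f h :: "'f^'n^'n" where "f = munit b a" and "h = munit b b - munit a a"
  have in_sl: "e \<in> sl" "f \<in> sl" "h \<in> sl" using ab by (simp_all add: e f_def h_def)
  have l: "lie f e = h" "lie f h = mscale (- 2) f" "lie f f = 0"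
    "lie f (mscale x A) = mscale x (lie f A)" for x A
    using ab by (simp_all add: e f_def h_def lie_diff lie_munit lie_mscale)
      (simp add: vec_eq_iff munit_nth)
  have dl: "dd f (pr s t) \<simeq> A + B"
    if "s \<in> sl" "t \<in> sl" "pr (lie f s) t \<simeq> A" "pr s (lie f t) \<simeq> B" for s t A B
    using cong_trans[OF dd_pr[OF that(1,2)] cong_add[OF that(3,4)]] .
  have scale: "pr (mscale x s) t \<simeq> fscale x (pr s t)"
    "pr s (mscale x t) \<simeq> fscale x (pr s t)" if "s \<in> sl" "t \<in> sl" for x s t
    using lin_on_mscale[OF pr_lin_left that(1)] lin_on_mscale[OF pr_lin_right that(2)] by blast+
  have ee: "pr e e \<simeq> 0" using X_X_zero[of \<alpha> \<beta>] by (simp add: e)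
  have r1: "pr h e + pr e h \<simeq> 0"
    using pr_lie_zero[OF ee, of f] in_sl by (simp add: l)
  have d_he: "dd f (pr h e) \<simeq> fscale (- 2) (pr f e) + pr h h"
    by (rule dl) (simp_all add: l scale pr_zero in_sl)
  have d_eh: "dd f (pr e h) \<simeq> pr h h + fscale (- 2) (pr e f)"
    by (rule dl) (simp_all add: l scale pr_zero in_sl)
  have d_hh: "dd f (pr h h) \<simeq> fscale (- 2) (pr f h) + fscale (- 2) (pr h f)"
    by (rule dl) (simp_all add: l scale pr_zero in_sl)
  have d_fe: "dd f (pr f e) \<simeq> 0 + pr f h"
    by (rule dl) (simp_all add: l scale pr_zero in_sl)
  have d_ef: "dd f (pr e f) \<simeq> pr h f + 0"
    by (rule dl) (simp_all add: l scale pr_zero in_sl)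
  have d_fh: "dd f (pr f h) \<simeq> 0 + fscale (- 2) (pr f f)"
    by (rule dl) (simp_all add: l scale pr_zero in_sl)
  have d_hf: "dd f (pr h f) \<simeq> fscale (- 2) (pr f f) + 0"
    by (rule dl) (simp_all add: l scale pr_zero in_sl)
  have "fscale 2 (pr h h - (pr e f + pr f e))
      = (fscale (- 2) (pr f e) + pr h h) + (pr h h + fscale (- 2) (pr e f))"
    by (simp add: fscale_minus fscale_numeral algebra_simps)
  also have "\<dots> \<simeq> dd f (pr h e) + dd f (pr e h)"
    by (intro cong_add cong_sym[OF d_he] cong_sym[OF d_eh])
  also have "\<dots> = dd f (pr h e + pr e h)" by (simp add: dd_add)
  also have "\<dots> \<simeq> 0" by (rule dd_cong_zero[OF r1])
  finally have r2: "pr h h - (pr e f + pr f e) \<simeq> 0"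
    by (rule cong_fscale_cancel) simp
  have "fscale (- 3) (pr f h + pr h f)
      = (fscale (- 2) (pr f h) + fscale (- 2) (pr h f))
        - ((pr h f + 0) + (0 + pr f h))"
    by (simp add: fscale_minus fscale_numeral algebra_simps)
  also have "\<dots> \<simeq> dd f (pr h h) - (dd f (pr e f) + dd f (pr f e))"
    by (intro cong_add cong_diff cong_sym[OF d_hh] cong_sym[OF d_ef] cong_sym[OF d_fe])
  also have "\<dots> = dd f (pr h h - (pr e f + pr f e))" by (simp add: dd_add dd_diff)
  also have "\<dots> \<simeq> 0" by (rule dd_cong_zero[OF r2])
  finally have r3: "pr f h + pr h f \<simeq> 0" by (rule cong_fscale_cancel) simp
  have "fscale (- 4) (pr f f)
      = (0 + fscale (- 2) (pr f f)) + (fscale (- 2) (pr f f) + 0)"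
    by (simp add: fscale_minus fscale_numeral algebra_simps)
  also have "\<dots> \<simeq> dd f (pr f h) + dd f (pr h f)"
    by (intro cong_add cong_sym[OF d_fh] cong_sym[OF d_hf])
  also have "\<dots> = dd f (pr f h + pr h f)" by (simp add: dd_add)
  also have "\<dots> \<simeq> 0" by (rule dd_cong_zero[OF r3])
  finally have ff: "pr f f \<simeq> 0" by (rule cong_fscale_cancel) simp
  have n: "n a a = pr e f" "n a b = pr e h" "n b b = pr f e"
    "n b a = pr f (- h)"
    using ab by (simp_all add: n_def lfac_def rfac_def ob e f_def h_def)
  have nba: "n b a \<simeq> - pr f h"
    unfolding n using in_sl by (intro lin_on_minus[OF pr_lin_right])
  have prods: "e ** e = 0" "e ** f = munit a a" "e ** h = munit a b" "f ** e = munit b b"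
    "f ** f = 0" "f ** h = - munit b a" "h ** e = - munit a b" "h ** f = munit b a"
    "h ** h = munit a a + munit b b"
    using ab by (simp_all add: e f_def h_def matrix_ring_simps munit_mult)
  have hh: "pr h h \<simeq> n a a + n b b"
    using r2 by (simp add: n cong_def)
  have he: "pr h e \<simeq> - n a b"
    using r1 by (simp add: n cong_def)
  have fh: "pr f h \<simeq> - n b a"
    using cong_sym[OF cong_minus[OF nba]] by simp
  have "pr h f \<simeq> - pr f h"
    using r3 by (simp add: cong_def add.commute)
  then have hf: "pr h f \<simeq> n b a" using cong_sym[OF nba] by (rule cong_trans)
  have lin_comp: "lin_on sl (\<lambda>t. lin n (A ** t))" "lin_on sl (\<lambda>t. lin n (t ** A))" for A
    by (intro lin_on_comp[OF lin_on_lin[of UNIV]]; simp add: matrix_ring_simps)+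
  have basis: "pr s t \<simeq> lin n (s ** t)" if "s \<in> {e, f, h}" "t \<in> {e, f, h}" for s t
    using that ee ff hh he fh hf n(1-3)
    by (auto simp: prods lin_add lin_minus)
  have right: "pr s t \<simeq> lin n (s ** t)" if "s \<in> {e, f, h}" for s
  proof (rule lin_on_eq_sl[where f = "pr s" and g = "\<lambda>t. lin n (s ** t)" and o' = a])
    fix i q :: 'n assume "i \<noteq> q"
    then show "pr s (munit i q) \<simeq> lin n (s ** munit i q)"
      using two[of i] two[of q] basis[OF that] by (auto simp: e f_def)
  next
    fix i :: 'n assume "i \<noteq> a"
    then show "pr s (munit i i - munit a a) \<simeq> lin n (s ** (munit i i - munit a a))"
      using two[of i] basis[OF that] by (auto simp: h_def)
  qed (use t in \<open>auto intro: pr_lin_right lin_comp\<close>)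
  have "pr s t \<simeq> lin n (s ** t)"
  proof (rule lin_on_eq_sl[where f = "\<lambda>s. pr s t" and g = "\<lambda>s. lin n (s ** t)" and o' = a])
    fix i q :: 'n assume "i \<noteq> q"
    then show "pr (munit i q) t \<simeq> lin n (munit i q ** t)"
      using two[of i] two[of q] right by (auto simp: e f_def)
  next
    fix i :: 'n assume "i \<noteq> a"
    then show "pr (munit i i - munit a a) t \<simeq> lin n ((munit i i - munit a a) ** t)"
      using two[of i] right by (auto simp: h_def)
  qed (use s in \<open>auto intro: pr_lin_left lin_comp\<close>)
  moreover have "n = (\<lambda>r q. pr (lfac r) (rfac r q))" by (simp add: n_def fun_eq_iff)
  ultimately show ?thesis by simp
qed

lemma pr_factors:
  assumes "s \<in> sl" and "t \<in> sl"
  shows "pr s t \<simeq> lin (\<lambda>r q. pr (lfac r) (rfac r q)) (s ** t)"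
  using e pr_factors_two pr_factors_three assms by blast

end

end


section \<open>Normal forms\<close>

context matrix_relations
begin

text \<open>
  The class of all words with sources \<open>L\<close> and product \<open>m\<close> of targets, written with the help of the
  factorisation of matrix units into trace-zero matrices. For the empty word the product is a
  multiple of the identity, so one diagonal entry determines it.
\<close>

fun nf :: "'l list \<Rightarrow> 'f^'n^'n \<Rightarrow> ('f, 's) falg"
  where
    "nf [] m = fscale (m $ a $ a) 1"
  | "nf [\<alpha>] m = X \<alpha> m"
  | "nf (\<alpha> # \<beta> # L) m = lin (\<lambda>r q. X \<alpha> (lfac r) * nf (\<beta> # L) (rfac r q)) m"

lemma nf_eta [simp]:
  "nf [\<alpha>] = X \<alpha>"
  "nf (\<alpha> # \<beta> # L) = lin (\<lambda>r q. X \<alpha> (lfac r) * nf (\<beta> # L) (rfac r q))"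
  by (rule ext, simp)+

text \<open>
  The span of the products of targets of the words with sources \<open>L\<close>.
\<close>

fun nf_coeffs :: "'l list \<Rightarrow> ('f^'n^'n) set"
  where
    "nf_coeffs [] = range (\<lambda>c. mscale c (mat 1))"
  | "nf_coeffs [\<alpha>] = sl"
  | "nf_coeffs (\<alpha> # \<beta> # L) = UNIV"

lemma sl_dom: "s \<in> sl \<Longrightarrow> s \<in> nf_coeffs (\<alpha> # L)"
  by (cases L) auto

lemma dom_length: "length L = length L' \<Longrightarrow> nf_coeffs L = nf_coeffs L'"
  by (induction L L' rule: list_induct2) (auto, (metis nf_coeffs.simps length_0_conv neq_Nil_conv length_Suc_conv)+)

lemma dom_mult: "m \<in> nf_coeffs L \<Longrightarrow> m' \<in> nf_coeffs L' \<Longrightarrow> m ** m' \<in> nf_coeffs (L @ L')"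
proof (cases L rule: nf_coeffs.cases)
  case 1
  assume "m \<in> nf_coeffs L" "m' \<in> nf_coeffs L'"
  moreover from this 1 obtain c where "m = mscale c (mat 1)" by auto
  ultimately show ?thesis using 1
    by (cases L' rule: nf_coeffs.cases) (auto simp: mscale_simps)
next
  case (2 \<alpha>)
  assume "m \<in> nf_coeffs L" "m' \<in> nf_coeffs L'"
  then show ?thesis using 2
    by (cases L') (auto simp: mscale_simps)
qed auto

lemma nf_lin: "lin_on (nf_coeffs L) (nf L)"
proof (cases L rule: nf_coeffs.cases)
  case 1
  then show ?thesis by (auto simp: lin_on_def fscale_add_left fscale_fscale)
next
  case (3 \<alpha> \<beta> L')
  then show ?thesis using 3 by (simp add: lin_on_lin)
qed (simp add: X_lin)

text \<open>
  Two letters are the case treated in \<open>pr_factors\<close>. For longer words, the induction hypothesis and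
  \<open>pr_factors\<close> are the two partial factorisations required in \<open>associative_factors\<close>.
\<close>

lemma X_nf: "s \<in> sl \<Longrightarrow> m \<in> nf_coeffs L \<Longrightarrow> X \<alpha> s * nf L m \<simeq> nf (\<alpha> # L) (s ** m)"
proof (induction L arbitrary: \<alpha> s m)
  case Nil
  then obtain c where m: "m = mscale c (mat 1)" by auto
  have "nf [] m = fscale c 1" by (simp add: m mat_def)
  then have "X \<alpha> s * nf [] m = fscale c (X \<alpha> s)" by (simp flip: fscale_mult_right)
  also have "\<dots> \<simeq> X \<alpha> (mscale c s)"
    using Nil by (intro cong_sym[OF lin_on_mscale[OF X_lin]])
  finally show ?case by (simp add: m mscale_simps)
next
  case (Cons \<beta> L)
  show ?case
  proof (cases L)
    case Nil
    then show ?thesis using pr_factors[of s m \<alpha> \<beta>] Cons.prems by simp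
  next
    case L: (Cons \<gamma> L')
    have "X \<alpha> s * nf (\<beta> # L) m
        \<simeq> lin (\<lambda>r q. X \<alpha> (lfac r) * nf (\<beta> # L) (rfac r q)) (s ** m)"
    proof (rule associative_factors[where Q = "\<lambda>s m. X \<alpha> s * nf (\<beta> # L) m"
          and P = "\<lambda>m t. nf [\<alpha>, \<beta>] m * nf L t"])
      show "lin_on UNIV (\<lambda>m. X \<alpha> s * nf (\<beta> # L) m)" for s
        using nf_lin[of "\<beta> # L"] L by (intro lin_on_mult_left) simp
      show "lin_on UNIV (\<lambda>m. nf [\<alpha>, \<beta>] m * nf L t)" for t
        using nf_lin[of "[\<alpha>, \<beta>]"] by (intro lin_on_mult_right) simp
      fix s s' t :: "'f^'n^'n" assume sl: "s \<in> sl" "s' \<in> sl" "t \<in> sl"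
      have "X \<alpha> s * nf (\<beta> # L) (s' ** t) \<simeq> X \<alpha> s * (X \<beta> s' * nf L t)"
        using sl L by (intro cong_mult cong_refl cong_sym[OF Cons.IH]) (simp_all add: sl_dom)
      also have "\<dots> = (X \<alpha> s * X \<beta> s') * nf L t" by (simp add: mult.assoc)
      also have "\<dots> \<simeq> nf [\<alpha>, \<beta>] (s ** s') * nf L t"
        using pr_factors[of s s' \<alpha> \<beta>] sl by (intro cong_mult cong_refl) simp
      finally show "X \<alpha> s * nf (\<beta> # L) (s' ** t) \<simeq> nf [\<alpha>, \<beta>] (s ** s') * nf L t" .
    qed (use Cons.prems in auto)
    then show ?thesis using L by simp
  qed
qed

lemma nf_Cons_mult:
  assumes "L \<noteq> []"
  shows "nf (\<alpha> # L) (munit r q) = X \<alpha> (lfac r) * nf L (rfac r q)"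
  using assms by (cases L) auto

lemma nf_append: "m \<in> nf_coeffs L \<Longrightarrow> m' \<in> nf_coeffs L' \<Longrightarrow> nf L m * nf L' m' \<simeq> nf (L @ L') (m ** m')"
proof (induction L arbitrary: m)
  case Nil
  then obtain c where m: "m = mscale c (mat 1)" by auto
  have "nf [] m = fscale c 1" by (simp add: m mat_def)
  then have "nf [] m * nf L' m' = fscale c (nf L' m')" by (simp flip: fscale_mult_left)
  also have "\<dots> \<simeq> nf L' (mscale c m')"
    using Nil by (intro cong_sym[OF lin_on_mscale[OF nf_lin]])
  finally show ?case by (simp add: m mscale_simps)
next
  case (Cons \<alpha> L)
  show ?case
  proof (cases L)
    case Nil
    then show ?thesis using X_nf[of m m' L' \<alpha>] Cons.prems by simp
  next
    case L: (Cons \<beta> L1)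
    show ?thesis
    proof (rule lin_on_eq_UNIV[where f = "\<lambda>m. nf (\<alpha> # L) m * nf L' m'"])
      show "lin_on UNIV (\<lambda>m. nf (\<alpha> # L) m * nf L' m')"
        using nf_lin[of "\<alpha> # L"] L by (intro lin_on_mult_right) simp
      show "lin_on UNIV (\<lambda>m. nf ((\<alpha> # L) @ L') (m ** m'))"
        by (rule lin_on_comp[where D = UNIV and f = "nf ((\<alpha> # L) @ L')" and l = "\<lambda>m. m ** m'"])
          (use nf_lin[of "(\<alpha> # L) @ L'"] L in
            \<open>simp_all add: matrix_ring_simps del: nf.simps nf_eta\<close>)
      fix r q
      have dm: "rfac r q ** m' \<in> nf_coeffs (L @ L')"
        using L Cons.prems by (intro dom_mult) (simp_all add: sl_dom)
      have "nf (\<alpha> # L) (munit r q) * nf L' m' = X \<alpha> (lfac r) * (nf L (rfac r q) * nf L' m')"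
        using nf_Cons_mult[of L \<alpha> r q] L by (simp only: mult.assoc list.distinct(2) simp_thms)
      also have "\<dots> \<simeq> X \<alpha> (lfac r) * nf (L @ L') (rfac r q ** m')"
        using L Cons.prems by (intro cong_mult cong_refl Cons.IH) (simp_all add: sl_dom)
      also have "\<dots> \<simeq> nf (\<alpha> # L @ L') (lfac r ** (rfac r q ** m'))"
        using dm by (intro X_nf) auto
      finally show "nf (\<alpha> # L) (munit r q) * nf L' m' \<simeq> nf ((\<alpha> # L) @ L') (munit r q ** m')"
        by (simp add: matrix_mul_assoc)
    qed
  qed
qed

text \<open>
  Both sides commute with all derivations, and they agree at \<open>E\<^sub>a\<^sub>a\<close>, which generates the matrices
  under brackets.
\<close>

lemma nf_two_swap: "nf [\<alpha>, \<beta>] m \<simeq> nf [\<beta>, \<alpha>] m"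
proof -
  have dd_nf: "dd c (nf [\<alpha>, \<beta>] m) \<simeq> nf [\<alpha>, \<beta>] (lie c m)" for c m \<alpha> \<beta>
  proof (rule lin_on_eq_UNIV[where f = "\<lambda>m. dd c (nf [\<alpha>, \<beta>] m)"])
    show "lin_on UNIV (\<lambda>m. dd c (nf [\<alpha>, \<beta>] m))"
      by (simp add: lin_on_def lin_add lin_mscale dd_add dd_fscale)
    show "lin_on UNIV (\<lambda>m. nf [\<alpha>, \<beta>] (lie c m))"
      by (simp add: lin_on_def lin_add lin_mscale lie_add lie_mscale)
    fix r q :: 'n
    let ?s = "lfac r" and ?t = "rfac r q"
    have "dd c (nf [\<alpha>, \<beta>] (munit r q)) \<simeq> X \<alpha> (lie c ?s) * X \<beta> ?t + X \<alpha> ?s * X \<beta> (lie c ?t)"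
      by (simp add: dd_pr)
    also have "\<dots> \<simeq> nf [\<alpha>, \<beta>] (lie c ?s ** ?t) + nf [\<alpha>, \<beta>] (?s ** lie c ?t)"
      using pr_factors by (intro cong_add) auto
    also have "\<dots> = nf [\<alpha>, \<beta>] (lie c (?s ** ?t))" by (simp add: lie_mult lin_add del: lfac_rfac)
    finally show "dd c (nf [\<alpha>, \<beta>] (munit r q)) \<simeq> nf [\<alpha>, \<beta>] (lie c (munit r q))" by simp
  qed
  have eq: "X \<alpha> s * X \<beta> t \<simeq> nf [\<alpha>, \<beta>] (s ** t)" if "s \<in> sl" "t \<in> sl" for s t \<alpha> \<beta>
    using pr_factors[OF that] by simp
  have base: "nf [\<alpha>, \<beta>] (munit a a) \<simeq> nf [\<beta>, \<alpha>] (munit a a)"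
  proof -
    have "nf [\<alpha>, \<beta>] (munit a b ** munit b a) \<simeq> X \<alpha> (munit a b) * X \<beta> (munit b a)"
      using ab by (intro cong_sym[OF eq]) auto
    also have "\<dots> \<simeq> X \<beta> (munit a b) * X \<alpha> (munit b a)" by (rule X_X_swap)
    also have "\<dots> \<simeq> nf [\<beta>, \<alpha>] (munit a b ** munit b a)"
      using ab by (intro eq) auto
    finally show ?thesis by (simp add: munit_mult del: nf.simps)
  qed
  show ?thesis
  proof (rule lie_closed_UNIV[where P = "\<lambda>m. nf [\<alpha>, \<beta>] m \<simeq> nf [\<beta>, \<alpha>] m", OF _ _ _ ab base])
    fix c m assume "nf [\<alpha>, \<beta>] m \<simeq> nf [\<beta>, \<alpha>] m"
    from dd_cong[OF this]
    show "nf [\<alpha>, \<beta>] (lie c m) \<simeq> nf [\<beta>, \<alpha>] (lie c m)"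
      by (rule cong_trans[OF cong_sym[OF dd_nf] cong_trans[OF _ dd_nf]])
  qed (simp_all add: lin_add lin_mscale cong_add cong_fscale)
qed

text \<open>
  In \<open>E\<^sub>r\<^sub>q = E\<^sub>r\<^sub>r t\<close> with \<open>t\<close> of trace zero, the factor \<open>E\<^sub>r\<^sub>r\<close> comes from the first two letters and
  \<open>t\<close> from the others.
\<close>

lemma nf_swap: "nf (\<alpha> # \<beta> # L) m \<simeq> nf (\<beta> # \<alpha> # L) m"
proof (cases L)
  case Nil
  then show ?thesis using nf_two_swap by simp
next
  case (Cons \<gamma> L')
  have *: "nf (\<alpha> # \<beta> # L) (munit r q) \<simeq> nf [\<alpha>, \<beta>] (munit r r) * nf L t"
    if t: "t \<in> sl" "munit r r ** t = munit r q" for \<alpha> \<beta> r q t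
  proof -
    have "nf [\<alpha>, \<beta>] (munit r r) * nf L t \<simeq> nf ([\<alpha>, \<beta>] @ L) (munit r r ** t)"
      using t Cons by (intro nf_append) (auto simp: sl_dom)
    then show ?thesis using t by (simp add: cong_sym)
  qed
  show ?thesis
  proof (rule lin_on_eq_UNIV[where f = "nf (\<alpha> # \<beta> # L)"])
    fix r q :: 'n
    let ?t = "if q = r then munit r r - munit (oth r) (oth r) else munit r q :: 'f^'n^'n"
    have t: "?t \<in> sl" "munit r r ** ?t = munit r q"
      using oth[of r] by (auto simp: matrix_ring_simps munit_mult)
    have "nf (\<alpha> # \<beta> # L) (munit r q) \<simeq> nf [\<alpha>, \<beta>] (munit r r) * nf L ?t" by (rule *[OF t])
    also have "\<dots> \<simeq> nf [\<beta>, \<alpha>] (munit r r) * nf L ?t"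
      by (intro cong_mult cong_refl nf_two_swap)
    also have "\<dots> \<simeq> nf (\<beta> # \<alpha> # L) (munit r q)" by (rule cong_sym[OF *[OF t]])
    finally show "nf (\<alpha> # \<beta> # L) (munit r q) \<simeq> nf (\<beta> # \<alpha> # L) (munit r q)" .
  qed (use nf_lin[of "\<alpha> # \<beta> # L"] nf_lin[of "\<beta> # \<alpha> # L"] in simp_all)
qed

lemma nf_Cons_cong:
  assumes L: "\<And>m. m \<in> nf_coeffs L \<Longrightarrow> nf L m \<simeq> nf L' m" and len: "length L = length L'"
  shows "nf (\<alpha> # L) m \<simeq> nf (\<alpha> # L') m"
proof (cases L)
  case Nil
  then show ?thesis using len by simp
next
  case (Cons \<beta> L1)
  then obtain \<gamma> L2 where L': "L' = \<gamma> # L2" using len by (cases L') auto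
  have "nf L (rfac r q) \<simeq> nf L' (rfac r q)" for r q
    using Cons by (intro L) (simp add: sl_dom)
  then show ?thesis unfolding Cons L' by (auto intro!: cong_lin cong_mult)
qed

lemma nf_front:
  "m \<in> nf_coeffs (ys @ \<alpha> # zs) \<Longrightarrow> nf (ys @ \<alpha> # zs) m \<simeq> nf (\<alpha> # ys @ zs) m"
proof (induction ys arbitrary: m)
  case (Cons \<beta> ys)
  have "nf (\<beta> # ys @ \<alpha> # zs) m \<simeq> nf (\<beta> # \<alpha> # ys @ zs) m"
    by (rule nf_Cons_cong) (auto intro: Cons.IH)
  also have "\<dots> \<simeq> nf (\<alpha> # \<beta> # ys @ zs) m" by (rule nf_swap)
  finally show ?case by simp
qed simp

lemma nf_perm: "mset L = mset L' \<Longrightarrow> m \<in> nf_coeffs L \<Longrightarrow> nf L m \<simeq> nf L' m"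
proof (induction L arbitrary: L' m)
  case (Cons \<alpha> L)
  then have "\<alpha> \<in> set L'" by (metis list.set_intros(1) set_mset_mset)
  then obtain ys zs where L': "L' = ys @ \<alpha> # zs" by (meson split_list)
  then have eq: "mset L = mset (ys @ zs)" using Cons.prems(1) by simp
  have len: "length L = length (ys @ zs)" using mset_eq_length[OF eq] .
  have "nf (\<alpha> # L) m \<simeq> nf (\<alpha> # ys @ zs) m"
    using Cons.IH[OF eq] len by (intro nf_Cons_cong)
  also have "\<dots> \<simeq> nf L' m"
    unfolding L' using Cons.prems(2) len
    by (intro cong_sym[OF nf_front]) (simp add: dom_length[of "ys @ \<alpha> # zs" "\<alpha> # L"])
  finally show ?case .
qed simp

definition zp :: "'z list \<Rightarrow> ('f, 's) falg"
  where "zp zs = prod_list (map Z zs)"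

lemma Z_zp: "Z i * zp zs \<simeq> zp zs * Z i"
proof (induction zs)
  case (Cons j zs)
  have "Z i * zp (j # zs) = (Z i * Z j) * zp zs" by (simp add: zp_def mult.assoc)
  also have "\<dots> \<simeq> (Z j * Z i) * zp zs" by (intro cong_mult Z_Z cong_refl)
  also have "\<dots> = Z j * (Z i * zp zs)" by (simp add: mult.assoc)
  also have "\<dots> \<simeq> Z j * (zp zs * Z i)" by (intro cong_mult Cons cong_refl)
  finally show ?case by (simp add: zp_def mult.assoc)
qed (simp add: zp_def)

lemma zp_perm: "mset zs = mset zs' \<Longrightarrow> zp zs \<simeq> zp zs'"
proof (induction zs arbitrary: zs')
  case (Cons i zs)
  then have "i \<in> set zs'" by (metis list.set_intros(1) set_mset_mset)
  then obtain ys xs where zs': "zs' = ys @ i # xs" by (meson split_list)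
  have "zp (i # zs) = Z i * zp zs" by (simp add: zp_def)
  also have "\<dots> \<simeq> Z i * zp (ys @ xs)"
    using Cons.prems by (intro cong_mult cong_refl Cons.IH) (simp add: zs')
  also have "\<dots> = (Z i * zp ys) * zp xs" by (simp add: zp_def mult.assoc)
  also have "\<dots> \<simeq> (zp ys * Z i) * zp xs" by (intro cong_mult Z_zp cong_refl)
  finally show ?case by (simp add: zs' zp_def mult.assoc)
qed (simp add: zp_def)

lemma Z_X_sl:
  assumes s: "s \<in> sl"
  shows "Z i * X \<alpha> s \<simeq> X \<alpha> s * Z i"
proof -
  let ?P = "\<lambda>s. s \<in> sl \<and> Z i * X \<alpha> s \<simeq> X \<alpha> s * Z i"
  have l: "lin_on sl (\<lambda>s. Z i * X \<alpha> s)" and r: "lin_on sl (\<lambda>s. X \<alpha> s * Z i)"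
    by (intro lin_on_mult_left lin_on_mult_right X_lin)+
  have "?P s"
  proof (rule lie_closed_sl[where P = ?P, OF _ _ _ ab])
    fix s t assume st: "?P s" "?P t"
    have "Z i * X \<alpha> (s + t) \<simeq> Z i * X \<alpha> s + Z i * X \<alpha> t" using st by (intro lin_on_add[OF l]) auto
    also have "\<dots> \<simeq> X \<alpha> s * Z i + X \<alpha> t * Z i" using st by (intro cong_add) auto
    also have "\<dots> \<simeq> X \<alpha> (s + t) * Z i" using st by (intro cong_sym[OF lin_on_add[OF r]]) auto
    finally show "?P (s + t)" using st by simp
  next
    fix c s assume st: "?P s"
    have "Z i * X \<alpha> (mscale c s) \<simeq> fscale c (Z i * X \<alpha> s)"
      using st by (intro lin_on_mscale[OF l]) auto
    also have "\<dots> \<simeq> fscale c (X \<alpha> s * Z i)" using st by (intro cong_fscale) auto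
    also have "\<dots> \<simeq> X \<alpha> (mscale c s) * Z i"
      using st by (intro cong_sym[OF lin_on_mscale[OF r]]) auto
    finally show "?P (mscale c s)" using st by simp
  next
    fix c s assume st: "?P s"
    have "Z i * X \<alpha> (lie c s) = 0 * X \<alpha> s + Z i * X \<alpha> (lie c s)" by simp
    also have "\<dots> \<simeq> dd c (Z i) * X \<alpha> s + Z i * dd c (X \<alpha> s)"
      using st by (intro cong_add cong_mult cong_refl cong_sym[OF dd_X] cong_sym[OF dd_Z]) auto
    also have "\<dots> = dd c (Z i * X \<alpha> s)" by (simp add: dd_mult)
    also have "\<dots> \<simeq> dd c (X \<alpha> s * Z i)" using st by (intro dd_cong) auto
    also have "\<dots> = dd c (X \<alpha> s) * Z i + X \<alpha> s * dd c (Z i)" by (simp add: dd_mult)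
    also have "\<dots> \<simeq> X \<alpha> (lie c s) * Z i + X \<alpha> s * 0"
      using st by (intro cong_add cong_mult cong_refl dd_X dd_Z) auto
    finally show "?P (lie c s)" by simp
  qed (use ab Z_X s in \<open>auto simp: sl_def trace_simps\<close>)
  then show ?thesis by simp
qed

lemma Z_nf: "m \<in> nf_coeffs L \<Longrightarrow> Z i * nf L m \<simeq> nf L m * Z i"
proof (induction L arbitrary: m)
  case Nil
  have "Z i * nf [] m = nf [] m * Z i"
    by (simp flip: fscale_mult_left fscale_mult_right)
  then show ?case by (simp only: cong_refl)
next
  case (Cons \<alpha> L)
  show ?case
  proof (cases L)
    case Nil
    then show ?thesis using Cons.prems Z_X_sl by simp
  next
    case L: (Cons \<beta> L1)
    show ?thesis
    proof (rule lin_on_eq_UNIV[where f = "\<lambda>m. Z i * nf (\<alpha> # L) m"])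
      show "lin_on UNIV (\<lambda>m. Z i * nf (\<alpha> # L) m)" "lin_on UNIV (\<lambda>m. nf (\<alpha> # L) m * Z i)"
        using nf_lin[of "\<alpha> # L"] L by (auto intro: lin_on_mult_left lin_on_mult_right)
      fix r q
      have eq: "nf (\<alpha> # L) (munit r q) = X \<alpha> (lfac r) * nf L (rfac r q)"
        using L by (intro nf_Cons_mult) simp
      have "Z i * nf (\<alpha> # L) (munit r q) = (Z i * X \<alpha> (lfac r)) * nf L (rfac r q)"
        unfolding eq by (simp add: mult.assoc)
      also have "\<dots> \<simeq> (X \<alpha> (lfac r) * Z i) * nf L (rfac r q)"
        by (intro cong_mult Z_X_sl cong_refl) simp
      also have "\<dots> = X \<alpha> (lfac r) * (Z i * nf L (rfac r q))" by (simp add: mult.assoc)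
      also have "\<dots> \<simeq> X \<alpha> (lfac r) * (nf L (rfac r q) * Z i)"
        using L by (intro cong_mult Cons.IH cong_refl) (simp add: sl_dom)
      finally show "Z i * nf (\<alpha> # L) (munit r q) \<simeq> nf (\<alpha> # L) (munit r q) * Z i"
        unfolding eq by (simp add: mult.assoc)
    qed
  qed
qed

lemma zp_nf: "m \<in> nf_coeffs L \<Longrightarrow> zp zs * nf L m \<simeq> nf L m * zp zs"
proof (induction zs)
  case (Cons i zs)
  have "zp (i # zs) * nf L m = Z i * (zp zs * nf L m)" by (simp add: zp_def mult.assoc)
  also have "\<dots> \<simeq> Z i * (nf L m * zp zs)" using Cons by (intro cong_mult[OF cong_refl])
  also have "\<dots> = (Z i * nf L m) * zp zs" by (simp add: mult.assoc)
  also have "\<dots> \<simeq> (nf L m * Z i) * zp zs" using Cons.prems by (intro cong_mult cong_refl Z_nf)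
  finally show ?case by (simp add: zp_def mult.assoc)
qed (simp add: zp_def)

lemma nf_zp_mult:
  assumes "m \<in> nf_coeffs L" and "m' \<in> nf_coeffs L'"
  shows "(nf L m * zp zs) * (nf L' m' * zp zs') \<simeq> nf (L @ L') (m ** m') * zp (zs @ zs')"
proof -
  have "(nf L m * zp zs) * (nf L' m' * zp zs') = nf L m * (zp zs * nf L' m') * zp zs'"
    by (simp add: mult.assoc)
  also have "\<dots> \<simeq> nf L m * (nf L' m' * zp zs) * zp zs'"
    using assms by (intro cong_mult cong_refl zp_nf)
  also have "\<dots> = (nf L m * nf L' m') * zp (zs @ zs')"
    by (simp add: zp_def mult.assoc)
  also have "\<dots> \<simeq> nf (L @ L') (m ** m') * zp (zs @ zs')"
    using assms by (intro cong_mult cong_refl nf_append)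
  finally show ?thesis .
qed

lemma nf_zp_perm:
  assumes "mset L = mset L'" and "mset zs = mset zs'" and "m \<in> nf_coeffs L"
  shows "nf L m * zp zs \<simeq> nf L' m * zp zs'"
  using assms by (intro cong_mult nf_perm zp_perm)

end


section \<open>The operator algebra U\<close>

lemma ad_derivation: "is_matrix_derivation (lie c)"
  by (auto simp: is_matrix_derivation_def mlinear_iff lie_add lie_mscale lie_mult)

definition ad :: "'f::field^'n::finite^'n \<Rightarrow> ('f, 'n) der"
  where "ad c = Abs_der (lie c)"

lemma Rep_ad [simp]: "Rep_der (ad c) = lie c"
  unfolding ad_def by (rule Abs_der_inverse) (simp add: ad_derivation)

abbreviation ops :: "('f::field^'n::finite^'n \<Rightarrow> 'f^'n^'n) set"
  where "ops \<equiv> range env_act"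

lemma ops_add: "u \<in> ops \<Longrightarrow> v \<in> ops \<Longrightarrow> (\<lambda>A. u A + v A) \<in> ops"
proof -
  assume "u \<in> ops" "v \<in> ops"
  then obtain x y where "u = env_act x" "v = env_act y" by blast
  then have "(\<lambda>A. u A + v A) = env_act (x + y)" by (simp add: env_act_hom fun_eq_iff)
  then show ?thesis by blast
qed

lemma ops_mscale: "u \<in> ops \<Longrightarrow> (\<lambda>A. mscale c (u A)) \<in> ops"
proof -
  assume "u \<in> ops"
  then obtain x where "u = env_act x" by blast
  then have "(\<lambda>A. mscale c (u A)) = env_act (env_scale c x)" by (simp add: env_act_hom fun_eq_iff)
  then show ?thesis by blast
qed

lemma ops_comp: "u \<in> ops \<Longrightarrow> v \<in> ops \<Longrightarrow> (\<lambda>A. u (v A)) \<in> ops"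
proof -
  assume "u \<in> ops" "v \<in> ops"
  then obtain x y where "u = env_act x" "v = env_act y" by blast
  then have "(\<lambda>A. u (v A)) = env_act (x * y)" by (simp add: env_act_hom fun_eq_iff)
  then show ?thesis by blast
qed

lemma ops_id: "(\<lambda>A. A) \<in> ops"
proof -
  have "(\<lambda>A. A) = env_act 1" by (simp add: env_act_hom fun_eq_iff)
  then show ?thesis by blast
qed

lemma ops_der: "Rep_der d \<in> ops"
proof -
  have "Rep_der d = env_act (env_incl d)" by (simp add: env_act_hom fun_eq_iff)
  then show ?thesis by blast
qed

lemma ops_lie: "lie c \<in> ops"
  using ops_der[of "ad c"] by simp

lemma ops_zero: "(\<lambda>A. 0) \<in> ops"
  using ops_mscale[OF ops_id, of 0] by (simp add: mscale_simps)

lemma ops_sum: "(\<And>i. i \<in> I \<Longrightarrow> u i \<in> ops) \<Longrightarrow> (\<lambda>A. \<Sum>i\<in>I. u i A) \<in> ops"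
  by (induction I rule: infinite_finite_induct) (auto intro: ops_add ops_zero)

text \<open>
  The seed is \<open>(ad E)\<^sup>2 A = -2 E A E\<close> for \<open>E = E\<^sub>p\<^sub>q\<close>, which is a multiple of \<open>tr(E A) E\<close>. Composing an
  operator \<open>A \<mapsto> tr(w A) v\<close> with a derivation from the left takes the bracket of \<open>v\<close>, and composing
  from the right takes the bracket of \<open>w\<close> up to sign, so simplicity of \<open>sl\<close> gives all \<open>v\<close> and \<open>w\<close>.
\<close>

lemma ops_rank_one:
  fixes v w :: "'f::field_char_0^'n::finite^'n"
  assumes v: "v \<in> sl" and w: "w \<in> sl"
  shows "(\<lambda>A. mscale (trace (w ** A)) v) \<in> ops"
proof (cases "\<exists>p q :: 'n. p \<noteq> q")
  case True
  then obtain p q :: 'n where pq: "p \<noteq> q" by blast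
  let ?E = "munit p q :: 'f^'n^'n"
  have E2: "?E ** ?E = 0" "?E ** A ** ?E = mscale (A $ q $ p) ?E"
    "trace (?E ** A) = A $ q $ p" for A
    using pq by (auto simp: munit_mult vec_eq_iff munit_mult_nth munit_nth trace_def)
  have "lie ?E (lie ?E A) = mscale (- 2) (mscale (A $ q $ p) ?E)" for A
  proof -
    have "lie ?E (lie ?E A) = (?E ** ?E) ** A + A ** (?E ** ?E) - (?E ** A ** ?E + ?E ** A ** ?E)"
      by (simp add: lie_def matrix_ring_simps matrix_mul_assoc)
    then show ?thesis by (simp add: E2) (simp add: vec_eq_iff matrix_matrix_mult_def)
  qed
  then have "(\<lambda>A. mscale (- 2) (mscale (A $ q $ p) ?E)) \<in> ops"
    using ops_comp[OF ops_lie[of ?E] ops_lie[of ?E]] by simp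
  then have "(\<lambda>A. mscale (- 1 / 2) (mscale (- 2) (mscale (A $ q $ p) ?E))) \<in> ops"
    by (rule ops_mscale)
  then have base: "(\<lambda>A. mscale (trace (?E ** A)) ?E) \<in> ops"
    by (simp add: mscale_simps E2)
  have tr: "trace v = 0" "trace w = 0" using v w by (simp_all add: sl_def)
  have left: "(\<lambda>A. mscale (trace (?E ** A)) v) \<in> ops"
  proof (rule lie_closed_sl[where P = "\<lambda>v. (\<lambda>A. mscale (trace (?E ** A)) v) \<in> ops", OF _ _ _ pq base tr(1)])
    fix s t assume "(\<lambda>A. mscale (trace (?E ** A)) s) \<in> ops" "(\<lambda>A. mscale (trace (?E ** A)) t) \<in> ops"
    from ops_add[OF this] show "(\<lambda>A. mscale (trace (?E ** A)) (s + t)) \<in> ops"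
      by (simp add: mscale_simps)
  next
    fix c s assume "(\<lambda>A. mscale (trace (?E ** A)) s) \<in> ops"
    from ops_mscale[OF this, of c] show "(\<lambda>A. mscale (trace (?E ** A)) (mscale c s)) \<in> ops"
      by (simp add: mscale_simps mult.commute)
  next
    fix c s assume "(\<lambda>A. mscale (trace (?E ** A)) s) \<in> ops"
    from ops_comp[OF ops_lie[of c] this] show "(\<lambda>A. mscale (trace (?E ** A)) (lie c s)) \<in> ops"
      by (simp add: lie_mscale)
  qed
  show ?thesis
  proof (rule lie_closed_sl[where P = "\<lambda>w. (\<lambda>A. mscale (trace (w ** A)) v) \<in> ops", OF _ _ _ pq left tr(2)])
    fix s t assume "(\<lambda>A. mscale (trace (s ** A)) v) \<in> ops" "(\<lambda>A. mscale (trace (t ** A)) v) \<in> ops"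
    from ops_add[OF this] show "(\<lambda>A. mscale (trace ((s + t) ** A)) v) \<in> ops"
      by (simp add: matrix_ring_simps trace_simps)
  next
    fix c s assume "(\<lambda>A. mscale (trace (s ** A)) v) \<in> ops"
    from ops_mscale[OF this, of c] show "(\<lambda>A. mscale (trace (mscale c s ** A)) v) \<in> ops"
      by (simp add: mscale_simps trace_simps)
  next
    fix c s assume *: "(\<lambda>A. mscale (trace (s ** A)) v) \<in> ops"
    have "trace (lie c s ** A) = - trace (s ** lie c A)" for A
    proof -
      have "trace (lie c s ** A) + trace (s ** lie c A) = trace (lie c (s ** A))"
        by (simp add: lie_mult trace_simps)
      then show ?thesis by (simp add: trace_lie eq_neg_iff_add_eq_0)
    qed
    then show "(\<lambda>A. mscale (trace (lie c s ** A)) v) \<in> ops"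
      using ops_mscale[OF ops_comp[OF * ops_lie[of c]], of "- 1"] by (simp add: mscale_simps)
  qed
next
  case False
  then have U: "(UNIV :: 'n set) = {p}" for p by auto
  have "trace w = w $ p $ p" for p unfolding trace_def by (subst U[of p]) simp
  then have "w = 0" using w False by (auto simp: sl_def vec_eq_iff) metis
  then show ?thesis using ops_zero by (simp add: matrix_matrix_mult_def trace_def mscale_simps)
qed

definition functional :: "('f::field^'n::finite^'n \<Rightarrow> 'f) \<Rightarrow> bool"
  where "functional \<xi> \<longleftrightarrow>
    (\<forall>A B. \<xi> (A + B) = \<xi> A + \<xi> B) \<and> (\<forall>c A. \<xi> (mscale c A) = c * \<xi> A)"

lemma functional_sum:
  assumes "functional \<xi>"
  shows "\<xi> (sum f I) = (\<Sum>i\<in>I. \<xi> (f i))"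
proof -
  have "\<xi> 0 = 0" using assms[unfolded functional_def] by (metis mscale_simps(4) mult_zero_left)
  then show ?thesis
    using assms by (induction I rule: infinite_finite_induct) (simp_all add: functional_def)
qed

text \<open>
  A functional has the form \<open>A \<mapsto> tr (w A)\<close>, and its value at the identity is \<open>tr w\<close>.
\<close>

lemma ops_functional:
  fixes v :: "'f::field_char_0^'n::finite^'n"
  assumes \<xi>: "functional \<xi>" "\<xi> (mat 1) = 0" and v: "v \<in> sl"
  shows "(\<lambda>A. mscale (\<xi> A) v) \<in> ops"
proof -
  define w :: "'f^'n^'n" where "w = (\<chi> i j. \<xi> (munit j i))"
  have w: "trace (w ** A) = \<xi> A" for A
  proof (induction A rule: matrix_induct)
    case zero
    show ?case using functional_sum[OF \<xi>(1), of "\<lambda>x. x" "{}"]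
      by (simp add: matrix_matrix_mult_def trace_def)
  next
    case (unit p q)
    have "trace (w ** munit p q) = (\<Sum>i\<in>UNIV. if i = q then \<xi> (munit p q) else 0)"
      unfolding trace_def by (intro sum.cong refl) (auto simp: munit_mult_nth w_def)
    then show ?case by simp
  qed (use \<xi> in \<open>auto simp: functional_def matrix_ring_simps trace_simps\<close>)
  have "trace w = trace (w ** mat 1)" by simp
  then have "w \<in> sl" using w[of "mat 1"] \<xi> by (simp add: sl_def)
  from ops_rank_one[OF v this] show ?thesis by (simp add: w)
qed

subsection \<open>Coordinates\<close>

text \<open>
  The trace-zero part of a matrix has the coordinates \<open>coord o' r q\<close> with respect to the basis
  \<open>sl_elt o' r q\<close>, where \<open>(r, q)\<close> runs through all pairs but \<open>(o', o')\<close>; at this pair, both the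
  coordinate and the element are zero. This basis is more symmetric than the one with
  consecutive diagonal differences and has the same off-diagonal elements and coordinates.
\<close>

definition scalar_coord :: "'f::field^'n::finite^'n \<Rightarrow> 'f"
  where "scalar_coord A = trace A / of_nat CARD('n)"

definition coord :: "'n \<Rightarrow> 'n \<Rightarrow> 'n \<Rightarrow> 'f::field^'n::finite^'n \<Rightarrow> 'f"
  where "coord o' r q A =
    (if r \<noteq> q then A $ r $ q else if r = o' then 0 else A $ r $ r - scalar_coord A)"

definition sl_elt :: "'n \<Rightarrow> 'n \<Rightarrow> 'n \<Rightarrow> 'f::field^'n::finite^'n"
  where "sl_elt o' r q = (if r = q then munit r r - munit o' o' else munit r q)"

lemma sl_elt_sl [simp]: "sl_elt o' r q \<in> sl"
  by (simp add: sl_elt_def)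

lemma scalar_coord_simps:
  "scalar_coord (A + B) = scalar_coord A + scalar_coord B"
  "scalar_coord (mscale c A) = c * scalar_coord A"
  "scalar_coord (mat 1 :: 'f::field_char_0^'n::finite^'n) = 1"
  "A \<in> sl \<Longrightarrow> scalar_coord A = 0"
  by (simp_all add: scalar_coord_def trace_simps add_divide_distrib trace_I sl_def)

lemma functional_coord: "functional (coord o' r q)" "functional scalar_coord"
  by (simp_all add: functional_def coord_def scalar_coord_simps algebra_simps)

lemma coord_one: "coord o' r q (mat 1 :: 'f::field_char_0^'n::finite^'n) = 0"
  by (simp add: coord_def scalar_coord_simps) (simp add: mat_def)

lemma coord_sl_elt:
  "(r, q) \<noteq> (o', o') \<Longrightarrow> coord o' r q (sl_elt o' r' q') = (if r = r' \<and> q = q' then 1 else 0)"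
  by (auto simp: coord_def scalar_coord_simps) (auto simp: sl_elt_def munit_nth)

lemma coord_decomp:
  fixes A :: "'f::field_char_0^'n::finite^'n"
  shows "A = (\<Sum>(r, q)\<in>UNIV - {(o', o')}. mscale (coord o' r q A) (sl_elt o' r q))
    + mscale (scalar_coord A) (mat 1)"
proof -
  let ?S = "\<lambda>A :: 'f^'n^'n. (\<Sum>(r, q)\<in>UNIV - {(o', o')}. mscale (coord o' r q A) (sl_elt o' r q))
    + mscale (scalar_coord A) (mat 1)"
  have add: "?S (A + B) = ?S A + ?S B" for A B
    by (simp add: functional_coord[unfolded functional_def] mscale_simps sum.distrib case_prod_unfold)
  have scale: "?S (mscale c A) = mscale c (?S A)" for c :: 'f and A :: "'f^'n^'n"
  proof -
    have "mscale c (sum f I) = (\<Sum>i\<in>I. mscale c (f i))" for f :: "'n \<times> 'n \<Rightarrow> 'f^'n^'n" and I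
      by (induction I rule: infinite_finite_induct) (simp_all add: mscale_simps)
    then show ?thesis
      by (simp add: functional_coord[unfolded functional_def] mscale_simps case_prod_unfold)
  qed
  have "coord o' r q 0 = (0 :: 'f)" for r q
    by (simp add: coord_def scalar_coord_def trace_simps)
  then have S0: "?S 0 = 0"
    by (simp add: scalar_coord_def trace_simps mscale_simps case_prod_unfold)
  have elt: "?S (sl_elt o' r q) = sl_elt o' r q" for r q
  proof (cases "(r, q) = (o', o')")
    case True
    then have "sl_elt o' r q = (0 :: 'f^'n^'n)" by (simp add: sl_elt_def)
    then show ?thesis by (simp only: S0)
  next
    case False
    have "(\<Sum>(r', q')\<in>UNIV - {(o', o')}.
          mscale (coord o' r' q' (sl_elt o' r q)) (sl_elt o' r' q'))
        = (\<Sum>x\<in>UNIV - {(o', o')}. if x = (r, q) then sl_elt o' r q else 0 :: 'f^'n^'n)"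
    proof (rule sum.cong)
      fix x assume "x \<in> UNIV - {(o', o')}"
      then obtain r' q' where x: "x = (r', q')" "(r', q') \<noteq> (o', o')" by (cases x) auto
      have "coord o' r' q' (sl_elt o' r q) = (if r' = r \<and> q' = q then 1 else 0 :: 'f)"
        by (rule coord_sl_elt[OF x(2)])
      then show "(case x of (r', q') \<Rightarrow> mscale (coord o' r' q' (sl_elt o' r q)) (sl_elt o' r' q'))
          = (if x = (r, q) then sl_elt o' r q else 0 :: 'f^'n^'n)"
        by (simp add: x(1) mscale_simps)
    qed simp
    also have "\<dots> = sl_elt o' r q" using False by (simp add: sum.delta)
    finally show ?thesis by (simp add: scalar_coord_simps mscale_simps)
  qed
  have one: "?S (mat 1) = mat 1"
    by (simp add: coord_one scalar_coord_simps mscale_simps)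
  have sl: "?S s = s" if "s \<in> sl" for s
    using that[unfolded sl_def mem_Collect_eq]
  proof (induction s rule: sl_induct[where o' = o'])
    case (off i q)
    then show ?case using elt[of i q] by (simp add: sl_elt_def)
  next
    case (diag i)
    then show ?case using elt[of i i] by (simp add: sl_elt_def)
  next
    case zero
    show ?case by (rule S0)
  qed (simp_all only: add scale)
  let ?s = "A - mscale (scalar_coord A) (mat 1)"
  have "?s \<in> sl" by (simp add: sl_def trace_simps trace_I scalar_coord_def)
  then have "?S (?s + mscale (scalar_coord A) (mat 1)) = A"
    by (simp only: add scale one sl) simp
  then show ?thesis by simp
qed

lemma ops_coord:
  fixes v :: "'f::field_char_0^'n::finite^'n"
  shows "v \<in> sl \<Longrightarrow> (\<lambda>A. mscale (coord o' r q A) v) \<in> ops"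
  by (intro ops_functional functional_coord coord_one)

lemma ops_scalar_coord: "(\<lambda>A :: 'f::field_char_0^'n::finite^'n. mscale (scalar_coord A) (mat 1)) \<in> ops"
proof -
  obtain o' :: 'n where True by simp
  have "(\<lambda>A :: 'f^'n^'n. A + mscale (- 1) (\<Sum>(r, q)\<in>UNIV - {(o', o')}.
      mscale (coord o' r q A) (sl_elt o' r q))) \<in> ops"
    unfolding case_prod_unfold by (intro ops_add ops_id ops_mscale ops_sum ops_coord sl_elt_sl)
  moreover have "A + mscale (- 1) (\<Sum>(r, q)\<in>UNIV - {(o', o')}.
      mscale (coord o' r q A) (sl_elt o' r q)) = mscale (scalar_coord A) (mat 1)" for A :: "'f^'n^'n"
    using coord_decomp[of A o'] by (simp add: mscale_simps algebra_simps)
  ultimately show ?thesis by simp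
qed

lemma Rep_der_one: "Rep_der d (mat 1) = 0"
proof -
  have "is_matrix_derivation (Rep_der d)" using Rep_der[of d] by simp
  then have "Rep_der d (mat 1 ** mat 1) = Rep_der d (mat 1) ** mat 1 + mat 1 ** Rep_der d (mat 1)"
    unfolding is_matrix_derivation_def by blast
  then show ?thesis by simp
qed

text \<open>
  A derivation maps commutators to sums of commutators, and these span \<open>sl\<close>; it maps the
  identity to zero.
\<close>

lemma Rep_der_sl: "Rep_der d A \<in> sl"
  for A :: "'f::field_char_0^'n::finite^'n"
proof -
  have prod: "Rep_der d (A ** B) = Rep_der d A ** B + A ** Rep_der d B" for A B
    using Rep_der[of d] by (simp add: is_matrix_derivation_def)
  have diff: "Rep_der d (A - B) = Rep_der d A - Rep_der d B" for A B
    using Rep_der_simps(1)[of d "A - B" B] by (simp add: algebra_simps)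
  have lie: "Rep_der d (lie A B) \<in> sl" for A B
    by (simp add: lie_def prod diff sl_def trace_simps trace_mul_sym[of A] trace_mul_sym[of B])
  obtain o' :: 'n where True by simp
  have sl: "Rep_der d s \<in> sl" if "s \<in> sl" for s
    using that[unfolded sl_def mem_Collect_eq]
  proof (induction s rule: sl_induct[where o' = o'])
    case (off i q)
    then show ?case using lie[of "munit i i" "munit i q"] by (simp add: lie_munit)
  next
    case (diag i)
    then show ?case using lie[of "munit i o'" "munit o' i"] by (simp add: lie_munit)
  qed (simp_all add: Rep_der_simps)
  let ?s = "A - mscale (scalar_coord A) (mat 1)"
  have "?s \<in> sl" by (simp add: sl_def trace_simps trace_I scalar_coord_def)
  moreover have "Rep_der d A = Rep_der d ?s" by (simp add: diff Rep_der_simps Rep_der_one mscale_simps)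
  ultimately show ?thesis using sl by metis
qed

text \<open>
  A nonempty product of derivations kills the identity and has values in \<open>sl\<close>, so \<open>U\<close> respects the
  decomposition of a matrix into its scalar and its trace-zero part.
\<close>

lemma falg_act_blocks:
  fixes p :: "('f::field_char_0, ('f, 'n::finite) der) falg"
  shows "(\<exists>c. falg_act p (mat 1) = mscale c (mat 1)) \<and> (\<forall>s\<in>sl. falg_act p s \<in> sl)"
proof (induction p rule: falg_induct)
  case (word w)
  show ?case
  proof (cases w)
    case Nil
    then show ?thesis by (auto simp: falg_act_simps intro!: exI[of _ 1] simp: mscale_simps)
  next
    case (Cons d w')
    have one: "foldr Rep_der w (mat 1) = 0" if "w \<noteq> []" for w :: "('f, 'n) der list"
      using that by (induction w rule: list_nonempty_induct) (simp_all add: Rep_der_one Rep_der_simps)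
    show ?thesis using Cons one[of w]
      by (auto simp: falg_act_simps Rep_der_sl intro!: exI[of _ 0] simp: mscale_simps)
  qed
next
  case (add p q)
  then obtain c d where "falg_act p (mat 1) = mscale c (mat 1)" "falg_act q (mat 1) = mscale d (mat 1)"
    by blast
  then have "falg_act (p + q) (mat 1) = mscale (c + d) (mat 1)"
    by (simp add: falg_act_simps mscale_simps)
  then show ?case using add by (auto simp: falg_act_simps)
next
  case (scale x p)
  then obtain c where "falg_act p (mat 1) = mscale c (mat 1)" by blast
  then have "falg_act (fscale x p) (mat 1) = mscale (x * c) (mat 1)"
    by (simp add: falg_act_simps mscale_simps)
  then show ?case using scale by (auto simp: falg_act_simps)
qed

lemma Rep_uop_falg_act: "\<exists>p. Rep_uop u = falg_act p"
proof -
  obtain x where "Rep_uop u = env_act x" using Rep_uop[of u] by blast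
  moreover have "env_act x = falg_act (rep_env x)"
    by (simp add: env_act.rep_eq)
  ultimately show ?thesis by (intro exI[of _ "rep_env x"]) simp
qed

lemma Rep_uop_blocks:
  fixes u :: "('f::field_char_0, 'n::finite) uop"
  shows "\<exists>c. Rep_uop u (mat 1) = mscale c (mat 1)" and "s \<in> sl \<Longrightarrow> Rep_uop u s \<in> sl"
  using Rep_uop_falg_act[of u] falg_act_blocks by metis+

lemma Rep_uop_linear:
  "Rep_uop u (A + B) = Rep_uop u A + Rep_uop u B"
  "Rep_uop u (mscale c A) = mscale c (Rep_uop u A)"
  "Rep_uop u 0 = 0"
  "Rep_uop u (sum f I) = (\<Sum>i\<in>I. Rep_uop u (f i))"
proof -
  obtain p where p: "Rep_uop u = falg_act p" using Rep_uop_falg_act by blast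
  show 1: "Rep_uop u (A + B) = Rep_uop u A + Rep_uop u B" for A B
    by (simp add: p falg_act_linear)
  show "Rep_uop u (mscale c A) = mscale c (Rep_uop u A)" by (simp add: p falg_act_linear)
  show 2: "Rep_uop u 0 = 0" by (simp add: p falg_act_zero)
  show "Rep_uop u (sum f I) = (\<Sum>i\<in>I. Rep_uop u (f i))"
    by (induction I rule: infinite_finite_induct) (simp_all add: 1 2)
qed

subsection \<open>The elementary operators of the generators\<close>

lemma matrix_unit_munit: "matrix_unit \<iota> i j = munit (\<iota> i) (\<iota> j)"
  by (simp add: matrix_unit_def munit_def)

text \<open>
  Uniqueness only needs that the given matrices span: the consecutive differences of diagonal
  units add up to \<open>E\<^sub>1\<^sub>1 - E\<^sub>i\<^sub>i\<close>.
\<close>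

lemma elem_opI:
  fixes u :: "'f::field_char_0^'n::finite^'n \<Rightarrow> 'f^'n^'n"
  assumes \<iota>: "bij_betw \<iota> {1..CARD('n)} (UNIV :: 'n set)"
    and u: "mlinear u" "u a = b" "\<And>c. c \<in> mat_basis \<iota> \<Longrightarrow> c \<noteq> a \<Longrightarrow> u c = 0"
  shows "elem_op \<iota> a b = u"
  unfolding elem_op_def
proof (rule the_equality)
  show "mlinear u \<and> u a = b \<and> (\<forall>c\<in>mat_basis \<iota> - {a}. u c = 0)" using u by auto
  fix v assume v: "mlinear v \<and> v a = b \<and> (\<forall>c\<in>mat_basis \<iota> - {a}. v c = 0)"
  have basis: "v c = u c" if "c \<in> mat_basis \<iota>" for c
    using u v that by (cases "c = a") auto
  have lin: "v (A + B) = v A + v B" "v (mscale c A) = mscale c (v A)"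
    "u (A + B) = u A + u B" "u (mscale c A) = mscale c (u A)" for A B c
    using u v by (simp_all add: mlinear_iff)
  have surj: "\<exists>i\<in>{1..CARD('n)}. p = \<iota> i" for p
    using \<iota> by (auto simp: bij_betw_def)
  have off: "v (munit p q) = u (munit p q)" if pq: "p \<noteq> q" for p q
  proof -
    obtain i j where "i \<in> {1..CARD('n)}" "j \<in> {1..CARD('n)}" "p = \<iota> i" "q = \<iota> j"
      using surj by metis
    then show ?thesis using pq
      by (intro basis) (auto simp: mat_basis_def sl_basis_def matrix_unit_munit)
  qed
  have diag: "v (munit (\<iota> i) (\<iota> i) - munit (\<iota> 1) (\<iota> 1)) = u (munit (\<iota> i) (\<iota> i) - munit (\<iota> 1) (\<iota> 1))"
    if "1 \<le> i" "i \<le> CARD('n)" for i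
    using that
  proof (induction i rule: nat_induct_at_least)
    case base
    then show ?case using lin(2,4)[of 0 0] by (simp add: mscale_simps)
  next
    case (Suc i)
    let ?h = "munit (\<iota> i) (\<iota> i) - munit (\<iota> (Suc i)) (\<iota> (Suc i)) :: 'f^'n^'n"
    have "?h \<in> mat_basis \<iota>"
      using Suc by (auto simp: mat_basis_def sl_basis_def matrix_unit_munit)
    then have "v (mscale (- 1) ?h) = u (mscale (- 1) ?h)" by (simp only: lin basis)
    then have "v (mscale (- 1) ?h + (munit (\<iota> i) (\<iota> i) - munit (\<iota> 1) (\<iota> 1)))
        = u (mscale (- 1) ?h + (munit (\<iota> i) (\<iota> i) - munit (\<iota> 1) (\<iota> 1)))"
      using Suc by (simp only: lin(1,3))
    moreover have "mscale (- 1) ?h + (munit (\<iota> i) (\<iota> i) - munit (\<iota> 1) (\<iota> 1))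
        = munit (\<iota> (Suc i)) (\<iota> (Suc i)) - munit (\<iota> 1) (\<iota> 1)"
      by (simp add: mscale_simps)
    ultimately show ?case by (simp only:)
  qed
  have sl: "v s = u s" if "trace s = 0" for s
    using that
  proof (induction s rule: sl_induct[where o' = "\<iota> 1"])
    case zero
    then show ?case using lin(2,4)[of 0 0] by (simp add: mscale_simps)
  next
    case (diag p)
    then show ?case using \<open>\<And>i. 1 \<le> i \<Longrightarrow> i \<le> CARD('n) \<Longrightarrow> _ i\<close> surj[of p] by auto
  qed (simp_all add: lin off)
  show "v = u"
  proof
    fix A :: "'f^'n^'n"
    let ?s = "A - mscale (scalar_coord A) (mat 1)"
    have "trace ?s = 0" by (simp add: trace_simps trace_I scalar_coord_def)
    then have "v (?s + mscale (scalar_coord A) (mat 1)) = u (?s + mscale (scalar_coord A) (mat 1))"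
      using basis[of "mat 1"] by (simp only: lin sl) (simp add: mat_basis_def)
    then show "v A = u A" by simp
  qed
qed

lemma elem_op_e12:
  fixes b :: "'f::field_char_0^'n::finite^'n"
  assumes k: "CARD('n) \<ge> 2" and \<iota>: "bij_betw \<iota> {1..CARD('n)} (UNIV :: 'n set)"
  shows "elem_op \<iota> (munit (\<iota> 1) (\<iota> 2)) b = (\<lambda>A. mscale (A $ \<iota> 1 $ \<iota> 2) b)"
proof (rule elem_opI[OF \<iota>])
  have inj: "\<iota> i = \<iota> j \<longleftrightarrow> i = j" if "i \<in> {1..CARD('n)}" "j \<in> {1..CARD('n)}" for i j
    by (rule inj_on_eq_iff[OF bij_betw_imp_inj_on[OF \<iota>] that])
  then have d: "\<iota> 1 \<noteq> \<iota> 2" using k by simp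
  show "mlinear (\<lambda>A. mscale (A $ \<iota> 1 $ \<iota> 2) b)" by (simp add: mlinear_iff mscale_simps)
  fix c :: "'f^'n^'n" assume c: "c \<in> mat_basis \<iota>" "c \<noteq> munit (\<iota> 1) (\<iota> 2)"
  from c(1) have "c $ \<iota> 1 $ \<iota> 2 = 0"
    unfolding mat_basis_def sl_basis_def matrix_unit_munit
  proof (elim insertE UnE CollectE exE conjE)
    fix i j assume "c = munit (\<iota> i) (\<iota> j)" "i \<in> {1..CARD('n)}" "j \<in> {1..CARD('n)}"
    then show ?thesis using c(2) inj[of 1 i] inj[of 2 j] k by (auto simp: munit_nth)
  qed (use d in \<open>auto simp: munit_nth mat_def\<close>)
  then show "mscale (c $ \<iota> 1 $ \<iota> 2) b = 0" by (simp add: mscale_simps)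
qed (simp add: munit_nth mscale_simps)

lemma elem_op_one:
  assumes \<iota>: "bij_betw \<iota> {1..CARD('n)} (UNIV :: 'n set)"
  shows "elem_op \<iota> (mat 1 :: 'f::field_char_0^'n::finite^'n) (mat 1)
    = (\<lambda>A. mscale (scalar_coord A) (mat 1))"
proof (rule elem_opI[OF \<iota>])
  show "mlinear (\<lambda>A :: 'f^'n^'n. mscale (scalar_coord A) (mat 1))"
    by (simp add: mlinear_iff scalar_coord_simps mscale_simps)
  fix c :: "'f^'n^'n" assume "c \<in> mat_basis \<iota>" "c \<noteq> mat 1"
  then have "c \<in> sl_basis \<iota>" by (simp add: mat_basis_def)
  then have "c \<in> sl"
    unfolding sl_basis_def matrix_unit_munit
  proof (rule UnE)
    assume "c \<in> {munit (\<iota> i) (\<iota> j) | i j. i \<in> {1..CARD('n)} \<and> j \<in> {1..CARD('n)} \<and> i \<noteq> j}"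
    then show ?thesis
    proof (elim CollectE exE conjE)
      fix i j assume "c = munit (\<iota> i) (\<iota> j)"
        and ij: "i \<in> {1..CARD('n)}" "j \<in> {1..CARD('n)}" "i \<noteq> j"
      moreover have "\<iota> i \<noteq> \<iota> j"
        using inj_on_eq_iff[OF bij_betw_imp_inj_on[OF \<iota>] ij(1,2)] ij(3) by simp
      ultimately show ?thesis by simp
    qed
  next
    assume "c \<in> {munit (\<iota> i) (\<iota> i) - munit (\<iota> (i + 1)) (\<iota> (i + 1)) | i. 1 \<le> i \<and> i < CARD('n)}"
    then show ?thesis by (elim CollectE exE conjE) simp
  qed
  then show "mscale (scalar_coord c) (mat 1) = (0 :: 'f^'n^'n)"
    by (simp add: scalar_coord_simps mscale_simps)
qed (simp add: scalar_coord_simps mscale_simps)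


section \<open>Representatives of U-polynomials\<close>

text \<open>
  A \<open>U\<close>-polynomial is the class of an element of the free unital algebra without constant term.
\<close>

definition const_free :: "('f::field, 's) falg \<Rightarrow> bool"
  where "const_free p \<longleftrightarrow> Poly_Mapping.lookup p 0 = 0"

lemma const_free_simps [simp]:
  "const_free 0" "const_free (letter s)"
  "const_free p \<Longrightarrow> const_free q \<Longrightarrow> const_free (p + q)"
  "const_free p \<Longrightarrow> const_free q \<Longrightarrow> const_free (p - q)"
  "const_free p \<Longrightarrow> const_free (fscale c p)"
  "const_free p \<Longrightarrow> const_free (p * q)" "const_free q \<Longrightarrow> const_free (p * q)"
  "const_free (falg_der d p')"
  by (simp_all add: const_free_def lookup_letter_zero lookup_add lookup_minus lookup_fscale
      lookup_mult_zero lookup_falg_der_zero)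

lemma const_free_sum: "(\<And>i. i \<in> I \<Longrightarrow> const_free (f i)) \<Longrightarrow> const_free (sum f I)"
  by (induction I rule: infinite_finite_induct) auto

lemma eq_upoly_iff:
  "const_free p \<Longrightarrow> const_free q \<Longrightarrow> abs_upoly p = abs_upoly q \<longleftrightarrow> p - q \<in> ideal_gen lin_rels"
  using Quotient3_rel[OF Quotient3_upoly, of p q]
  by (simp add: const_free_def ideal_gen.zero)

lemma upoly_cases:
  fixes f :: "('f::field, 'n::finite) upoly"
  obtains p where "f = abs_upoly p" "const_free p"
proof -
  have "f = abs_upoly (rep_upoly f)" using Quotient3_abs_rep[OF Quotient3_upoly] by metis
  moreover have "const_free (rep_upoly f)"
    using Quotient3_rep_reflp[OF Quotient3_upoly, of f] by (simp add: const_free_def)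
  ultimately show ?thesis using that by blast
qed

lemma abs_upoly_simps:
  assumes "const_free p"
  shows "const_free q \<Longrightarrow> abs_upoly (p + q) = abs_upoly p + abs_upoly q"
    and "const_free q \<Longrightarrow> abs_upoly (p - q) = abs_upoly p - abs_upoly q"
    and "const_free q \<Longrightarrow> abs_upoly (p * q) = abs_upoly p * abs_upoly q"
    and "abs_upoly (fscale c p) = upoly_scale c (abs_upoly p)"
    and "abs_upoly (falg_der d p) = upoly_der d (abs_upoly p)"
    and "upoly_eval m (abs_upoly p) = falg_eval m p"
  using assms
  by (simp_all add: plus_upoly.abs_eq minus_upoly.abs_eq times_upoly.abs_eq upoly_scale.abs_eq
      upoly_der.abs_eq upoly_eval.abs_eq eq_onp_def ideal_gen.zero const_free_def)

lemma abs_upoly_letter: "abs_upoly (letter (i, u)) = uvar i u"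
  by (simp add: uvar.abs_eq)

lemma abs_upoly_zero: "abs_upoly 0 = 0"
  by (simp add: zero_upoly.abs_eq)

lemma upoly_scale_zero: "upoly_scale 0 f = 0"
proof -
  obtain p where "f = abs_upoly p" "const_free p" by (rule upoly_cases)
  then show ?thesis using abs_upoly_simps(4)[of p 0] by (simp add: abs_upoly_zero)
qed

lemma upoly_induct [case_names uvar add scale mult]:
  fixes f :: "('f::field, 'n::finite) upoly"
  assumes uvar: "\<And>i u. P (uvar i u)" and add: "\<And>f h. P f \<Longrightarrow> P h \<Longrightarrow> P (f + h)"
    and scale: "\<And>c f. P f \<Longrightarrow> P (upoly_scale c f)"
    and mult: "\<And>f h. P f \<Longrightarrow> P h \<Longrightarrow> P (f * h)"
  shows "P f"
proof -
  let ?Q = "\<lambda>p. const_free p \<and> P (abs_upoly p)"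
  obtain p where f: "f = abs_upoly p" "const_free p" by (rule upoly_cases)
  have word: "?Q (word_poly w)" if "w \<noteq> []" for w
    using that
  proof (induction w rule: list_nonempty_induct)
    case (single s)
    then show ?case using uvar by (cases s) (simp add: word_poly_singleton abs_upoly_letter)
  next
    case (cons s w)
    then show ?case using uvar mult
      by (cases s) (simp add: word_poly_Cons abs_upoly_simps abs_upoly_letter)
  qed
  have single: "?Q (Poly_Mapping.single w c)" if "w \<noteq> 0" for w c
  proof -
    obtain v where w: "w = FWord v" by (cases w)
    then have v: "w = FWord v" "v \<noteq> []" using that by (auto simp: zero_fword_def)
    have "Poly_Mapping.single w c = fscale c (word_poly v)"
      by (simp add: v word_poly_def fscale_single)
    then show ?thesis using word[OF v(2)] scale by (simp add: abs_upoly_simps)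
  qed
  have "?Q 0"
    using scale[OF uvar, of 0] by (simp add: upoly_scale_zero abs_upoly_zero)
  then have "?Q (\<Sum>w\<in>Poly_Mapping.keys p. Poly_Mapping.single w (Poly_Mapping.lookup p w))"
    by (rule additive_sum[where P = ?Q])
      (use f(2) in \<open>auto simp: abs_upoly_simps in_keys_iff const_free_def[of p]
          intro!: add single[THEN conjunct1] single[THEN conjunct2]\<close>)
  then show ?thesis using f by (simp flip: single_expansion)
qed


section \<open>Equivariant maps\<close>

definition equivariant ::
  "(('f::field, 'n::finite) upoly \<Rightarrow> 'f^'n^'n) \<Rightarrow> bool"
  where "equivariant \<eta> \<longleftrightarrow>
    (\<forall>f h. \<eta> (f + h) = \<eta> f + \<eta> h) \<and>
    (\<forall>c f. \<eta> (upoly_scale c f) = mscale c (\<eta> f)) \<and>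
    (\<forall>d f. \<eta> (upoly_der d f) = Rep_der d (\<eta> f))"

abbreviation base_var :: "nat \<Rightarrow> ('f::field, 'n::finite) upoly"
  where "base_var i \<equiv> uvar i (Abs_uop (\<lambda>A. A))"

lemma Rep_uop_Abs: "u \<in> ops \<Longrightarrow> Rep_uop (Abs_uop u) = u"
  by (rule Abs_uop_inverse)

lemma falg_act_ops: "falg_act p \<in> ops"
proof -
  have "falg_act p = env_act (abs_env p)" by (simp add: env_act.abs_eq)
  then show ?thesis by blast
qed

text \<open>
  The letter \<open>x\<^sub>i\<^sup>u\<close> arises from \<open>x\<^sub>i\<close> by the action of an element of \<open>U(L)\<close> that acts on the matrices
  as \<open>u\<close>, so an equivariant map is determined on letters by its values at the variables.
\<close>

lemma equivariant_uvar:
  assumes "equivariant \<eta>"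
  shows "\<eta> (uvar i u) = Rep_uop u (\<eta> (base_var i))"
proof -
  obtain p where p: "Rep_uop u = falg_act p" using Rep_uop_falg_act by blast
  have "\<eta> (uvar i (Abs_uop (falg_act p))) = falg_act p (\<eta> (base_var i))" for p
  proof (induction p rule: falg_induct)
    case (word w)
    show ?case
    proof (induction w)
      case Nil
      show ?case by (simp add: falg_act_simps(4) Rep_uop_Abs[OF ops_id] id_def)
    next
      case (Cons d w)
      have "Abs_uop (falg_act (word_poly (d # w))) = der_comp d (Abs_uop (falg_act (word_poly w)))"
        unfolding der_comp_def Rep_uop_Abs[OF falg_act_ops]
        by (intro arg_cong[where f = Abs_uop])
          (simp add: fun_eq_iff word_poly_Cons falg_act_mult falg_act_simps(6))
      then have eq: "uvar i (Abs_uop (falg_act (word_poly (d # w))))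
          = upoly_der d (uvar i (Abs_uop (falg_act (word_poly w))))"
        by (simp add: upoly_der_uvar)
      have e1: "\<eta> (uvar i (Abs_uop (falg_act (word_poly (d # w)))))
          = Rep_der d (\<eta> (uvar i (Abs_uop (falg_act (word_poly w)))))"
        unfolding eq using assms unfolding equivariant_def by blast
      have e2: "Rep_der d (falg_act (word_poly w) A) = falg_act (word_poly (d # w)) A" for A
        by (simp add: word_poly_Cons falg_act_mult falg_act_simps(6))
      show ?case by (simp only: e1 Cons e2)
    qed
  next
    case (add p q)
    have "uvar i (Abs_uop (falg_act (p + q)))
        = upoly_scale 1 (uvar i (Abs_uop (falg_act p))) + upoly_scale 1 (uvar i (Abs_uop (falg_act q)))"
      by (rule uvar_linear) (simp add: Rep_uop_Abs[OF falg_act_ops] falg_act_simps mscale_simps)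
    then show ?case using add assms
      by (simp add: equivariant_def falg_act_simps(1)[where A = "\<eta> (base_var i)"] mscale_simps)
  next
    case (scale c p)
    have "uvar i (Abs_uop (falg_act (fscale c p)))
        = upoly_scale c (uvar i (Abs_uop (falg_act p))) + upoly_scale 0 (uvar i (Abs_uop (falg_act p)))"
      by (rule uvar_linear) (simp add: Rep_uop_Abs[OF falg_act_ops] falg_act_simps mscale_simps)
    then show ?case using scale assms
      by (simp add: equivariant_def falg_act_simps(3)[where A = "\<eta> (base_var i)"] mscale_simps)
  qed
  from this[of p] show ?thesis by (simp add: Rep_uop_inverse flip: p)
qed

lemma equivariant_zero:
  assumes "equivariant \<eta>"
  shows "\<eta> 0 = 0"
proof -
  have "\<eta> (0 + 0) = \<eta> 0 + \<eta> 0" using assms unfolding equivariant_def by blast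
  then show ?thesis by simp
qed

lemma equivariant_diff:
  assumes "equivariant \<eta>"
  shows "\<eta> (f - h) = \<eta> f - \<eta> h"
proof -
  have "\<eta> ((f - h) + h) = \<eta> (f - h) + \<eta> h" using assms unfolding equivariant_def by blast
  then show ?thesis by simp
qed

lemma upoly_eval_equivariant: "equivariant (upoly_eval m)"
proof -
  have "upoly_eval m (upoly_der d f) = Rep_der d (upoly_eval m f)" for d and f :: "('a, 'b) upoly"
  proof (induction f rule: upoly_induct)
    case (mult f h)
    have "Rep_der d (A ** B) = Rep_der d A ** B + A ** Rep_der d B" for A B
      using Rep_der[of d] by (simp add: is_matrix_derivation_def)
    then show ?case using mult by (simp add: upoly_der_mult upoly_eval_simps)
  qed (simp_all add: upoly_der_uvar upoly_der_add upoly_der_scale upoly_eval_simps Rep_der_comp Rep_der_simps)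
  then show ?thesis by (simp add: equivariant_def upoly_eval_simps)
qed

definition equivariant_hom :: "(('f::field, 'n::finite) upoly \<Rightarrow> 'f^'n^'n) \<Rightarrow> bool"
  where "equivariant_hom \<eta> \<longleftrightarrow> equivariant \<eta> \<and> (\<forall>f h. \<eta> (f * h) = \<eta> f ** \<eta> h)"

lemma equivariant_homD:
  assumes "equivariant_hom \<eta>"
  shows "\<eta> 0 = 0" "\<eta> (f + h) = \<eta> f + \<eta> h" "\<eta> (f - h) = \<eta> f - \<eta> h"
    "\<eta> (f * h) = \<eta> f ** \<eta> h" "\<eta> (upoly_scale c f) = mscale c (\<eta> f)"
    "\<eta> (upoly_der d f) = Rep_der d (\<eta> f)"
    "\<eta> (uvar i u) = Rep_uop u (\<eta> (base_var i))"
proof -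
  have *: "equivariant \<eta>" using assms by (simp add: equivariant_hom_def)
  show "\<eta> 0 = 0" "\<eta> (f - h) = \<eta> f - \<eta> h" "\<eta> (uvar i u) = Rep_uop u (\<eta> (base_var i))"
    using * equivariant_zero equivariant_diff equivariant_uvar by blast+
  show "\<eta> (f + h) = \<eta> f + \<eta> h" "\<eta> (f * h) = \<eta> f ** \<eta> h"
    "\<eta> (upoly_scale c f) = mscale c (\<eta> f)" "\<eta> (upoly_der d f) = Rep_der d (\<eta> f)"
    using assms unfolding equivariant_hom_def equivariant_def by blast+
qed

lemma matrix_zero_mult: "0 ** A = 0" "A ** 0 = 0" for A :: "'f::field^'n::finite^'n"
  by (simp_all add: vec_eq_iff matrix_matrix_mult_def)

text \<open>
  This set is used in place of \<open>Id_U\<close> since the composition of an equivariant homomorphism with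
  an endomorphism commuting with \<open>L\<close> is again one, which makes it a \<open>T\<^sub>U\<close>-ideal.
\<close>

definition hom_identities :: "('f::field, 'n::finite) upoly set"
  where "hom_identities = {f. \<forall>\<eta>. equivariant_hom \<eta> \<longrightarrow> \<eta> f = 0}"

lemma hom_identities_TU: "TU_ideal (hom_identities :: ('f::field, 'n::finite) upoly set)"
  unfolding TU_ideal_def upoly_ideal_def
proof (intro conjI allI ballI impI)
  fix \<psi> :: "('f, 'n) upoly \<Rightarrow> ('f, 'n) upoly" and f :: "('f, 'n) upoly"
  assume \<psi>: "upoly_endo \<psi> \<and> (\<forall>d f. \<psi> (upoly_der d f) = upoly_der d (\<psi> f))"
    and f: "f \<in> hom_identities"
  have "equivariant_hom (\<lambda>f. \<eta> (\<psi> f))" if "equivariant_hom \<eta>" for \<eta> :: "('f, 'n) upoly \<Rightarrow> 'f^'n^'n"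
    using that \<psi> by (simp add: equivariant_hom_def equivariant_def upoly_endo_def)
  then show "\<psi> f \<in> hom_identities" using f by (auto simp: hom_identities_def)
qed (auto simp: hom_identities_def equivariant_homD mscale_simps matrix_zero_mult Rep_der_simps)

lemma hom_identities_subset: "hom_identities \<subseteq> Id_U"
proof -
  have "equivariant_hom (upoly_eval m)" for m
    by (simp add: equivariant_hom_def upoly_eval_equivariant upoly_eval_simps)
  then show ?thesis by (auto simp: hom_identities_def Id_U_def)
qed


section \<open>Linear substitutions\<close>

definition op_comp :: "('f::field, 'n::finite) uop \<Rightarrow> ('f, 'n) uop \<Rightarrow> ('f, 'n) uop"
  where "op_comp u v = Abs_uop (\<lambda>A. Rep_uop u (Rep_uop v A))"

lemma Rep_op_comp: "Rep_uop (op_comp u v) A = Rep_uop u (Rep_uop v A)"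
  unfolding op_comp_def using ops_comp[OF Rep_uop Rep_uop, of u v] by (simp add: Rep_uop_Abs)

text \<open>
  Derivations act on a letter \<open>x\<^sub>i\<^sup>u\<close> by composition with \<open>u\<close> from the left, so replacing \<open>x\<^sub>i\<^sup>u\<close> by
  \<open>x\<^sub>j\<^sup>u\<^sup>v\<close>, with \<open>j\<close> and \<open>v\<close> depending on \<open>i\<close>, commutes with them.
\<close>

definition subst_letter ::
  "(nat \<Rightarrow> nat \<times> ('f::field, 'n::finite) uop) \<Rightarrow> nat \<times> ('f, 'n) uop \<Rightarrow> nat \<times> ('f, 'n) uop"
  where "subst_letter \<sigma> s = (fst (\<sigma> (fst s)), op_comp (snd s) (snd (\<sigma> (fst s))))"

definition falg_subst ::
  "(nat \<Rightarrow> nat \<times> ('f::field, 'n::finite) uop) \<Rightarrow>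
    ('f, nat \<times> ('f, 'n) uop) falg \<Rightarrow> ('f, nat \<times> ('f, 'n) uop) falg"
  where "falg_subst \<sigma> = lin_ext fscale (\<lambda>w. word_poly (map (subst_letter \<sigma>) w))"

lemma falg_subst_simps:
  "falg_subst \<sigma> (p + q) = falg_subst \<sigma> p + falg_subst \<sigma> q"
  "falg_subst \<sigma> (p - q) = falg_subst \<sigma> p - falg_subst \<sigma> q"
  "falg_subst \<sigma> (fscale c p) = fscale c (falg_subst \<sigma> p)"
  "falg_subst \<sigma> (word_poly w) = word_poly (map (subst_letter \<sigma>) w)"
  "falg_subst \<sigma> (letter s) = letter (subst_letter \<sigma> s)"
  using lin_ext_word[OF module_fscale, of "\<lambda>w. word_poly (map (subst_letter \<sigma>) w)" "[s]"]
  by (simp_all add: falg_subst_def lin_ext_add lin_ext_diff lin_ext_fscale lin_ext_word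
      module_fscale word_poly_singleton)

lemma falg_subst_mult: "falg_subst \<sigma> (p * q) = falg_subst \<sigma> p * falg_subst \<sigma> q"
proof (induction p rule: falg_induct)
  case (word v)
  show ?case
  proof (induction q rule: falg_induct)
    case (word w)
    then show ?case by (simp add: falg_subst_simps(4) flip: word_poly_append map_append)
  next
    case (add p q)
    then show ?case by (simp add: falg_subst_simps(1) distrib_left)
  next
    case (scale c p)
    then show ?case by (simp add: falg_subst_simps(3) flip: fscale_mult_right)
  qed
next
  case (add p q)
  then show ?case by (simp add: falg_subst_simps(1) distrib_right)
next
  case (scale c p)
  then show ?case by (simp add: falg_subst_simps(3) flip: fscale_mult_left)
qed

lemma falg_subst_der: "falg_subst \<sigma> (falg_der d p) = falg_der d (falg_subst \<sigma> p)"
proof (induction p rule: falg_induct)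
  case (word w)
  have comp: "op_comp (der_comp d u) v = der_comp d (op_comp u v)" for u v
    by (rule Rep_uop_inject[THEN iffD1]) (simp add: fun_eq_iff Rep_op_comp Rep_der_comp)
  have "falg_subst \<sigma> (word_der d w) = word_der d (map (subst_letter \<sigma>) w)"
  proof (induction w)
    case Nil
    then show ?case using falg_subst_simps(2)[of \<sigma> 0 0] by simp
  next
    case (Cons s w)
    then show ?case
      by (simp add: falg_subst_simps falg_subst_mult) (simp add: subst_letter_def comp)
  qed
  then show ?case by (simp add: falg_der_simps(4) falg_subst_simps(4))
qed (simp_all add: falg_der_simps falg_subst_simps)

lemma const_free_subst: "const_free p \<Longrightarrow> const_free (falg_subst \<sigma> p)"
proof -
  have "Poly_Mapping.lookup (falg_subst \<sigma> p) 0 = Poly_Mapping.lookup p 0"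
  proof (induction p rule: falg_induct)
    case (word w)
    then show ?case
      by (simp add: falg_subst_simps(4)) (simp add: word_poly_def lookup_single zero_fword_def when_def)
  qed (simp_all add: falg_subst_simps lookup_add lookup_fscale)
  then show "const_free p \<Longrightarrow> ?thesis" by (simp add: const_free_def)
qed

lemma falg_subst_lin_rels: "p \<in> ideal_gen lin_rels \<Longrightarrow> falg_subst \<sigma> p \<in> ideal_gen lin_rels"
proof (induction p rule: ideal_gen.induct)
  case zero
  then show ?case using falg_subst_simps(2)[of \<sigma> 0 0] by (simp add: ideal_gen.zero)
next
  case (base r)
  then obtain a b i u u1 u2
    where r: "r = letter (i, u) - (fscale a (letter (i, u1)) + fscale b (letter (i, u2)))"
      and *: "\<forall>A. Rep_uop u A = mscale a (Rep_uop u1 A) + mscale b (Rep_uop u2 A)"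
    by (auto simp: lin_rels_def)
  let ?c = "\<lambda>u. op_comp u (snd (\<sigma> i))"
  have "Rep_uop (?c u) A = mscale a (Rep_uop (?c u1) A) + mscale b (Rep_uop (?c u2) A)" for A
    by (simp add: Rep_op_comp *)
  then have "letter (fst (\<sigma> i), ?c u) -
      (fscale a (letter (fst (\<sigma> i), ?c u1)) + fscale b (letter (fst (\<sigma> i), ?c u2))) \<in> lin_rels"
    unfolding lin_rels_def by blast
  then show ?case by (simp add: r falg_subst_simps subst_letter_def ideal_gen.base)
next
  case (add p q)
  then show ?case by (simp add: falg_subst_simps ideal_gen.add)
next
  case (left p a)
  then show ?case by (simp add: falg_subst_mult ideal_gen.left)
next
  case (right p a)
  then show ?case by (simp add: falg_subst_mult ideal_gen.right)
qed

lift_definition upoly_subst ::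
  "(nat \<Rightarrow> nat \<times> ('f::field, 'n::finite) uop) \<Rightarrow> ('f, 'n) upoly \<Rightarrow> ('f, 'n) upoly" is falg_subst
  using const_free_subst
  by (fastforce simp: const_free_def falg_subst_lin_rels simp flip: falg_subst_simps(2))

lemma upoly_subst_simps:
  "upoly_subst \<sigma> (f + h) = upoly_subst \<sigma> f + upoly_subst \<sigma> h"
  "upoly_subst \<sigma> (upoly_scale c f) = upoly_scale c (upoly_subst \<sigma> f)"
  "upoly_subst \<sigma> (f * h) = upoly_subst \<sigma> f * upoly_subst \<sigma> h"
  "upoly_subst \<sigma> (upoly_der d f) = upoly_der d (upoly_subst \<sigma> f)"
  "upoly_subst \<sigma> (uvar i u) = uvar (fst (\<sigma> i)) (op_comp u (snd (\<sigma> i)))"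
proof -
  obtain p q where f: "f = abs_upoly p" "const_free p" and h: "h = abs_upoly q" "const_free q"
    by (metis upoly_cases)
  have s: "upoly_subst \<sigma> (abs_upoly p) = abs_upoly (falg_subst \<sigma> p)" if "const_free p" for p
    using that by (simp add: upoly_subst.abs_eq eq_onp_def const_free_def ideal_gen.zero)
  note [simp] = const_free_subst
  show "upoly_subst \<sigma> (f + h) = upoly_subst \<sigma> f + upoly_subst \<sigma> h"
    "upoly_subst \<sigma> (upoly_scale c f) = upoly_scale c (upoly_subst \<sigma> f)"
    "upoly_subst \<sigma> (f * h) = upoly_subst \<sigma> f * upoly_subst \<sigma> h"
    "upoly_subst \<sigma> (upoly_der d f) = upoly_der d (upoly_subst \<sigma> f)"
    using f h by (simp_all add: s falg_subst_simps falg_subst_mult falg_subst_der flip: abs_upoly_simps)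
  show "upoly_subst \<sigma> (uvar i u) = uvar (fst (\<sigma> i)) (op_comp u (snd (\<sigma> i)))"
    by (simp add: s falg_subst_simps subst_letter_def flip: abs_upoly_letter)
qed

lemma TU_ideal_subst: "TU_ideal I \<Longrightarrow> f \<in> I \<Longrightarrow> upoly_subst \<sigma> f \<in> I"
  by (simp add: TU_ideal_def upoly_endo_def upoly_subst_simps)


section \<open>Linear independence of monomials\<close>

text \<open>
  Dedekind's independence of characters: replacing \<open>g\<close> by \<open>op g h\<close> in a relation and subtracting
  \<open>\<psi> \<mu> g\<close> times the relation removes \<open>\<mu>\<close> from it.
\<close>

lemma characters_independent:
  fixes \<psi> :: "'k \<Rightarrow> 'g \<Rightarrow> 'f::field"
  assumes "finite K"
    and mult: "\<And>\<kappa> g h. \<psi> \<kappa> (op g h) = \<psi> \<kappa> g * \<psi> \<kappa> h" and one: "\<And>\<kappa>. \<psi> \<kappa> u = 1"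
    and sep: "\<And>\<kappa> \<mu>. \<kappa> \<noteq> \<mu> \<Longrightarrow> \<exists>g. \<psi> \<kappa> g \<noteq> \<psi> \<mu> g"
    and zero: "\<And>g. (\<Sum>\<kappa>\<in>K. c \<kappa> * \<psi> \<kappa> g) = 0"
    and "\<kappa> \<in> K"
  shows "c \<kappa> = 0"
  using assms(1) zero \<open>\<kappa> \<in> K\<close>
proof (induction K arbitrary: c \<kappa> rule: finite_induct)
  case (insert \<mu> K)
  have K: "c \<kappa> = 0" if \<kappa>: "\<kappa> \<in> K" for \<kappa>
  proof -
    obtain g where g: "\<psi> \<kappa> g \<noteq> \<psi> \<mu> g" using sep[of \<kappa> \<mu>] \<kappa> insert.hyps by blast
    have "(\<Sum>\<kappa>\<in>K. (c \<kappa> * (\<psi> \<kappa> g - \<psi> \<mu> g)) * \<psi> \<kappa> h) = 0" for h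
    proof -
      have "(\<Sum>\<kappa>\<in>insert \<mu> K. c \<kappa> * \<psi> \<kappa> (op g h)) - \<psi> \<mu> g * (\<Sum>\<kappa>\<in>insert \<mu> K. c \<kappa> * \<psi> \<kappa> h) = 0"
        using insert.prems(1)[of "op g h"] insert.prems(1)[of h] by simp
      then show ?thesis
        using insert.hyps
        by (simp add: mult sum_distrib_left algebra_simps flip: sum_subtractf)
    qed
    from insert.IH[OF this \<kappa>] show ?thesis using g by simp
  qed
  have "c \<mu> = 0" using insert.prems(1)[of u] insert.hyps K by (simp add: one)
  then show ?case using K insert.prems(2) by blast
qed simp

definition monomial :: "'a multiset \<times> 'b multiset \<Rightarrow> ('a \<Rightarrow> 'f) \<times> ('b \<Rightarrow> 'f) \<Rightarrow> 'f::comm_ring_1"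
  where "monomial \<kappa> g = (\<Prod>x\<in>#fst \<kappa>. fst g x) * (\<Prod>x\<in>#snd \<kappa>. snd g x)"

text \<open>
  At the point that is 2 in one unknown and 1 in the others, a monomial is the power of 2 given
  by the degree in this unknown; the powers of 2 are distinct in characteristic zero.
\<close>

lemma monomials_separate:
  fixes \<kappa> \<mu> :: "'a multiset \<times> 'b multiset"
  assumes "\<kappa> \<noteq> \<mu>"
  shows "\<exists>g. monomial \<kappa> g \<noteq> (monomial \<mu> g :: 'f::field_char_0)"
proof -
  have pow: "(\<Prod>y\<in>#M. if y = x then 2 else 1) = (2 ^ count M x :: 'f)" for M :: "'c multiset" and x
    by (induction M) auto
  have inj: "m = n" if "(2 :: 'f) ^ m = 2 ^ n" for m n
  proof -
    have "of_nat (2 ^ m) = (of_nat (2 ^ n) :: 'f)" using that by simp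
    then have "(2 :: nat) ^ m = 2 ^ n" by (simp only: of_nat_eq_iff)
    then show ?thesis by simp
  qed
  from assms consider "fst \<kappa> \<noteq> fst \<mu>" | "snd \<kappa> \<noteq> snd \<mu>" by (metis prod_eqI)
  then show ?thesis
  proof cases
    case 1
    then obtain x where "count (fst \<kappa>) x \<noteq> count (fst \<mu>) x" by (metis multiset_eqI)
    then have "monomial \<kappa> (\<lambda>y. if y = x then 2 else 1, \<lambda>_. 1)
        \<noteq> (monomial \<mu> (\<lambda>y. if y = x then 2 else 1, \<lambda>_. 1) :: 'f)"
      using inj by (auto simp: monomial_def pow)
    then show ?thesis by blast
  next
    case 2
    then obtain x where "count (snd \<kappa>) x \<noteq> count (snd \<mu>) x" by (metis multiset_eqI)
    then have "monomial \<kappa> (\<lambda>_. 1, \<lambda>y. if y = x then 2 else 1)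
        \<noteq> (monomial \<mu> (\<lambda>_. 1, \<lambda>y. if y = x then 2 else 1) :: 'f)"
      using inj by (auto simp: monomial_def pow)
    then show ?thesis by blast
  qed
qed

lemma monomials_independent:
  fixes c :: "'a multiset \<times> 'b multiset \<Rightarrow> 'f::field_char_0"
  assumes "finite K" and "\<And>g. (\<Sum>\<kappa>\<in>K. c \<kappa> * monomial \<kappa> g) = 0" and "\<kappa> \<in> K"
  shows "c \<kappa> = 0"
proof (rule characters_independent[where \<psi> = monomial
      and op = "\<lambda>g h. (\<lambda>x. fst g x * fst h x, \<lambda>x. snd g x * snd h x)" and u = "(\<lambda>_. 1, \<lambda>_. 1)"])
  show "\<exists>g. monomial \<kappa> g \<noteq> (monomial \<mu> g :: 'f)" if "\<kappa> \<noteq> \<mu>" for \<kappa> \<mu> :: "'a multiset \<times> 'b multiset"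
    using that by (rule monomials_separate)
qed (use assms in \<open>auto simp: monomial_def prod_mset.distrib algebra_simps\<close>)


section \<open>Identities follow from the four relations\<close>

lemma sum_list_group:
  assumes "finite K" "key ` set xs \<subseteq> K"
  shows "sum_list (map f xs) = (\<Sum>\<kappa>\<in>K. sum_list (map f (filter (\<lambda>x. key x = \<kappa>) xs)))"
  using assms(2)
proof (induction xs)
  case (Cons x xs)
  have "(\<Sum>\<kappa>\<in>K. sum_list (map f (filter (\<lambda>x. key x = \<kappa>) (x # xs))))
      = (\<Sum>\<kappa>\<in>K. (if key x = \<kappa> then f x else 0) + sum_list (map f (filter (\<lambda>x. key x = \<kappa>) xs)))"
    by (intro sum.cong refl) simp
  also have "\<dots> = f x + sum_list (map f xs)"
    using Cons assms(1) by (simp add: sum.distrib)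
  finally show ?case by simp
qed simp

lemma sum_list_biadditive:
  fixes op :: "'a::comm_monoid_add \<Rightarrow> 'b::comm_monoid_add \<Rightarrow> 'c::comm_monoid_add"
  assumes "\<And>x y z. op (x + y) z = op x z + op y z" "\<And>x y z. op z (x + y) = op z x + op z y"
    and "\<And>z. op 0 z = 0" "\<And>z. op z 0 = 0"
  shows "op (sum_list (map f xs)) (sum_list (map g ys))
    = sum_list (map (\<lambda>(x, y). op (f x) (g y)) (List.product xs ys))"
proof -
  have 1: "op z (sum_list (map g ys)) = sum_list (map (\<lambda>y. op z (g y)) ys)" for z
    by (induction ys) (simp_all add: assms)
  show ?thesis
    by (induction xs) (simp_all add: assms 1 comp_def sum_list_addf)
qed

lemma uvar_zero:
  assumes "\<And>A. Rep_uop u A = 0"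
  shows "uvar i u = 0"
proof -
  have "uvar i u = upoly_scale 0 (uvar i u) + upoly_scale 0 (uvar i u)"
    using assms by (intro uvar_linear) (simp add: mscale_simps)
  then show ?thesis by (simp add: upoly_scale_zero)
qed

lemma upoly_scale_one: "upoly_scale 1 f = f"
proof -
  obtain p where "f = abs_upoly p" "const_free p" by (rule upoly_cases)
  then show ?thesis using abs_upoly_simps(4)[of p 1] by (simp add: fscale_one)
qed

lemma uvar_scale:
  assumes "\<And>A. Rep_uop u A = mscale c (Rep_uop v A)"
  shows "uvar i u = upoly_scale c (uvar i v)"
  using uvar_linear[of u c v 0 v i] assms by (simp add: mscale_simps upoly_scale_zero)

lemma uvar_add:
  assumes "\<And>A. Rep_uop u A = Rep_uop v A + Rep_uop w A"
  shows "uvar i u = uvar i v + uvar i w"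
  using uvar_linear[of u 1 v 1 w i] assms by (simp add: mscale_simps upoly_scale_one)

lemma uvar_sum:
  assumes "finite K" and "\<And>A. Rep_uop u A = (\<Sum>k\<in>K. Rep_uop (v k) A) + Rep_uop w A"
  shows "uvar i u = (\<Sum>k\<in>K. uvar i (v k)) + uvar i w"
  using assms
proof (induction K arbitrary: u rule: finite_induct)
  case empty
  then have "Rep_uop u = Rep_uop w" by (simp add: fun_eq_iff)
  then show ?case by (simp add: Rep_uop_inject)
next
  case (insert k K)
  let ?u = "Abs_uop (\<lambda>A. (\<Sum>k\<in>K. Rep_uop (v k) A) + Rep_uop w A)"
  have R: "Rep_uop ?u A = (\<Sum>k\<in>K. Rep_uop (v k) A) + Rep_uop w A" for A
    by (subst Rep_uop_Abs) (intro ops_add ops_sum Rep_uop, rule refl)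
  have "uvar i u = uvar i (v k) + uvar i ?u"
    using insert by (intro uvar_add) (simp add: R add.assoc)
  then show ?case using insert.IH[OF R] insert.hyps by (simp add: add.assoc)
qed

definition ideal_reps :: "('f::field, 'n::finite) upoly set \<Rightarrow> ('f, nat \<times> ('f, 'n) uop) falg set"
  where "ideal_reps I = {p. const_free p \<and> abs_upoly p \<in> I}"

text \<open>
  An ideal of the nonunital algebra is an ideal of the unital one, because the constant term of
  a factor acts as a scalar.
\<close>

lemma ideal_gen_reps:
  assumes I: "upoly_ideal I"
  shows "ideal_gen (ideal_reps I) = ideal_reps I"
proof
  show "ideal_gen (ideal_reps I) \<subseteq> ideal_reps I"
  proof
    fix p assume "p \<in> ideal_gen (ideal_reps I)"
    then show "p \<in> ideal_reps I"
    proof (induction p rule: ideal_gen.induct)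
      case zero
      then show ?case using I by (simp add: ideal_reps_def abs_upoly_zero upoly_ideal_def)
    next
      case (add p q)
      then show ?case using I by (simp add: ideal_reps_def abs_upoly_simps upoly_ideal_def)
    next
      case (left p a)
      let ?c = "Poly_Mapping.lookup a 0"
      define a' where "a' = a - fscale ?c 1"
      have a': "const_free a'"
        by (simp add: a'_def const_free_def lookup_minus lookup_fscale lookup_one)
      have "a * p = a' * p + fscale ?c p"
        by (simp add: a'_def left_diff_distrib flip: fscale_mult_left)
      then show ?case using left I a'
        by (simp add: ideal_reps_def abs_upoly_simps upoly_ideal_def)
    next
      case (right p a)
      let ?c = "Poly_Mapping.lookup a 0"
      define a' where "a' = a - fscale ?c 1"
      have a': "const_free a'"
        by (simp add: a'_def const_free_def lookup_minus lookup_fscale lookup_one)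
      have "p * a = p * a' + fscale ?c p"
        by (simp add: a'_def right_diff_distrib flip: fscale_mult_right)
      then show ?case using right I a'
        by (simp add: ideal_reps_def abs_upoly_simps upoly_ideal_def)
    qed
  qed
qed (auto intro: ideal_gen.base)

definition rank_one_uop ::
  "('f::field^'n::finite^'n \<Rightarrow> 'f) \<Rightarrow> 'f^'n^'n \<Rightarrow> ('f, 'n) uop"
  where "rank_one_uop \<xi> v = Abs_uop (\<lambda>A. mscale (\<xi> A) v)"

lemma Rep_rank_one:
  fixes v :: "'f::field_char_0^'n::finite^'n"
  assumes "functional \<xi>" "\<xi> (mat 1) = 0" "v \<in> sl"
  shows "Rep_uop (rank_one_uop \<xi> v) A = mscale (\<xi> A) v"
  unfolding rank_one_uop_def Rep_uop_Abs[OF ops_functional[OF assms]] ..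

abbreviation scalar_uop :: "('f::field_char_0, 'n::finite) uop"
  where "scalar_uop \<equiv> rank_one_uop scalar_coord (mat 1)"

lemma Rep_scalar: "Rep_uop scalar_uop A = mscale (scalar_coord A) (mat 1)"
  for A :: "'f::field_char_0^'n::finite^'n"
  unfolding rank_one_uop_def Rep_uop_Abs[OF ops_scalar_coord] ..

lemma functional_entry: "functional (\<lambda>A. A $ a $ b)"
  by (simp add: functional_def)

text \<open>
  An arbitrary \<open>T\<^sub>U\<close>-ideal that contains the four generators; the elementary operator with source
  \<open>E\<^sub>a\<^sub>b\<close> and target \<open>v\<close> is \<open>A \<mapsto> A\<^sub>a\<^sub>b v\<close>.
\<close>

locale generator_ideal =
  fixes I :: "('f::field_char_0, 'n::finite) upoly set" and a b :: 'n and e :: "'f^'n^'n"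
    and i j :: nat
  assumes I: "TU_ideal I" and ab: "a \<noteq> b" and ij: "i \<noteq> j"
    and e: "e = munit a b \<and> UNIV = {a, b} \<or> (\<exists>c. c \<noteq> a \<and> c \<noteq> b \<and> e = munit c a)"
    and I1: "uvar i (rank_one_uop (\<lambda>A. A $ a $ b) (munit a b))
      * uvar j (rank_one_uop (\<lambda>A. A $ a $ b) e) \<in> I"
    and I2: "uvar i (rank_one_uop (\<lambda>A. A $ a $ b) (munit a b))
        * uvar j (rank_one_uop (\<lambda>A. A $ a $ b) (munit b a))
      - uvar j (rank_one_uop (\<lambda>A. A $ a $ b) (munit a b))
        * uvar i (rank_one_uop (\<lambda>A. A $ a $ b) (munit b a)) \<in> I"
    and I3: "commutator (uvar i scalar_uop)
      (uvar j scalar_uop) \<in> I"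
    and I4: "commutator (uvar i scalar_uop)
      (uvar j (rank_one_uop (\<lambda>A. A $ a $ b) (munit a b))) \<in> I"
begin

text \<open>
  The source \<open>(l, r, q)\<close> is the variable \<open>x\<^sub>l\<close> together with the coordinate \<open>(r, q)\<close>, where the index \<open>a\<close> is
  the exceptional one.
\<close>

definition xl :: "nat \<times> 'n \<times> 'n \<Rightarrow> 'f^'n^'n \<Rightarrow> ('f, nat \<times> ('f, 'n) uop) falg"
  where "xl \<alpha> s = letter (fst \<alpha>, rank_one_uop (coord a (fst (snd \<alpha>)) (snd (snd \<alpha>))) s)"

definition zl :: "nat \<Rightarrow> ('f, nat \<times> ('f, 'n) uop) falg"
  where "zl l = letter (l, scalar_uop)"

abbreviation R where "R \<equiv> ideal_reps I"

lemma e_sl: "e \<in> sl"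
  using e ab by auto

lemma Rep_entry: "v \<in> sl \<Longrightarrow> Rep_uop (rank_one_uop (\<lambda>A. A $ a $ b) v) A = mscale (A $ a $ b) v"
  for v :: "'f^'n^'n"
  using Rep_rank_one[OF functional_entry, of a b v] ab by (simp add: mat_def)

lemma Rep_coord: "v \<in> sl \<Longrightarrow> Rep_uop (rank_one_uop (coord a r q) v) A = mscale (coord a r q A) v"
  for v :: "'f^'n^'n"
  by (rule Rep_rank_one[OF functional_coord(1) coord_one])

lemma congI: "const_free p \<Longrightarrow> const_free q \<Longrightarrow> abs_upoly p - abs_upoly q \<in> I \<Longrightarrow> falg_mod.cong R p q"
  using I by (simp add: falg_mod.cong_def ideal_gen_reps TU_ideal_def)
    (simp add: ideal_reps_def abs_upoly_simps)

lemma congI': "const_free p \<Longrightarrow> const_free q \<Longrightarrow> abs_upoly p = abs_upoly q \<Longrightarrow> falg_mod.cong R p q"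
  using I by (intro congI) (auto simp: TU_ideal_def upoly_ideal_def)

lemma xl_const_free [simp]: "const_free (xl \<alpha> s)" "const_free (zl l)"
  by (simp_all add: xl_def zl_def)

lemma xl_add:
  assumes "s \<in> sl" "t \<in> sl"
  shows "abs_upoly (xl \<alpha> (s + t)) = abs_upoly (xl \<alpha> s) + abs_upoly (xl \<alpha> t)"
  unfolding xl_def abs_upoly_letter using assms
  by (intro uvar_add) (simp add: Rep_coord mscale_simps)

lemma xl_mscale:
  assumes "s \<in> sl"
  shows "abs_upoly (xl \<alpha> (mscale c s)) = upoly_scale c (abs_upoly (xl \<alpha> s))"
  unfolding xl_def abs_upoly_letter using assms
  by (intro uvar_scale) (simp add: Rep_coord mscale_simps mult.commute)

text \<open>
  Substituting \<open>x\<^sub>i\<close> by the letter with operator \<open>A \<mapsto> \<xi>(A) E\<^sub>a\<^sub>b\<close> changes the functional \<open>A \<mapsto> A\<^sub>a\<^sub>b\<close> into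
  the functional \<open>\<xi>\<close>, which turns a generator into the same relation for other sources.
\<close>

lemma subst_entry:
  fixes s :: "'f^'n^'n"
  assumes "s \<in> sl"
  shows "op_comp (rank_one_uop (\<lambda>A. A $ a $ b) s) (rank_one_uop (coord a r q) (munit a b))
    = rank_one_uop (coord a r q) s"
proof (rule Rep_uop_inject[THEN iffD1], rule ext)
  fix A
  show "Rep_uop (op_comp (rank_one_uop (\<lambda>A. A $ a $ b) s) (rank_one_uop (coord a r q) (munit a b))) A
    = Rep_uop (rank_one_uop (coord a r q) s) A"
    using assms ab by (simp add: Rep_op_comp Rep_entry Rep_coord munit_nth)
qed

lemma subst_scalar:
  "op_comp scalar_uop scalar_uop
    = (scalar_uop :: ('f, 'n) uop)"
  by (rule Rep_uop_inject[THEN iffD1]) (simp add: fun_eq_iff Rep_op_comp Rep_scalar scalar_coord_simps)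

definition letter_subst :: "nat \<times> ('f, 'n) uop \<Rightarrow> nat \<times> ('f, 'n) uop \<Rightarrow> nat \<Rightarrow> nat \<times> ('f, 'n) uop"
  where "letter_subst s t l = (if l = i then s else t)"

lemma I_subst: "f \<in> I \<Longrightarrow> upoly_subst (letter_subst s t) f \<in> I"
  by (rule TU_ideal_subst[OF I])

lemma upoly_subst_diff: "upoly_subst \<sigma> (f - h) = upoly_subst \<sigma> f - upoly_subst \<sigma> h"
  using upoly_subst_simps(1)[of \<sigma> "f - h" h] by (simp add: algebra_simps)

sublocale matrix_relations R a b xl zl "\<lambda>c. falg_der (ad c)" e
proof unfold_locales
  note subst = upoly_subst_simps upoly_subst_diff letter_subst_def ij ij[symmetric] subst_entry subst_scalar
  fix c s :: "'f^'n^'n" and p q :: "('f, nat \<times> ('f, 'n) uop) falg"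
    and x :: 'f and \<alpha> \<beta> :: "nat \<times> 'n \<times> 'n" and l l' :: nat
  show "a \<noteq> b" by (rule ab)
  show "falg_der (ad c) (p - q) = falg_der (ad c) p - falg_der (ad c) q"
    "falg_der (ad c) (fscale x p) = fscale x (falg_der (ad c) p)"
    "falg_der (ad c) (p * q) = falg_der (ad c) p * q + p * falg_der (ad c) q"
    by (simp_all add: falg_der_simps falg_der_mult)
  show "falg_der (ad c) p \<in> ideal_gen R" if "p \<in> ideal_gen R"
    using that I by (simp add: ideal_gen_reps TU_ideal_def)
      (simp add: ideal_reps_def abs_upoly_simps)
  show "falg_mod.cong R (falg_der (ad c) (xl \<alpha> s)) (xl \<alpha> (lie c s))" if s: "s \<in> sl"
  proof -
    have "der_comp (ad c) (rank_one_uop (coord a r q) s) = rank_one_uop (coord a r q) (lie c s)" for r q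
      by (rule Rep_uop_inject[THEN iffD1]) (simp add: fun_eq_iff Rep_der_comp Rep_coord s lie_mscale)
    then have "falg_der (ad c) (xl \<alpha> s) = xl \<alpha> (lie c s)" by (simp add: xl_def falg_der_simps)
    then show ?thesis by (simp add: falg_mod.cong_refl)
  qed
  show "falg_mod.cong R (falg_der (ad c) (zl l)) 0"
  proof (rule congI')
    show "abs_upoly (falg_der (ad c) (zl l)) = abs_upoly 0"
      unfolding zl_def falg_der_simps(5) abs_upoly_letter abs_upoly_zero
      by (rule uvar_zero) (simp add: Rep_der_comp Rep_scalar lie_mscale, simp add: lie_def mscale_simps)
  qed simp_all
  show "falg_mod.lin_on R sl (xl \<alpha>)"
    by (auto simp: falg_mod.lin_on_def xl_add xl_mscale abs_upoly_simps intro!: congI')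
  have E: "munit a b \<in> sl" "munit b a \<in> sl" using ab by auto
  show "falg_mod.cong R (xl \<alpha> (munit a b) * xl \<beta> e) 0"
  proof (rule congI)
    obtain l r q l' r' q' where ind: "\<alpha> = (l, r, q)" "\<beta> = (l', r', q')" by (metis prod_cases3)
    show "abs_upoly (xl \<alpha> (munit a b) * xl \<beta> e) - abs_upoly 0 \<in> I"
      using I_subst[OF I1, of "(l, rank_one_uop (coord a r q) (munit a b))"
          "(l', rank_one_uop (coord a r' q') (munit a b))"]
      by (simp add: ind abs_upoly_simps abs_upoly_zero subst E e_sl) (simp add: xl_def abs_upoly_letter)
  qed simp_all
  show "falg_mod.cong R (xl \<alpha> (munit a b) * xl \<beta> (munit b a)) (xl \<beta> (munit a b) * xl \<alpha> (munit b a))"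
  proof (rule congI)
    obtain l r q l' r' q' where ind: "\<alpha> = (l, r, q)" "\<beta> = (l', r', q')" by (metis prod_cases3)
    show "abs_upoly (xl \<alpha> (munit a b) * xl \<beta> (munit b a))
        - abs_upoly (xl \<beta> (munit a b) * xl \<alpha> (munit b a)) \<in> I"
      using I_subst[OF I2, of "(l, rank_one_uop (coord a r q) (munit a b))"
          "(l', rank_one_uop (coord a r' q') (munit a b))"]
      by (simp add: ind abs_upoly_simps subst E) (simp add: xl_def abs_upoly_letter)
  qed simp_all
  show "falg_mod.cong R (zl l * zl l') (zl l' * zl l)"
  proof (rule congI)
    show "abs_upoly (zl l * zl l') - abs_upoly (zl l' * zl l) \<in> I"
      using I_subst[OF I3, of "(l, scalar_uop)"
          "(l', scalar_uop)"]
      by (simp add: commutator_def abs_upoly_simps subst) (simp add: zl_def abs_upoly_letter)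
  qed simp_all
  show "falg_mod.cong R (zl l * xl \<alpha> (munit a b)) (xl \<alpha> (munit a b) * zl l)"
  proof (rule congI)
    obtain l' r q where ind: "\<alpha> = (l', r, q)" by (metis prod_cases3)
    show "abs_upoly (zl l * xl \<alpha> (munit a b)) - abs_upoly (xl \<alpha> (munit a b) * zl l) \<in> I"
      using I_subst[OF I4, of "(l, scalar_uop)"
          "(l', rank_one_uop (coord a r q) (munit a b))"]
      by (simp add: ind commutator_def abs_upoly_simps subst E) (simp add: zl_def xl_def abs_upoly_letter)
  qed simp_all
  show "e = munit a b \<and> UNIV = {a, b} \<or> (\<exists>c. c \<noteq> a \<and> c \<noteq> b \<and> e = munit c a)" by (rule e)
qed

notation cong (infix "\<simeq>" 50)

text \<open>
  The point of the matrix space whose coordinates are prescribed by \<open>g\<close>: trace-zero coordinates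
  by its first component and scalar parts by the second.
\<close>

definition point :: "(nat \<times> 'n \<times> 'n \<Rightarrow> 'f) \<times> (nat \<Rightarrow> 'f) \<Rightarrow> nat \<Rightarrow> 'f^'n^'n"
  where "point g l = (\<Sum>(r, q)\<in>UNIV - {(a, a)}. mscale (fst g (l, r, q)) (sl_elt a r q))
    + mscale (snd g l) (mat 1)"

lemma coord_point:
  assumes "(r, q) \<noteq> (a, a)"
  shows "coord a r q (point g l) = fst g (l, r, q)"
proof -
  have f: "functional (coord a r q :: 'f^'n^'n \<Rightarrow> 'f)" by (rule functional_coord)
  have "coord a r q (point g l)
      = (\<Sum>x\<in>UNIV - {(a, a)}. fst g (l, fst x, snd x) * coord a r q (sl_elt a (fst x) (snd x)))"
    using f by (simp add: point_def functional_sum[OF f] functional_def coord_one case_prod_unfold)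
  also have "\<dots> = (\<Sum>x\<in>UNIV - {(a, a)}. if x = (r, q) then fst g (l, r, q) else 0)"
    by (intro sum.cong refl) (auto simp: coord_sl_elt[OF assms])
  finally show ?thesis using assms by simp
qed

lemma scalar_coord_point: "scalar_coord (point g l) = snd g l"
proof -
  have f: "functional (scalar_coord :: 'f^'n^'n \<Rightarrow> 'f)" by (rule functional_coord)
  show ?thesis
    using f by (simp add: point_def functional_sum[OF f] functional_def scalar_coord_simps
        case_prod_unfold)
qed

abbreviation tval :: "(nat \<times> 'n \<times> 'n) list \<times> nat list \<times> ('f^'n^'n) \<Rightarrow> ('f, nat \<times> ('f, 'n) uop) falg"
  where "tval x \<equiv> nf (fst x) (snd (snd x)) * zp (fst (snd x))"

abbreviation tkey :: "(nat \<times> 'n \<times> 'n) list \<times> nat list \<times> ('f^'n^'n) \<Rightarrow>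
    (nat \<times> 'n \<times> 'n) multiset \<times> nat multiset"
  where "tkey x \<equiv> (mset (fst x), mset (fst (snd x)))"

abbreviation teval ::
  "(nat \<times> 'n \<times> 'n \<Rightarrow> 'f) \<times> (nat \<Rightarrow> 'f) \<Rightarrow> (nat \<times> 'n \<times> 'n) list \<times> nat list \<times> ('f^'n^'n) \<Rightarrow> 'f^'n^'n"
  where "teval g x \<equiv> mscale (monomial (tkey x) g) (snd (snd x))"

text \<open>
  A triple in the list holds the \<open>X\<close>-sources, the \<open>Z\<close>-indices and the matrix of a normal form. The
  last condition, on the values at all points, is carried along because the ideal is arbitrary
  and its elements need not be identities.
\<close>

definition has_normal_form :: "('f, nat \<times> ('f, 'n) uop) falg \<Rightarrow> bool"
  where "has_normal_form p \<longleftrightarrow> (\<exists>ts. (\<forall>x\<in>set ts. snd (snd x) \<in> nf_coeffs (fst x)) \<and>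
    p \<simeq> sum_list (map tval ts) \<and> (\<forall>g. falg_eval (point g) p = sum_list (map (teval g) ts)))"

lemma has_normal_formI:
  assumes "\<And>x. x \<in> set ts \<Longrightarrow> snd (snd x) \<in> nf_coeffs (fst x)"
    and "p \<simeq> sum_list (map tval ts)" and "\<And>g. falg_eval (point g) p = sum_list (map (teval g) ts)"
  shows "has_normal_form p"
  using assms unfolding has_normal_form_def by blast

lemma has_normal_formE:
  assumes "has_normal_form p"
  obtains ts where "\<forall>x\<in>set ts. snd (snd x) \<in> nf_coeffs (fst x)" "p \<simeq> sum_list (map tval ts)"
    "\<forall>g. falg_eval (point g) p = sum_list (map (teval g) ts)"
  using assms unfolding has_normal_form_def by blast

lemma falg_eval_zero: "falg_eval m 0 = 0"
  using falg_eval_simps(2)[of m 0 0] by simp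

lemma has_normal_form_zero: "has_normal_form 0"
  by (rule has_normal_formI[of "[]"]) (simp_all add: falg_eval_zero)

lemma has_normal_form_cong:
  assumes "has_normal_form q" and "p \<simeq> q" and "\<And>g. falg_eval (point g) p = falg_eval (point g) q"
  shows "has_normal_form p"
proof -
  obtain ts where ts: "\<forall>x\<in>set ts. snd (snd x) \<in> nf_coeffs (fst x)" "q \<simeq> sum_list (map tval ts)"
    "\<forall>g. falg_eval (point g) q = sum_list (map (teval g) ts)"
    using assms(1) by (rule has_normal_formE)
  show ?thesis
  proof (rule has_normal_formI)
    show "snd (snd x) \<in> nf_coeffs (fst x)" if "x \<in> set ts" for x using ts(1) that by (rule bspec)
    show "p \<simeq> sum_list (map tval ts)" by (rule cong_trans[OF assms(2) ts(2)])
    show "falg_eval (point g) p = sum_list (map (teval g) ts)" for g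
      unfolding assms(3) by (rule ts(3)[rule_format])
  qed
qed

lemma has_normal_form_add:
  assumes "has_normal_form p" "has_normal_form q"
  shows "has_normal_form (p + q)"
proof -
  obtain ts where ts: "\<forall>x\<in>set ts. snd (snd x) \<in> nf_coeffs (fst x)" "p \<simeq> sum_list (map tval ts)"
    "\<forall>g. falg_eval (point g) p = sum_list (map (teval g) ts)"
    using assms(1) by (rule has_normal_formE)
  obtain ts' where ts': "\<forall>x\<in>set ts'. snd (snd x) \<in> nf_coeffs (fst x)" "q \<simeq> sum_list (map tval ts')"
    "\<forall>g. falg_eval (point g) q = sum_list (map (teval g) ts')"
    using assms(2) by (rule has_normal_formE)
  show ?thesis
  proof (rule has_normal_formI[of "ts @ ts'"])
    show "p + q \<simeq> sum_list (map tval (ts @ ts'))" using cong_add[OF ts(2) ts'(2)] by simp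
    show "snd (snd x) \<in> nf_coeffs (fst x)" if "x \<in> set (ts @ ts')" for x
      using ts(1) ts'(1) that by (simp only: set_append Un_iff) blast
    show "falg_eval (point g) (p + q) = sum_list (map (teval g) (ts @ ts'))" for g
      by (simp only: falg_eval_simps(1) ts(3)[rule_format] ts'(3)[rule_format] map_append sum_list_append)
  qed
qed

lemma has_normal_form_sum:
  "(\<And>k. k \<in> K \<Longrightarrow> has_normal_form (f k)) \<Longrightarrow> has_normal_form (sum f K)"
  by (rule additive_sum[where P = has_normal_form]) (auto intro: has_normal_form_zero has_normal_form_add)

lemma cong_sum_list: "(\<And>x. x \<in> set xs \<Longrightarrow> f x \<simeq> g x) \<Longrightarrow> sum_list (map f xs) \<simeq> sum_list (map g xs)"
  by (induction xs) (auto intro: cong_add)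

lemma has_normal_form_mult:
  assumes "has_normal_form p" "has_normal_form q"
  shows "has_normal_form (p * q)"
proof -
  obtain ts where ts: "\<forall>x\<in>set ts. snd (snd x) \<in> nf_coeffs (fst x)" "p \<simeq> sum_list (map tval ts)"
    "\<forall>g. falg_eval (point g) p = sum_list (map (teval g) ts)"
    using assms(1) by (rule has_normal_formE)
  obtain ts' where ts': "\<forall>x\<in>set ts'. snd (snd x) \<in> nf_coeffs (fst x)" "q \<simeq> sum_list (map tval ts')"
    "\<forall>g. falg_eval (point g) q = sum_list (map (teval g) ts')"
    using assms(2) by (rule has_normal_formE)
  define mul :: "((nat \<times> 'n \<times> 'n) list \<times> nat list \<times> ('f^'n^'n)) \<times>
      ((nat \<times> 'n \<times> 'n) list \<times> nat list \<times> ('f^'n^'n)) \<Rightarrow>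
      (nat \<times> 'n \<times> 'n) list \<times> nat list \<times> ('f^'n^'n)"
    where "mul = (\<lambda>(x, y). (fst x @ fst y, fst (snd x) @ fst (snd y), snd (snd x) ** snd (snd y)))"
  let ?P = "List.product ts ts'"
  show ?thesis
  proof (rule has_normal_formI[of "map mul ?P"])
    have split: "snd (snd (fst w)) \<in> nf_coeffs (fst (fst w)) \<and> snd (snd (snd w)) \<in> nf_coeffs (fst (snd w))"
      if "w \<in> set ?P" for w
      using that ts(1) ts'(1) by (simp add: set_product mem_Times_iff)
    show "snd (snd x) \<in> nf_coeffs (fst x)" if "x \<in> set (map mul ?P)" for x
    proof -
      obtain w where w: "w \<in> set ?P" "x = mul w" using \<open>x \<in> set (map mul ?P)\<close> by (auto simp del: set_product)
      then show ?thesis using split[OF w(1)] by (simp add: mul_def case_prod_unfold dom_mult)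
    qed
    have "p * q \<simeq> sum_list (map tval ts) * sum_list (map tval ts')"
      by (intro cong_mult ts(2) ts'(2))
    also have "\<dots> = sum_list (map (\<lambda>(x, y). tval x * tval y) ?P)"
      by (intro sum_list_biadditive) (simp_all add: algebra_simps)
    also have "\<dots> \<simeq> sum_list (map (\<lambda>x. tval (mul x)) ?P)"
    proof (rule cong_sum_list)
      fix w assume "w \<in> set ?P"
      from split[OF this] show "(case w of (x, y) \<Rightarrow> tval x * tval y) \<simeq> tval (mul w)"
        by (simp add: mul_def case_prod_unfold nf_zp_mult)
    qed
    finally show "p * q \<simeq> sum_list (map tval (map mul ?P))" by (simp add: comp_def)
    fix g
    have "falg_eval (point g) (p * q) = sum_list (map (teval g) ts) ** sum_list (map (teval g) ts')"
      by (simp only: falg_eval_mult ts(3)[rule_format] ts'(3)[rule_format])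
    also have "\<dots> = sum_list (map (\<lambda>(x, y). teval g x ** teval g y) ?P)"
      by (intro sum_list_biadditive) (simp_all add: matrix_ring_simps matrix_zero_mult)
    also have "(\<lambda>(x, y). teval g x ** teval g y) = (\<lambda>x. teval g (mul x))"
      by (auto simp: fun_eq_iff mul_def mscale_simps monomial_def mult_ac)
    finally show "falg_eval (point g) (p * q) = sum_list (map (teval g) (map mul ?P))"
      by (simp add: comp_def)
  qed
qed

lemma has_normal_form_const: "has_normal_form (fscale c 1)"
proof (rule has_normal_formI[of "[([], [], mscale c (mat 1))]"])
  show "falg_eval (point g) (fscale c 1) = sum_list (map (teval g) [([], [], mscale c (mat 1))])" for g
    using falg_eval_simps(4)[of "point g" "[]"]
    by (simp add: falg_eval_simps(3) monomial_def word_poly_Nil mscale_simps)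
qed (simp_all add: zp_def mat_def)

lemma has_normal_form_fscale: "has_normal_form p \<Longrightarrow> has_normal_form (fscale c p)"
  using has_normal_form_mult[OF has_normal_form_const, of p c] by (simp flip: fscale_mult_left)

lemma has_normal_form_xl:
  assumes "(r, q) \<noteq> (a, a)" "s \<in> sl"
  shows "has_normal_form (xl (l, r, q) s)"
proof (rule has_normal_formI[of "[([(l, r, q)], [], s)]"])
  show "falg_eval (point g) (xl (l, r, q) s) = sum_list (map (teval g) [([(l, r, q)], [], s)])" for g
    using assms by (simp add: xl_def falg_eval_simps(5) Rep_coord coord_point monomial_def)
qed (use assms in \<open>simp_all add: zp_def\<close>)

lemma has_normal_form_zl: "has_normal_form (zl l)"
proof (rule has_normal_formI[of "[([], [l], mat 1)]"])
  show "snd (snd x) \<in> nf_coeffs (fst x)" if "x \<in> set [([], [l], mat 1)]" for x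
    using that by (auto intro!: image_eqI[of _ _ 1] simp: mscale_simps)
  show "falg_eval (point g) (zl l) = sum_list (map (teval g) [([], [l], mat 1)])" for g
    by (simp add: zl_def falg_eval_simps(5) Rep_scalar scalar_coord_point monomial_def)
qed (simp_all add: zp_def mat_def fscale_one)

text \<open>
  Decomposing the argument of \<open>u\<close> into coordinates writes \<open>u\<close> as a sum of operators of rank one with
  targets in \<open>sl\<close> and a multiple of the projection to the scalar part.
\<close>

lemma has_normal_form_letter: "has_normal_form (letter (l, u))"
proof -
  obtain c where c: "Rep_uop u (mat 1) = mscale c (mat 1)" using Rep_uop_blocks(1) by blast
  let ?K = "UNIV - {(a, a)}"
  define v where "v x = Rep_uop u (sl_elt a (fst x) (snd x))" for x
  let ?p = "(\<Sum>x\<in>?K. xl (l, x) (v x)) + fscale c (zl l)"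
  have v: "v x \<in> sl" for x by (simp add: v_def Rep_uop_blocks(2))
  have R: "Rep_uop u A = (\<Sum>x\<in>?K. mscale (coord a (fst x) (snd x) A) (v x))
      + mscale (scalar_coord A) (mscale c (mat 1))" for A
  proof -
    have "Rep_uop u A = Rep_uop u ((\<Sum>(r, q)\<in>?K. mscale (coord a r q A) (sl_elt a r q))
        + mscale (scalar_coord A) (mat 1))"
      by (rule arg_cong[OF coord_decomp])
    then show ?thesis by (simp add: Rep_uop_linear c case_prod_unfold v_def)
  qed
  have nf: "has_normal_form ?p"
    by (intro has_normal_form_add has_normal_form_sum has_normal_form_fscale has_normal_form_zl)
      (auto intro!: has_normal_form_xl v)
  show ?thesis
  proof (rule has_normal_form_cong[OF nf])
    define w :: "('f, 'n) uop" where "w = Abs_uop (\<lambda>A. mscale c (mscale (scalar_coord A) (mat 1)))"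
    have w: "Rep_uop w A = mscale c (mscale (scalar_coord A) (mat 1))" for A
      unfolding w_def Rep_uop_Abs[OF ops_mscale[OF ops_scalar_coord]] ..
    have "uvar l u = (\<Sum>x\<in>?K. uvar l (rank_one_uop (coord a (fst x) (snd x)) (v x))) + uvar l w"
      by (rule uvar_sum) (simp_all add: R w Rep_coord[OF v] mscale_simps mult.commute)
    also have "uvar l w = upoly_scale c (uvar l scalar_uop)"
      by (rule uvar_scale) (simp add: w Rep_scalar)
    also have "(\<Sum>x\<in>?K. uvar l (rank_one_uop (coord a (fst x) (snd x)) (v x)))
        = (\<Sum>x\<in>?K. abs_upoly (xl (l, x) (v x)))"
      by (simp add: xl_def abs_upoly_letter)
    also have "\<dots> = abs_upoly (\<Sum>x\<in>?K. xl (l, x) (v x))"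
    proof -
      have "abs_upoly (\<Sum>x\<in>J. xl (l, x) (v x)) = (\<Sum>x\<in>J. abs_upoly (xl (l, x) (v x)))"
        if "finite J" for J
        using that by (induction J) (simp_all add: abs_upoly_zero abs_upoly_simps const_free_sum)
      then show ?thesis by simp
    qed
    finally show "letter (l, u) \<simeq> ?p"
      by (intro congI')
        (simp_all add: abs_upoly_simps const_free_sum abs_upoly_letter zl_def)
    fix g
    have sum: "falg_eval m (sum f J) = (\<Sum>x\<in>J. falg_eval m (f x))"
      for m :: "nat \<Rightarrow> 'f^'n^'n" and f and J :: "('n \<times> 'n) set"
      by (induction J rule: infinite_finite_induct) (simp_all add: falg_eval_zero falg_eval_simps)
    have x: "falg_eval (point g) (xl (l, x) (v x)) = mscale (coord a (fst x) (snd x) (point g l)) (v x)" for x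
      unfolding xl_def falg_eval_simps(5) Rep_coord[OF v] by simp
    have z: "falg_eval (point g) (zl l) = mscale (scalar_coord (point g l)) (mat 1)"
      unfolding zl_def falg_eval_simps(5) Rep_scalar ..
    show "falg_eval (point g) (letter (l, u)) = falg_eval (point g) ?p"
      unfolding falg_eval_simps(1,3,5) sum x z R[of "point g l"] by (simp add: mscale_simps mult.commute)
  qed
qed

lemma has_normal_form_all: "has_normal_form p"
proof (induction p rule: falg_induct)
  case (word w)
  show ?case
  proof (induction w)
    case Nil
    then show ?case using has_normal_form_const[of 1] by (simp add: word_poly_Nil fscale_one)
  next
    case (Cons s w)
    then show ?case
      by (cases s) (simp add: word_poly_Cons has_normal_form_mult has_normal_form_letter)
  qed
qed (auto intro: has_normal_form_add has_normal_form_fscale)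

lemma nf_sum_list:
  assumes "\<forall>x\<in>set xs. h x \<in> nf_coeffs L"
  shows "nf L (sum_list (map h xs)) \<simeq> sum_list (map (\<lambda>x. nf L (h x)) xs)
    \<and> sum_list (map h xs) \<in> nf_coeffs L"
  using assms
proof (induction xs)
  case Nil
  have 0: "0 \<in> nf_coeffs L"
    by (cases L rule: nf_coeffs.cases) (auto intro!: image_eqI[of _ _ 0] simp: mscale_simps)
  then show ?case using lin_on_zero[OF nf_lin 0] by simp
next
  case (Cons x xs)
  have add: "s + t \<in> nf_coeffs L" if "s \<in> nf_coeffs L" "t \<in> nf_coeffs L" for s t
    using that by (cases L rule: nf_coeffs.cases) (auto simp flip: mscale_simps(2))
  have "nf L (h x + sum_list (map h xs)) \<simeq> nf L (h x) + nf L (sum_list (map h xs))"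
    using Cons by (intro lin_on_add[OF nf_lin]) auto
  also have "\<dots> \<simeq> nf L (h x) + sum_list (map (\<lambda>x. nf L (h x)) xs)"
    using Cons by (intro cong_add cong_refl) auto
  finally show ?case using Cons add by simp
qed

text \<open>
  Grouping the normal forms of an identity by their multisets of sources, the values at all
  points give a linear relation between monomials with matrix coefficients, so each group has
  coefficient sum zero; and the sum of a group is congruent to a normal form of that coefficient.
\<close>

theorem Id_U_subset: "Id_U \<subseteq> I"
proof
  fix f :: "('f, 'n) upoly" assume f: "f \<in> Id_U"
  obtain p where p: "f = abs_upoly p" "const_free p" by (rule upoly_cases)
  have ev: "falg_eval m p = 0" for m
    using f by (simp add: Id_U_def p abs_upoly_simps)
  obtain ts where ts: "\<forall>x\<in>set ts. snd (snd x) \<in> nf_coeffs (fst x)" "p \<simeq> sum_list (map tval ts)"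
    "\<forall>g. falg_eval (point g) p = sum_list (map (teval g) ts)"
    using has_normal_form_all[of p] by (rule has_normal_formE)
  define part where "part \<kappa> = filter (\<lambda>x. tkey x = \<kappa>) ts" for \<kappa>
  define c where "c \<kappa> = sum_list (map (\<lambda>x. snd (snd x)) (part \<kappa>))" for \<kappa>
  have part_key: "x \<in> set ts" "tkey x = \<kappa>" if "x \<in> set (part \<kappa>)" for x \<kappa>
    using that unfolding part_def set_filter mem_Collect_eq
    by (rule conjunct1, rule conjunct2)
  let ?K = "tkey ` set ts"
  have c0: "c \<kappa> = 0" if \<kappa>: "\<kappa> \<in> ?K" for \<kappa>
  proof -
    have "(\<Sum>\<kappa>\<in>?K. mscale (monomial \<kappa> g) (c \<kappa>)) = 0" for g
    proof -
      have "sum_list (map (teval g) (part \<kappa>)) = mscale (monomial \<kappa> g) (c \<kappa>)" for \<kappa>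
      proof -
        have "sum_list (map (teval g) xs) = mscale (monomial \<kappa> g) (sum_list (map (\<lambda>x. snd (snd x)) xs))"
          if "\<forall>x\<in>set xs. tkey x = \<kappa>" for xs
          using that
        proof (induction xs)
          case (Cons x xs)
          have k: "tkey x = \<kappa>" using Cons.prems list.set_intros(1) by (rule bspec)
          have IH: "sum_list (map (teval g) xs)
              = mscale (monomial \<kappa> g) (sum_list (map (\<lambda>x. snd (snd x)) xs))"
            using Cons.prems by (intro Cons.IH ballI) (blast intro: list.set_intros(2))
          show ?case unfolding list.map sum_list.Cons k IH mscale_simps(1) ..
        qed (simp add: mscale_simps)
        then show ?thesis unfolding c_def using part_key by blast
      qed
      then have "(\<Sum>\<kappa>\<in>?K. mscale (monomial \<kappa> g) (c \<kappa>))
          = (\<Sum>\<kappa>\<in>?K. sum_list (map (teval g) (part \<kappa>)))" by (simp only:)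
      also have "\<dots> = sum_list (map (teval g) ts)"
        unfolding part_def by (rule sum_list_group[symmetric]) simp_all
      also have "\<dots> = 0" by (simp only: ev flip: ts(3)[rule_format])
      finally show ?thesis .
    qed
    moreover have "(\<Sum>\<kappa>\<in>?K. c \<kappa> $ u $ v * monomial \<kappa> g)
        = (\<Sum>\<kappa>\<in>?K. mscale (monomial \<kappa> g) (c \<kappa>)) $ u $ v" for g u v
      by (simp add: sum_component mult.commute)
    ultimately have sum0: "(\<Sum>\<kappa>\<in>?K. c \<kappa> $ u $ v * monomial \<kappa> g) = 0" for g u v
      by (simp only: zero_index)
    have "c \<kappa> $ u $ v = 0" for u v
      by (rule monomials_independent[of ?K "\<lambda>\<kappa>. c \<kappa> $ u $ v"]) (simp_all only: sum0 \<kappa> finite_imageI finite_set)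
    then show ?thesis by (simp add: vec_eq_iff)
  qed
  have part0: "sum_list (map tval (part \<kappa>)) \<simeq> 0" if \<kappa>: "\<kappa> \<in> ?K" for \<kappa>
  proof -
    obtain y where y: "y \<in> set ts" "tkey y = \<kappa>" using \<kappa> by blast
    define L zs where "L = fst y" and "zs = fst (snd y)"
    have mem: "snd (snd x) \<in> nf_coeffs L \<and> mset (fst x) = mset L \<and> mset (fst (snd x)) = mset zs"
      if "x \<in> set (part \<kappa>)" for x
    proof -
      note x = part_key[OF that]
      then have "mset (fst x) = mset L" "mset (fst (snd x)) = mset zs"
        using y by (auto simp: L_def zs_def)
      moreover from this have "nf_coeffs (fst x) = nf_coeffs L" by (intro dom_length mset_eq_length)
      moreover have "snd (snd x) \<in> nf_coeffs (fst x)" using ts(1) x(1) by (rule bspec)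
      ultimately show ?thesis by (simp only: simp_thms)
    qed
    have "sum_list (map tval (part \<kappa>)) \<simeq> sum_list (map (\<lambda>x. nf L (snd (snd x)) * zp zs) (part \<kappa>))"
    proof (rule cong_sum_list)
      fix x assume "x \<in> set (part \<kappa>)"
      then have x: "snd (snd x) \<in> nf_coeffs L" "mset (fst x) = mset L" "mset (fst (snd x)) = mset zs"
        using mem by blast+
      then have "nf_coeffs (fst x) = nf_coeffs L" by (intro dom_length mset_eq_length)
      then show "tval x \<simeq> nf L (snd (snd x)) * zp zs"
        using x by (intro nf_zp_perm) (simp_all only:)
    qed
    also have "\<dots> = sum_list (map (\<lambda>x. nf L (snd (snd x))) (part \<kappa>)) * zp zs"
      by (simp add: sum_list_mult_const)
    also have "\<dots> \<simeq> nf L (c \<kappa>) * zp zs"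
      unfolding c_def using mem
      by (intro cong_mult cong_refl cong_sym[OF conjunct1[OF nf_sum_list]]) auto
    also have "\<dots> \<simeq> 0 * zp zs"
      unfolding c0[OF \<kappa>] using nf_sum_list[of "[]" _ L] by (intro cong_mult cong_refl) simp
    finally show ?thesis by simp
  qed
  have "p \<simeq> (\<Sum>\<kappa>\<in>?K. sum_list (map tval (part \<kappa>)))"
  proof -
    have "sum_list (map tval ts) = (\<Sum>\<kappa>\<in>?K. sum_list (map tval (part \<kappa>)))"
      unfolding part_def by (rule sum_list_group) simp_all
    then show ?thesis using ts(2) by (simp only:)
  qed
  also have "\<dots> \<simeq> (\<Sum>\<kappa>\<in>?K. 0)" by (intro cong_sum part0)
  finally have "p \<in> ideal_reps I"
    using I by (simp add: cong_def ideal_gen_reps TU_ideal_def)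
  then show "f \<in> I" by (simp add: ideal_reps_def p)
qed

end


section \<open>Nilpotent models\<close>

text \<open>
  A model is the nilpotent algebra \<open>M \<oplus> M \<oplus> End(M)\<close>, where \<open>M\<close> is the matrix space, in which the
  product of two elements is the value of \<open>B\<close> at their components in \<open>M \<oplus> M\<close> and lies in \<open>End(M)\<close>,
  while all other products vanish. The maps \<open>l1\<close>, \<open>l2\<close> and \<open>Q\<close> are the components of an equivariant
  homomorphism into it. Two copies of \<open>M\<close> are needed to distinguish the order of the factors, and
  \<open>End(M)\<close> is used since for two-by-two matrices the first generator has no equivariant image other
  than zero in \<open>M\<close>.
\<close>

definition model_hom ::
  "(('f::field^'n::finite^'n) \<times> ('f^'n^'n) \<Rightarrow> ('f^'n^'n) \<times> ('f^'n^'n) \<Rightarrow> 'f^'n^'n \<Rightarrow> 'f^'n^'n) \<Rightarrow>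
    (('f, 'n) upoly \<Rightarrow> 'f^'n^'n) \<Rightarrow> (('f, 'n) upoly \<Rightarrow> 'f^'n^'n) \<Rightarrow>
    (('f, 'n) upoly \<Rightarrow> 'f^'n^'n \<Rightarrow> 'f^'n^'n) \<Rightarrow> bool"
  where "model_hom B l1 l2 Q \<longleftrightarrow> equivariant l1 \<and> equivariant l2 \<and>
    (\<forall>f h. l1 (f * h) = 0 \<and> l2 (f * h) = 0) \<and>
    (\<forall>f h X. Q (f + h) X = Q f X + Q h X) \<and>
    (\<forall>c f X. Q (upoly_scale c f) X = mscale c (Q f X)) \<and>
    (\<forall>d f X. Q (upoly_der d f) X = Rep_der d (Q f X) - Q f (Rep_der d X)) \<and>
    (\<forall>f h X. Q (f * h) X = B (l1 f, l2 f) (l1 h, l2 h) X)"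

definition model_identities ::
  "(('f::field^'n::finite^'n) \<times> ('f^'n^'n) \<Rightarrow> ('f^'n^'n) \<times> ('f^'n^'n) \<Rightarrow> 'f^'n^'n \<Rightarrow> 'f^'n^'n) \<Rightarrow>
    ('f, 'n) upoly set"
  where "model_identities B =
    {f. \<forall>l1 l2 Q. model_hom B l1 l2 Q \<longrightarrow> l1 f = 0 \<and> l2 f = 0 \<and> (\<forall>X. Q f X = 0)}"

lemma model_homD:
  assumes "model_hom B l1 l2 Q"
  shows "equivariant l1" "equivariant l2" "l1 (f * h) = 0" "l2 (f * h) = 0"
    "Q (f + h) X = Q f X + Q h X" "Q (upoly_scale c f) X = mscale c (Q f X)"
    "Q (upoly_der d f) X = Rep_der d (Q f X) - Q f (Rep_der d X)"
    "Q (f * h) X = B (l1 f, l2 f) (l1 h, l2 h) X"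
  using assms unfolding model_hom_def by blast+

lemma model_hom_diff:
  assumes "model_hom B l1 l2 Q"
  shows "Q (f - h) X = Q f X - Q h X"
  using model_homD(5)[OF assms, of "f - h" h X] by simp

definition pair_der :: "('f::field, 'n::finite) der \<Rightarrow> ('f^'n^'n) \<times> ('f^'n^'n) \<Rightarrow> ('f^'n^'n) \<times> ('f^'n^'n)"
  where "pair_der d p = (Rep_der d (fst p), Rep_der d (snd p))"

definition pair_scale :: "'f::field \<Rightarrow> ('f^'n::finite^'n) \<times> ('f^'n^'n) \<Rightarrow> ('f^'n^'n) \<times> ('f^'n^'n)"
  where "pair_scale c p = (mscale c (fst p), mscale c (snd p))"

text \<open>
  The last condition is the equivariance of \<open>B\<close>, with respect to the commutator with \<open>d\<close> on \<open>End(M)\<close>;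
  it makes \<open>d\<close> a derivation of the model.
\<close>

locale nilpotent_model =
  fixes B :: "('f::field^'n::finite^'n) \<times> ('f^'n^'n) \<Rightarrow> ('f^'n^'n) \<times> ('f^'n^'n) \<Rightarrow> 'f^'n^'n \<Rightarrow> 'f^'n^'n"
  assumes add: "B (p + p') q X = B p q X + B p' q X" "B p (q + q') X = B p q X + B p q' X"
    and scale: "B (pair_scale c p) q X = mscale c (B p q X)" "B p (pair_scale c q) X = mscale c (B p q X)"
    and der: "B (pair_der d p) q X + B p (pair_der d q) X = Rep_der d (B p q X) - B p q (Rep_der d X)"
begin

lemma zero: "B 0 q X = 0" "B p 0 X = 0"
  using add(1)[of 0 0 q X] add(2)[of p 0 0 X] by simp_all

lemma TU_ideal_model: "TU_ideal (model_identities B)"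
  unfolding TU_ideal_def upoly_ideal_def
proof (intro conjI allI ballI impI)
  show "0 \<in> model_identities B"
    unfolding model_identities_def
  proof (intro CollectI allI impI conjI)
    fix l1 l2 Q X assume *: "model_hom B l1 l2 Q"
    show "l1 0 = 0" "l2 0 = 0" using model_homD(1,2)[OF *] equivariant_zero by blast+
    show "Q 0 X = 0" using model_homD(5)[OF *, of 0 0 X] by simp
  qed
  fix f assume f: "f \<in> model_identities B"
  note F = f[unfolded model_identities_def mem_Collect_eq, rule_format]
  show "f + h \<in> model_identities B" if h: "h \<in> model_identities B" for h
    unfolding model_identities_def
  proof (intro CollectI allI impI)
    fix l1 l2 Q assume *: "model_hom B l1 l2 Q"
    note H = h[unfolded model_identities_def mem_Collect_eq, rule_format, OF *]
    show "l1 (f + h) = 0 \<and> l2 (f + h) = 0 \<and> (\<forall>X. Q (f + h) X = 0)"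
      using F[OF *] H model_homD(1,2)[OF *] model_homD(5)[OF *] by (simp add: equivariant_def)
  qed
  show "upoly_scale c f \<in> model_identities B" for c
    unfolding model_identities_def
  proof (intro CollectI allI impI)
    fix l1 l2 Q assume *: "model_hom B l1 l2 Q"
    show "l1 (upoly_scale c f) = 0 \<and> l2 (upoly_scale c f) = 0 \<and> (\<forall>X. Q (upoly_scale c f) X = 0)"
      using F[OF *] model_homD(1,2)[OF *] model_homD(6)[OF *] by (simp add: equivariant_def mscale_simps)
  qed
  show "h * f \<in> model_identities B" "f * h \<in> model_identities B" for h
    unfolding model_identities_def
  proof (safe intro!: CollectI)
    fix l1 l2 Q X assume *: "model_hom B l1 l2 Q"
    show "l1 (h * f) = 0" "l2 (h * f) = 0" "l1 (f * h) = 0" "l2 (f * h) = 0"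
      by (rule model_homD(3,4)[OF *])+
    show "Q (h * f) X = 0" "Q (f * h) X = 0"
      using F[OF *] by (simp_all add: model_homD(8)[OF *] zero[unfolded zero_prod_def])
  qed
  show "upoly_der d f \<in> model_identities B" for d
    unfolding model_identities_def
  proof (intro CollectI allI impI)
    fix l1 l2 Q assume *: "model_hom B l1 l2 Q"
    show "l1 (upoly_der d f) = 0 \<and> l2 (upoly_der d f) = 0 \<and> (\<forall>X. Q (upoly_der d f) X = 0)"
      using F[OF *] model_homD(1,2)[OF *] model_homD(7)[OF *] by (simp add: equivariant_def Rep_der_simps)
  qed
  fix \<psi> :: "('f, 'n) upoly \<Rightarrow> ('f, 'n) upoly"
  assume \<psi>: "upoly_endo \<psi> \<and> (\<forall>d f. \<psi> (upoly_der d f) = upoly_der d (\<psi> f))"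
  show "\<psi> f \<in> model_identities B"
    unfolding model_identities_def
  proof (intro CollectI allI impI)
    fix l1 l2 Q assume *: "model_hom B l1 l2 Q"
    have "model_hom B (\<lambda>f. l1 (\<psi> f)) (\<lambda>f. l2 (\<psi> f)) (\<lambda>f. Q (\<psi> f))"
      using * \<psi> unfolding model_hom_def equivariant_def upoly_endo_def by simp
    from F[OF this] show "l1 (\<psi> f) = 0 \<and> l2 (\<psi> f) = 0 \<and> (\<forall>X. Q (\<psi> f) X = 0)" by simp
  qed
qed

end

subsection \<open>Existence of homomorphisms into a model\<close>

text \<open>
  The linear part, evaluated at \<open>m\<close>.
\<close>

definition lin_part ::
  "(nat \<Rightarrow> 'f::field^'n::finite^'n) \<Rightarrow> ('f, nat \<times> ('f, 'n) uop) falg \<Rightarrow> 'f^'n^'n"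
  where "lin_part m =
    lin_ext mscale (\<lambda>w. case w of [s] \<Rightarrow> Rep_uop (snd s) (m (fst s)) | _ \<Rightarrow> 0)"

lemma lin_part_simps:
  "lin_part m (p + q) = lin_part m p + lin_part m q"
  "lin_part m (p - q) = lin_part m p - lin_part m q"
  "lin_part m (fscale c p) = mscale c (lin_part m p)"
  "lin_part m (word_poly w) = (case w of [s] \<Rightarrow> Rep_uop (snd s) (m (fst s)) | _ \<Rightarrow> 0)"
  "lin_part m 0 = 0"
  using lin_ext_diff[OF module_mscale, of "\<lambda>w. case w of [s] \<Rightarrow> Rep_uop (snd s) (m (fst s)) | _ \<Rightarrow> 0" 0 0]
  by (simp_all add: lin_part_def lin_ext_add lin_ext_diff lin_ext_fscale lin_ext_word module_mscale)

lemma lin_part_letter: "lin_part m (letter s) = Rep_uop (snd s) (m (fst s))"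
  using lin_part_simps(4)[of m "[s]"] by (simp add: word_poly_singleton)

lemma lookup_word_poly: "Poly_Mapping.lookup (word_poly w) 0 = (if w = [] then 1 else 0)"
  by (simp add: word_poly_def lookup_single zero_fword_def when_def)

lemma lin_part_mult:
  "lin_part m (p * q) = mscale (Poly_Mapping.lookup p 0) (lin_part m q)
    + mscale (Poly_Mapping.lookup q 0) (lin_part m p)"
proof (induction p rule: falg_induct)
  case (word v)
  show ?case
  proof (induction q rule: falg_induct)
    case (word w)
    then show ?case
      by (auto simp: lin_part_simps lookup_word_poly mscale_simps append_eq_Cons_conv
          simp flip: word_poly_append split: list.split)
  next
    case (add p q)
    then show ?case by (simp add: distrib_left lin_part_simps lookup_add mscale_simps)
  next
    case (scale c p)
    then show ?case
      by (simp add: lin_part_simps lookup_fscale mscale_simps mult.commute flip: fscale_mult_right)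
  qed
next
  case (add p q)
  then show ?case by (simp add: distrib_right lin_part_simps lookup_add mscale_simps)
next
  case (scale c p)
  then show ?case
    by (simp add: lin_part_simps lookup_fscale mscale_simps mult.commute flip: fscale_mult_left)
qed

lemma lin_part_der: "lin_part m (falg_der d p) = Rep_der d (lin_part m p)"
proof (induction p rule: falg_induct)
  case (word w)
  show ?case
  proof (cases w)
    case Nil
    then show ?thesis by (simp add: falg_der_simps(4) lin_part_simps Rep_der_simps)
  next
    case (Cons s w')
    have "Poly_Mapping.lookup (word_der d w') 0 = 0"
      using lookup_falg_der_zero[of d "word_poly w'"] by (simp add: falg_der_simps(4))
    then show ?thesis
      unfolding Cons falg_der_simps(4) word_der.simps
      by (simp add: word_poly_Cons lin_part_simps(1) lin_part_mult lin_part_letter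
          lookup_letter_zero lookup_word_poly Rep_der_comp Rep_der_simps mscale_simps)
  qed
qed (simp_all add: falg_der_simps lin_part_simps Rep_der_simps)

context nilpotent_model
begin

definition pair_part :: "(nat \<Rightarrow> 'f^'n^'n) \<Rightarrow> (nat \<Rightarrow> 'f^'n^'n) \<Rightarrow>
    ('f, nat \<times> ('f, 'n) uop) falg \<Rightarrow> ('f^'n^'n) \<times> ('f^'n^'n)"
  where "pair_part m m' p = (lin_part m p, lin_part m' p)"

lemma pair_part_simps:
  "pair_part m m' (p + q) = pair_part m m' p + pair_part m m' q"
  "pair_part m m' (fscale c p) = pair_scale c (pair_part m m' p)"
  "pair_part m m' (falg_der d p) = pair_der d (pair_part m m' p)"
  by (simp_all add: pair_part_def lin_part_simps lin_part_der pair_scale_def pair_der_def)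

definition quad_part :: "(nat \<Rightarrow> 'f^'n^'n) \<Rightarrow> (nat \<Rightarrow> 'f^'n^'n) \<Rightarrow>
    ('f, nat \<times> ('f, 'n) uop) falg \<Rightarrow> 'f^'n^'n \<Rightarrow> 'f^'n^'n"
  where "quad_part m m' p X = lin_ext mscale (\<lambda>w. case w of
    [s, t] \<Rightarrow> B (pair_part m m' (letter s)) (pair_part m m' (letter t)) X | _ \<Rightarrow> 0) p"

lemma quad_part_simps:
  "quad_part m m' (p + q) X = quad_part m m' p X + quad_part m m' q X"
  "quad_part m m' (p - q) X = quad_part m m' p X - quad_part m m' q X"
  "quad_part m m' (fscale c p) X = mscale c (quad_part m m' p X)"
  "quad_part m m' (word_poly w) X = (case w of
    [s, t] \<Rightarrow> B (pair_part m m' (letter s)) (pair_part m m' (letter t)) X | _ \<Rightarrow> 0)"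
  "quad_part m m' 0 X = 0"
  "quad_part m m' (letter s) X = 0"
proof -
  show d: "quad_part m m' (p - q) X = quad_part m m' p X - quad_part m m' q X" for p q
    by (simp add: quad_part_def lin_ext_diff module_mscale)
  show "quad_part m m' 0 X = 0" using d[of 0 0] by simp
  show w: "quad_part m m' (word_poly w) X = (case w of
    [s, t] \<Rightarrow> B (pair_part m m' (letter s)) (pair_part m m' (letter t)) X | _ \<Rightarrow> 0)" for w
    by (simp add: quad_part_def lin_ext_word module_mscale)
  show "quad_part m m' (letter s) X = 0" using w[of "[s]"] by (simp add: word_poly_singleton)
qed (simp_all add: quad_part_def lin_ext_add lin_ext_fscale module_mscale)

lemma pair_part_word:
  "pair_part m m' (word_poly w) = (case w of [s] \<Rightarrow> pair_part m m' (letter s) | _ \<Rightarrow> 0)"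
  by (auto simp: pair_part_def lin_part_simps(4) lin_part_letter zero_prod_def split: list.split)

lemma quad_part_mult:
  "quad_part m m' (p * q) X = mscale (Poly_Mapping.lookup p 0) (quad_part m m' q X)
    + B (pair_part m m' p) (pair_part m m' q) X
    + mscale (Poly_Mapping.lookup q 0) (quad_part m m' p X)"
proof (induction p rule: falg_induct)
  case (word v)
  show ?case
  proof (induction q rule: falg_induct)
    case (word w)
    then show ?case
      by (cases v rule: remdups_adj.cases; cases w rule: remdups_adj.cases)
        (auto simp: quad_part_simps(4) pair_part_word lookup_word_poly mscale_simps zero
          simp flip: word_poly_append split: list.split)
  next
    case (add p q)
    then show ?case
      by (simp add: distrib_left quad_part_simps pair_part_simps lookup_add mscale_simps nilpotent_model.add[OF nilpotent_model_axioms])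
  next
    case (scale c p)
    have "quad_part m m' (word_poly v * fscale c p) X = mscale c (quad_part m m' (word_poly v * p) X)"
      by (simp add: quad_part_simps flip: fscale_mult_right)
    then show ?case using scale
      by (simp add: quad_part_simps(3) pair_part_simps lookup_fscale mscale_simps mult.commute nilpotent_model.scale[OF nilpotent_model_axioms])
  qed
next
  case (add p q)
  then show ?case
    by (simp add: distrib_right quad_part_simps pair_part_simps lookup_add mscale_simps nilpotent_model.add[OF nilpotent_model_axioms])
next
  case (scale c p)
  have "quad_part m m' (fscale c p * q) X = mscale c (quad_part m m' (p * q) X)"
    by (simp add: quad_part_simps flip: fscale_mult_left)
  then show ?case using scale
    by (simp add: quad_part_simps(3) pair_part_simps lookup_fscale mscale_simps mult.commute nilpotent_model.scale[OF nilpotent_model_axioms])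
qed

lemma quad_part_der:
  "quad_part m m' (falg_der d p) X = Rep_der d (quad_part m m' p X) - quad_part m m' p (Rep_der d X)"
proof (induction p rule: falg_induct)
  case (word w)
  show ?case
  proof (cases w)
    case Nil
    then show ?thesis by (simp add: falg_der_simps(4) quad_part_simps Rep_der_simps)
  next
    case (Cons s w')
    have "Poly_Mapping.lookup (word_der d w') 0 = 0"
      using lookup_falg_der_zero[of d "word_poly w'"] by (simp add: falg_der_simps(4))
    moreover have "pair_part m m' (word_der d w') = pair_der d (pair_part m m' (word_poly w'))"
      using pair_part_simps(3)[of m m' d "word_poly w'"] by (simp add: falg_der_simps(4))
    moreover have "pair_part m m' (letter (fst s, der_comp d (snd s))) = pair_der d (pair_part m m' (letter s))"
      by (simp add: pair_part_def lin_part_letter pair_der_def Rep_der_comp)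
    ultimately show ?thesis
      unfolding Cons falg_der_simps(4) word_der.simps
      by (simp add: word_poly_Cons quad_part_simps(1,6) quad_part_mult
          lookup_letter_zero mscale_simps der)
  qed
next
  case (add p q)
  then show ?case by (simp add: falg_der_simps quad_part_simps Rep_der_simps)
next
  case (scale c p)
  have "mscale c (A - B) = mscale c A - mscale c B" for A B :: "'f^'n^'n"
    by (simp add: vec_eq_iff algebra_simps)
  then show ?case using scale by (simp add: falg_der_simps quad_part_simps Rep_der_simps)
qed

lemma parts_lin_rels:
  "p \<in> ideal_gen lin_rels \<Longrightarrow>
    Poly_Mapping.lookup p 0 = 0 \<and> lin_part m p = 0 \<and> lin_part m' p = 0 \<and> quad_part m m' p X = 0"
proof (induction p rule: ideal_gen.induct)
  case zero
  then show ?case by (simp add: lin_part_simps quad_part_simps)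
next
  case (base r)
  then show ?case
    by (auto simp: lin_rels_def lin_part_simps lin_part_letter quad_part_simps lookup_minus lookup_add
        lookup_fscale lookup_letter_zero mscale_simps)
next
  case (add p q)
  then show ?case by (simp add: lin_part_simps quad_part_simps lookup_add)
next
  case (left p c)
  then have "pair_part m m' p = 0" by (simp add: pair_part_def zero_prod_def)
  then show ?case using left
    by (simp add: lin_part_mult quad_part_mult lookup_mult_zero mscale_simps zero)
next
  case (right p c)
  then have "pair_part m m' p = 0" by (simp add: pair_part_def zero_prod_def)
  then show ?case using right
    by (simp add: lin_part_mult quad_part_mult lookup_mult_zero mscale_simps zero)
qed

text \<open>
  Values at the variables can be prescribed: only the words of length one and two matter.
\<close>

lemma model_hom_exists:
  obtains l1 l2 Q where "model_hom B l1 l2 Q"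
    and "\<And>i u. l1 (uvar i u) = Rep_uop u (m i)" and "\<And>i u. l2 (uvar i u) = Rep_uop u (m' i)"
proof -
  define l1 l2 Q where "l1 f = lin_part m (rep_upoly f)" and "l2 f = lin_part m' (rep_upoly f)"
    and "Q f X = quad_part m m' (rep_upoly f) X" for f X
  have rep: "l1 (abs_upoly p) = lin_part m p" "l2 (abs_upoly p) = lin_part m' p"
    "Q (abs_upoly p) X = quad_part m m' p X" if "const_free p" for p X
  proof -
    obtain r where r: "rep_upoly (abs_upoly p) = r" by simp
    have "const_free r"
      using Quotient3_rep_reflp[OF Quotient3_upoly, of "abs_upoly p"] by (simp add: const_free_def r)
    moreover have "abs_upoly r = abs_upoly p"
      using Quotient3_abs_rep[OF Quotient3_upoly, of "abs_upoly p"] by (simp add: r)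
    ultimately have "r - p \<in> ideal_gen lin_rels" using that eq_upoly_iff by blast
    from parts_lin_rels[OF this] show "l1 (abs_upoly p) = lin_part m p" "l2 (abs_upoly p) = lin_part m' p"
      "Q (abs_upoly p) X = quad_part m m' p X"
      by (simp_all add: l1_def l2_def Q_def r lin_part_simps quad_part_simps)
  qed
  have "model_hom B l1 l2 Q"
    unfolding model_hom_def equivariant_def
  proof (intro conjI allI)
    fix f h :: "('f, 'n) upoly" and c d X
    obtain p where p: "f = abs_upoly p" "const_free p" by (rule upoly_cases)
    obtain q where q: "h = abs_upoly q" "const_free q" by (rule upoly_cases)
    have z: "Poly_Mapping.lookup p 0 = 0" "Poly_Mapping.lookup q 0 = 0"
      using p q by (simp_all add: const_free_def)
    note R = p q rep z pair_part_def
    show "l1 (f + h) = l1 f + l1 h" "l2 (f + h) = l2 f + l2 h" "Q (f + h) X = Q f X + Q h X"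
      "l1 (upoly_scale c f) = mscale c (l1 f)" "l2 (upoly_scale c f) = mscale c (l2 f)"
      "Q (upoly_scale c f) X = mscale c (Q f X)" "l1 (f * h) = 0" "l2 (f * h) = 0"
      "l1 (upoly_der d f) = Rep_der d (l1 f)" "l2 (upoly_der d f) = Rep_der d (l2 f)"
      "Q (upoly_der d f) X = Rep_der d (Q f X) - Q f (Rep_der d X)"
      "Q (f * h) X = B (l1 f, l2 f) (l1 h, l2 h) X"
      by (simp_all add: R lin_part_simps quad_part_simps lin_part_mult quad_part_mult lin_part_der
          quad_part_der mscale_simps flip: abs_upoly_simps)
  qed
  moreover have "l1 (uvar i u) = Rep_uop u (m i)" "l2 (uvar i u) = Rep_uop u (m' i)" for i u
    using rep(1,2)[of "letter (i, u)"] by (simp_all add: abs_upoly_letter lin_part_letter)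
  ultimately show ?thesis using that by blast
qed

lemma diff_in_model_iff:
  "uvar i u * uvar j v - uvar i' u' * uvar j' v' \<in> model_identities B \<longleftrightarrow>
    (\<forall>m m' X. B (Rep_uop u (m i), Rep_uop u (m' i)) (Rep_uop v (m j), Rep_uop v (m' j)) X
      = B (Rep_uop u' (m i'), Rep_uop u' (m' i')) (Rep_uop v' (m j'), Rep_uop v' (m' j')) X)"
    (is "?f \<in> _ \<longleftrightarrow> ?R")
proof
  assume L: "?f \<in> model_identities B"
  show ?R
  proof (intro allI)
    fix m m' X
    obtain l1 l2 Q where *: "model_hom B l1 l2 Q"
      "\<And>i u. l1 (uvar i u) = Rep_uop u (m i)" "\<And>i u. l2 (uvar i u) = Rep_uop u (m' i)"
      using model_hom_exists by blast
    then have "Q ?f X = 0" using L by (simp add: model_identities_def)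
    then show "B (Rep_uop u (m i), Rep_uop u (m' i)) (Rep_uop v (m j), Rep_uop v (m' j)) X
        = B (Rep_uop u' (m i'), Rep_uop u' (m' i')) (Rep_uop v' (m j'), Rep_uop v' (m' j')) X"
      by (simp add: model_hom_diff[OF *(1)] model_homD(8)[OF *(1)] *)
  qed
next
  assume R: ?R
  show "?f \<in> model_identities B"
    unfolding model_identities_def
  proof (intro CollectI allI impI)
    fix l1 l2 Q assume *: "model_hom B l1 l2 Q"
    have Q: "Q (uvar i u * uvar j v) X = B (Rep_uop u (l1 (base_var i)), Rep_uop u (l2 (base_var i)))
        (Rep_uop v (l1 (base_var j)), Rep_uop v (l2 (base_var j))) X" for i u j v X
      unfolding model_homD(8)[OF *] equivariant_uvar[OF model_homD(1)[OF *], of _ u]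
        equivariant_uvar[OF model_homD(2)[OF *], of _ u]
        equivariant_uvar[OF model_homD(1)[OF *], of _ v]
        equivariant_uvar[OF model_homD(2)[OF *], of _ v] ..
    have "Q ?f X = 0" for X
      unfolding model_hom_diff[OF *] Q
      using R[rule_format, of "\<lambda>i. l1 (base_var i)" "\<lambda>i. l2 (base_var i)" X] by simp
    then show "l1 ?f = 0 \<and> l2 ?f = 0 \<and> (\<forall>X. Q ?f X = 0)"
      by (simp add: equivariant_diff[OF model_homD(1)[OF *]] equivariant_diff[OF model_homD(2)[OF *]]
          model_homD(3,4)[OF *])
  qed
qed

lemma pair_in_model_iff:
  "uvar i u * uvar j v \<in> model_identities B \<longleftrightarrow>
    (\<forall>m m' X. B (Rep_uop u (m i), Rep_uop u (m' i)) (Rep_uop v (m j), Rep_uop v (m' j)) X = 0)"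
proof -
  define z :: "('f, 'n) uop" where "z = Abs_uop (\<lambda>A. 0)"
  have z: "Rep_uop z A = 0" for A by (simp add: z_def Rep_uop_Abs[OF ops_zero])
  have "uvar i z = 0" by (rule uvar_zero[OF z])
  then show ?thesis
    using diff_in_model_iff[of i u j v i z j v] by (simp add: z zero[unfolded zero_prod_def])
qed

end

subsection \<open>The four models\<close>

definition sl_part :: "'f::field^'n::finite^'n \<Rightarrow> 'f^'n^'n"
  where "sl_part A = A - mscale (scalar_coord A) (mat 1)"

lemma sl_part_simps:
  fixes A B :: "'f::field_char_0^'n::finite^'n"
  shows "sl_part (A + B) = sl_part A + sl_part B" "sl_part (mscale c A) = mscale c (sl_part A)"
    "sl_part (mscale c (mat 1)) = (0 :: 'f^'n^'n)" "A \<in> sl \<Longrightarrow> sl_part A = A"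
    "Rep_der d (sl_part A) = Rep_der d A" "sl_part (Rep_der d A) = Rep_der d A"
proof -
  show "sl_part (A + B) = sl_part A + sl_part B"
    by (simp add: sl_part_def scalar_coord_simps mscale_simps)
  show "sl_part (mscale c A) = mscale c (sl_part A)"
    by (simp add: sl_part_def scalar_coord_simps vec_eq_iff algebra_simps)
  show "sl_part (mscale c (mat 1)) = (0 :: 'f^'n^'n)"
    by (simp add: sl_part_def scalar_coord_simps)
  show sl: "A \<in> sl \<Longrightarrow> sl_part A = A" for A :: "'f^'n^'n"
    by (simp add: sl_part_def scalar_coord_simps mscale_simps)
  show "sl_part (Rep_der d A) = Rep_der d A" by (rule sl[OF Rep_der_sl])
  have "Rep_der d (sl_part A) = Rep_der d A - Rep_der d (mscale (scalar_coord A) (mat 1))"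
    using Rep_der_simps(1)[of d "sl_part A" "mscale (scalar_coord A) (mat 1)"]
    by (simp add: sl_part_def)
  then show "Rep_der d (sl_part A) = Rep_der d A" by (simp add: Rep_der_simps Rep_der_one mscale_simps)
qed

lemma Rep_der_mult: "Rep_der d (A ** B) = Rep_der d A ** B + A ** Rep_der d B"
  using Rep_der[of d] by (simp add: is_matrix_derivation_def)

lemma trace_Rep_der: "trace (Rep_der d A) = 0" for A :: "'f::field_char_0^'n::finite^'n"
  using Rep_der_sl[of d A] by (simp add: sl_def)

text \<open>
  These products keep the factors apart by an argument \<open>X\<close>, so that they vanish only if one factor
  does; the first generator is not an identity of this model.
\<close>

interpretation sandwich: nilpotent_model
  "\<lambda>p q X :: 'f::field_char_0^'n::finite^'n. sl_part (fst p) ** X ** sl_part (fst q)"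
  by unfold_locales
    (simp_all add: pair_der_def pair_scale_def sl_part_simps matrix_ring_simps Rep_der_mult)

text \<open>
  The first factor is read in one copy and the second factor in the other one, so this product
  is not symmetric in the variables, against the second generator.
\<close>

interpretation ordered: nilpotent_model
  "\<lambda>p q X :: 'f::field_char_0^'n::finite^'n. sl_part (fst p) ** sl_part (snd q) ** X"
  by unfold_locales
    (simp_all add: pair_der_def pair_scale_def sl_part_simps matrix_ring_simps Rep_der_mult)

text \<open>
  Only the scalar parts are multiplied here, in a way that depends on the order, against the
  third generator.
\<close>

interpretation scalars: nilpotent_model
  "\<lambda>p q X :: 'f::field_char_0^'n::finite^'n. mscale (trace (fst p) * trace (snd q)) X"
  by unfold_locales
    (simp_all add: pair_der_def pair_scale_def trace_simps trace_Rep_der Rep_der_simps mscale_simps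
      algebra_simps)

text \<open>
  The scalar part of a left factor acts but that of a right factor does not, against the fourth
  generator.
\<close>

interpretation left_trace: nilpotent_model
  "\<lambda>p q X :: 'f::field_char_0^'n::finite^'n. mscale (trace (fst p)) (fst q ** X)"
  by unfold_locales
    (simp_all add: pair_der_def pair_scale_def trace_simps trace_Rep_der Rep_der_simps mscale_simps
      matrix_ring_simps Rep_der_mult mult.commute)


section \<open>Generation and minimality\<close>

locale generators =
  fixes a b :: "'n::finite" and e :: "'f::field_char_0^'n^'n" and i j :: nat
  assumes ab: "a \<noteq> b" and ij: "i \<noteq> j"
    and e: "e = munit a b \<and> UNIV = {a, b} \<or> (\<exists>c. c \<noteq> a \<and> c \<noteq> b \<and> e = munit c a)"
begin

definition entry :: "nat \<Rightarrow> 'f^'n^'n \<Rightarrow> ('f, 'n) upoly"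
  where "entry l v = uvar l (rank_one_uop (\<lambda>A. A $ a $ b) v)"

definition scal :: "nat \<Rightarrow> ('f, 'n) upoly"
  where "scal l = uvar l scalar_uop"

definition g1 where "g1 = entry i (munit a b) * entry j e"
definition g2 where "g2 = entry i (munit a b) * entry j (munit b a) - entry j (munit a b) * entry i (munit b a)"
definition g3 where "g3 = scal i * scal j - scal j * scal i"
definition g4 where "g4 = scal i * entry j (munit a b) - entry j (munit a b) * scal i"

lemma units_sl: "munit a b \<in> (sl :: ('f^'n^'n) set)" "munit b a \<in> (sl :: ('f^'n^'n) set)" "e \<in> sl"
  using e ab by auto

lemma Rep_entry:
  fixes v :: "'f^'n^'n"
  assumes "v \<in> sl"
  shows "Rep_uop (rank_one_uop (\<lambda>A. A $ a $ b) v) A = mscale (A $ a $ b) v"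
  using Rep_rank_one[OF functional_entry, of a b v] ab assms by (simp add: mat_def)

lemmas Rep = Rep_entry[OF units_sl(1)] Rep_entry[OF units_sl(2)] Rep_entry[OF units_sl(3)] Rep_scalar

lemma e12_e: "munit a b ** e = 0"
  using e ab by (auto simp: munit_mult)

lemma trace_units: "trace (munit a b :: 'f^'n^'n) = 0" "trace (munit b a :: 'f^'n^'n) = 0" "trace e = 0"
  using units_sl by (simp_all add: sl_def)

lemma sl_part_units:
  "sl_part (munit a b) = (munit a b :: 'f^'n^'n)" "sl_part (munit b a) = (munit b a :: 'f^'n^'n)"
  "sl_part e = e" "sl_part (mat 1) = (0 :: 'f^'n^'n)"
proof -
  have "sl_part (mscale 1 (mat 1)) = (0 :: 'f^'n^'n)" by (rule sl_part_simps(3))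
  then show "sl_part (mat 1) = (0 :: 'f^'n^'n)" by (simp add: mscale_simps)
qed (use units_sl in \<open>simp_all add: sl_part_simps(4)\<close>)

lemmas gens = g1_def g2_def g3_def g4_def entry_def scal_def
lemmas evals = Rep trace_simps trace_units sl_part_simps(2,3) sl_part_units matrix_ring_simps
  matrix_zero_mult e12_e munit_mult ab ab[symmetric]

lemma g_hom: "{g1, g2, g3, g4} \<subseteq> hom_identities"
proof -
  have "\<eta> g1 = 0 \<and> \<eta> g2 = 0 \<and> \<eta> g3 = 0 \<and> \<eta> g4 = 0" if h: "equivariant_hom \<eta>" for \<eta>
    using ab
    by (simp add: gens equivariant_homD(2-6)[OF h] equivariant_homD(7)[OF h, of _ "rank_one_uop _ _"]
        evals mult.commute)
  then show ?thesis by (auto simp: hom_identities_def)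
qed

lemma generator_ideal:
  assumes "TU_ideal I" and "{g1, g2, g3, g4} \<subseteq> I"
  shows "generator_ideal I a b e i j"
  by unfold_locales (use assms ab ij e in \<open>auto simp: gens commutator_def\<close>)

lemma TU_generated_eq: "TU_generated {g1, g2, g3, g4} = Id_U"
proof
  show "TU_generated {g1, g2, g3, g4} \<subseteq> Id_U"
    using hom_identities_TU g_hom hom_identities_subset unfolding TU_generated_def by blast
  show "Id_U \<subseteq> TU_generated {g1, g2, g3, g4}"
    unfolding TU_generated_def
    using generator_ideal.Id_U_subset[OF generator_ideal] by blast
qed

lemma independent1: "\<exists>J. TU_ideal J \<and> {g2, g3, g4} \<subseteq> J \<and> g1 \<notin> J"
proof (intro exI conjI)
  let ?B = "\<lambda>p q X :: 'f^'n^'n. sl_part (fst p) ** X ** sl_part (fst q)"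
  show "TU_ideal (model_identities ?B)" by (rule sandwich.TU_ideal_model)
  show "{g2, g3, g4} \<subseteq> model_identities ?B"
    by (simp add: gens sandwich.diff_in_model_iff evals mult.commute)
  obtain c d where cd: "e = munit c d" using e by blast
  have "munit a b ** munit b c ** e \<noteq> 0"
  proof -
    have "munit a b ** munit b c ** e = munit a d" by (simp add: munit_mult cd)
    moreover have "(munit a d :: 'f^'n^'n) $ a $ d = 1" by (simp add: munit_nth)
    ultimately show ?thesis by (metis zero_index zero_neq_one)
  qed
  then have "\<exists>m m' :: nat \<Rightarrow> 'f^'n^'n. \<exists>X. mscale (m i $ a $ b) (mscale (m j $ a $ b) (munit a b ** X ** e)) \<noteq> 0"
    by (intro exI[of _ "\<lambda>_. munit a b"] exI[of _ "munit b c"]) (simp add: munit_nth mscale_simps)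
  then show "g1 \<notin> model_identities ?B"
    by (simp add: gens sandwich.pair_in_model_iff evals mult.commute)
qed

lemma independent2: "\<exists>J. TU_ideal J \<and> {g1, g3, g4} \<subseteq> J \<and> g2 \<notin> J"
proof (intro exI conjI)
  let ?B = "\<lambda>p q X :: 'f^'n^'n. sl_part (fst p) ** sl_part (snd q) ** X"
  show "TU_ideal (model_identities ?B)" by (rule ordered.TU_ideal_model)
  show "{g1, g3, g4} \<subseteq> model_identities ?B"
    by (simp add: gens ordered.diff_in_model_iff ordered.pair_in_model_iff evals)
  show "g2 \<notin> model_identities ?B"
  proof
    assume "g2 \<in> model_identities ?B"
    then have *: "mscale (m' j $ a $ b * m i $ a $ b) (munit a a ** X)
        = mscale (m' i $ a $ b * m j $ a $ b) (munit a a ** X)"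
      for m m' :: "nat \<Rightarrow> 'f^'n^'n" and X :: "'f^'n^'n"
      by (simp add: gens ordered.diff_in_model_iff evals)
    from *[of "\<lambda>l. if l = i then munit a b else 0" "\<lambda>l. if l = j then munit a b else 0" "mat 1"]
    have "(munit a a :: 'f^'n^'n) = 0" using ij by (simp add: munit_nth mscale_simps)
    moreover have "(munit a a :: 'f^'n^'n) $ a $ a = 1" by (simp add: munit_nth)
    ultimately show False by (metis zero_index zero_neq_one)
  qed
qed

lemma independent3: "\<exists>J. TU_ideal J \<and> {g1, g2, g4} \<subseteq> J \<and> g3 \<notin> J"
proof (intro exI conjI)
  let ?B = "\<lambda>p q X :: 'f^'n^'n. mscale (trace (fst p) * trace (snd q)) X"
  show "TU_ideal (model_identities ?B)" by (rule scalars.TU_ideal_model)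
  show "{g1, g2, g4} \<subseteq> model_identities ?B"
    by (simp add: gens scalars.diff_in_model_iff scalars.pair_in_model_iff evals)
  show "g3 \<notin> model_identities ?B"
  proof
    assume "g3 \<in> model_identities ?B"
    then have *: "mscale (scalar_coord (m i) * trace (mat 1 :: 'f^'n^'n) * (scalar_coord (m' j) * trace (mat 1 :: 'f^'n^'n))) X
        = mscale (scalar_coord (m j) * trace (mat 1 :: 'f^'n^'n) * (scalar_coord (m' i) * trace (mat 1 :: 'f^'n^'n))) X"
      for m m' :: "nat \<Rightarrow> 'f^'n^'n" and X :: "'f^'n^'n"
      by (simp add: gens scalars.diff_in_model_iff evals)
    from *[of "\<lambda>l. if l = i then mat 1 else 0" "\<lambda>l. if l = j then mat 1 else 0" "munit a a"]
    have "mscale (of_nat CARD('n) * of_nat CARD('n)) (munit a a :: 'f^'n^'n) = 0"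
      using ij by (simp add: scalar_coord_simps trace_I mscale_simps scalar_coord_def[of 0] trace_zero)
    then have "mscale (of_nat CARD('n) * of_nat CARD('n)) (munit a a :: 'f^'n^'n) $ a $ a = 0" by simp
    then show False by (simp add: munit_nth)
  qed
qed

lemma independent4: "\<exists>J. TU_ideal J \<and> {g1, g2, g3} \<subseteq> J \<and> g4 \<notin> J"
proof (intro exI conjI)
  let ?B = "\<lambda>p q X :: 'f^'n^'n. mscale (trace (fst p)) (fst q ** X)"
  show "TU_ideal (model_identities ?B)" by (rule left_trace.TU_ideal_model)
  show "{g1, g2, g3} \<subseteq> model_identities ?B"
    by (simp add: gens left_trace.diff_in_model_iff left_trace.pair_in_model_iff evals mult_ac)
  show "g4 \<notin> model_identities ?B"
  proof
    assume "g4 \<in> model_identities ?B"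
    then have *: "mscale (scalar_coord (m i) * trace (mat 1 :: 'f^'n^'n)) (mscale (m j $ a $ b) (munit a b ** X)) = 0"
      for m :: "nat \<Rightarrow> 'f^'n^'n" and X :: "'f^'n^'n"
      by (simp add: gens left_trace.diff_in_model_iff evals)
    from *[of "\<lambda>l. if l = i then mat 1 else munit a b" "mat 1"]
    have "mscale (of_nat CARD('n)) (munit a b :: 'f^'n^'n) = 0"
      using ij by (simp add: scalar_coord_simps trace_I mscale_simps munit_nth)
    then have "mscale (of_nat CARD('n)) (munit a b :: 'f^'n^'n) $ a $ b = 0" by simp
    then show False by (simp add: munit_nth)
  qed
qed

lemma minimal:
  assumes "H \<subset> {g1, g2, g3, g4}"
  shows "TU_generated H \<noteq> Id_U"
proof -
  have sub: "{g1, g2, g3, g4} \<subseteq> Id_U" using g_hom hom_identities_subset by blast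
  have "\<exists>J. TU_ideal J \<and> H \<subseteq> J \<and> \<not> {g1, g2, g3, g4} \<subseteq> J"
  proof -
    from assms consider "g1 \<notin> H" | "g2 \<notin> H" | "g3 \<notin> H" | "g4 \<notin> H" by blast
    then show ?thesis
    proof cases
      case 1
      then have "H \<subseteq> {g2, g3, g4}" using assms by blast
      then show ?thesis using independent1 by blast
    next
      case 2
      then have "H \<subseteq> {g1, g3, g4}" using assms by blast
      then show ?thesis using independent2 by blast
    next
      case 3
      then have "H \<subseteq> {g1, g2, g4}" using assms by blast
      then show ?thesis using independent3 by blast
    next
      case 4
      then have "H \<subseteq> {g1, g2, g3}" using assms by blast
      then show ?thesis using independent4 by blast
    qed
  qed
  then obtain J where "TU_ideal J" "H \<subseteq> J" "\<not> {g1, g2, g3, g4} \<subseteq> J" by blast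
  moreover from this have "TU_generated H \<subseteq> J" unfolding TU_generated_def by blast
  ultimately show ?thesis using sub by blast
qed

end

theorem theorem4p1p9:
  fixes \<iota> :: "nat \<Rightarrow> 'n::finite" and i j :: nat
    and e12 e21 e g :: "'f::field_char_0^'n^'n"
    and x y :: "'f^'n^'n \<Rightarrow> 'f^'n^'n \<Rightarrow> ('f, 'n) upoly"
    and G :: "('f, 'n) upoly set"
  assumes k: "CARD('n) \<ge> 2"
    and \<iota>: "bij_betw \<iota> {1..CARD('n)} UNIV"
    and ij: "i \<noteq> j"
  defines "e12 \<equiv> matrix_unit \<iota> 1 2"
    and "e21 \<equiv> matrix_unit \<iota> 2 1"
    and "e \<equiv> (if CARD('n) = 2 then matrix_unit \<iota> 1 2 else matrix_unit \<iota> 3 1)"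
    and "g \<equiv> mat 1"
    and "x \<equiv> uvar_elem \<iota> i"
    and "y \<equiv> uvar_elem \<iota> j"
    and "G \<equiv>
      {x e12 e12 * y e12 e,
       x e12 e12 * y e12 e21 - y e12 e12 * x e12 e21,
       commutator (x g g) (y g g),
       commutator (x g g) (y e12 e12)}"
  shows "TU_generated G = Id_U \<and> (\<forall>H. H \<subset> G \<longrightarrow> TU_generated H \<noteq> Id_U)"
proof -
  have inj: "\<iota> l \<noteq> \<iota> l'" if "l \<in> {1..CARD('n)}" "l' \<in> {1..CARD('n)}" "l \<noteq> l'" for l l'
    using inj_on_eq_iff[OF bij_betw_imp_inj_on[OF \<iota>] that(1,2)] that(3) by simp
  have 12: "\<iota> 1 \<noteq> \<iota> 2" using k by (intro inj) auto
  have e: "e = munit (\<iota> 1) (\<iota> 2) \<and> UNIV = {\<iota> 1, \<iota> 2} \<or>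
      (\<exists>c. c \<noteq> \<iota> 1 \<and> c \<noteq> \<iota> 2 \<and> e = munit c (\<iota> 1))"
  proof (cases "CARD('n) = 2")
    case True
    have "UNIV = \<iota> ` {1..CARD('n)}" using \<iota> by (simp add: bij_betw_def)
    also have "{1..CARD('n)} = {1, 2}" using True by auto
    finally show ?thesis using True by (simp add: e_def matrix_unit_munit)
  next
    case False
    then have "\<iota> 3 \<noteq> \<iota> 1" "\<iota> 3 \<noteq> \<iota> 2" using k by (intro inj; simp)+
    then show ?thesis using False by (auto simp: e_def matrix_unit_munit)
  qed
  interpret generators "\<iota> 1" "\<iota> 2" e i j
    by unfold_locales (use 12 ij e in auto)
  have e12: "uvar_elem \<iota> l (munit (\<iota> 1) (\<iota> 2)) v = entry l v" for l v
    unfolding uvar_elem_def entry_def elem_op_e12[OF k \<iota>] rank_one_uop_def ..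
  have gg: "uvar_elem \<iota> l (mat 1) (mat 1) = scal l" for l
    unfolding uvar_elem_def scal_def elem_op_one[OF \<iota>] rank_one_uop_def ..
  have "G = {g1, g2, g3, g4}"
    unfolding G_def x_def y_def e12_def e21_def g_def matrix_unit_munit commutator_def e12 gg
    by (simp only: g1_def g2_def g3_def g4_def)
  then show ?thesis using TU_generated_eq minimal by simp
qed

end
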